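(* Let $R$ be a graded ring supported in non-negative degrees. The category of Gröbner-coherent $R$-modules is an abelian subcategory of the category of all graded $R$-modules, and it is closed under extension.
   Context: Rings are commutative with unit; gradings are by $\mathbb{Z}$; the category of graded $R$-modules has the degree-preserving $R$-linear maps as morphisms, and the Gröbner-coherent modules are regarded as a full subcategory. Being an abelian subcategory means being closed under kernels, cokernels and finite direct sums formed in the ambient category; closed under extension means that if $0\to M'\to M\to M''\to 0$ is an exact sequence of graded modules with $M'$ and $M''$ Gröbner-coherent then $M$ is Gröbner-coherent. Graded modules $M$ are assumed to satisfy $M_n=0$ for $n\ll 0$. For a nonzero $x=\sum_n x_n\in M$ with $x_n\in M_n$, $\deg(x)$ is the maximal $n$ with $x_n\ne 0$ and $\mathrm{in}(x)=x_{\deg(x)}$; set $\deg(0)=-\infty$, $\mathrm{in}(0)=0$. For a (not necessarily homogeneous) submodule $N\subset M$, $\mathrm{in}(N)$ is the homogeneous submodule generated by $\mathrm{in}(x)$ over all nonzero $x\in N$. A Gröbner basis for $N$ is a collection of elements of $N$ whose initial terms generate $\mathrm{in}(N)$ as an $R$-module. A graded module is graded-coherent if it is finitely generated and every finitely generated homogeneous submodule is finitely presented. A graded module $M$ is Gröbner-coherent if it is graded-coherent and every finitely generated, not necessarily homogeneous, submodule of $M$ admits a finite Gröbner basis. *)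

theory Defs
  imports "HOL-Algebra.Algebra" "HOL.Hull"
begin

section \<open>Graded rings and graded modules\<close>

record 'a graded_ring = "'a ring" +
  rgrade :: "int \<Rightarrow> 'a set"

record ('a, 'b) graded_module = "('a, 'b) module" +
  mgrade :: "int \<Rightarrow> 'b set"

definition hom_decomp ::
    "('b, 'c) ring_scheme \<Rightarrow> (int \<Rightarrow> 'b set) \<Rightarrow> 'b \<Rightarrow> (int \<Rightarrow> 'b) \<Rightarrow> bool" where
  "hom_decomp G D x c \<longleftrightarrow>
     (\<forall>n. c n \<in> D n) \<and> finite {n. c n \<noteq> \<zero>\<^bsub>G\<^esub>} \<and>
     x = (\<Oplus>\<^bsub>G\<^esub>n\<in>{n. c n \<noteq> \<zero>\<^bsub>G\<^esub>}. c n)"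

text \<open>The additive group \<open>G\<close> is the internal direct sum of the subgroups \<open>D n\<close>.\<close>

definition grading :: "('b, 'c) ring_scheme \<Rightarrow> (int \<Rightarrow> 'b set) \<Rightarrow> bool" where
  "grading G D \<longleftrightarrow>
     (\<forall>n. additive_subgroup (D n) G) \<and> (\<forall>x\<in>carrier G. \<exists>!c. hom_decomp G D x c)"

locale graded_ring = cring R for R :: "('a, 'c) graded_ring_scheme" (structure) +
  assumes grading: "grading R (rgrade R)"
    and one_grade: "\<one> \<in> rgrade R 0"
    and mult_grade: "\<lbrakk>a \<in> rgrade R i; b \<in> rgrade R j\<rbrakk> \<Longrightarrow> a \<otimes> b \<in> rgrade R (i + j)"

text \<open>Boundedness below is part of the notion of graded module used throughout.\<close>

locale graded_module = R?: graded_ring R + M?: module R M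
  for R :: "('a, 'c) graded_ring_scheme" (structure)
  and M :: "('a, 'b, 'd) graded_module_scheme" (structure) +
  assumes mgrading: "grading M (mgrade M)"
    and smult_grade: "\<lbrakk>a \<in> rgrade R i; x \<in> mgrade M j\<rbrakk> \<Longrightarrow> a \<odot>\<^bsub>M\<^esub> x \<in> mgrade M (i + j)"
    and bounded_below: "\<exists>n0. \<forall>n<n0. mgrade M n = {\<zero>\<^bsub>M\<^esub>}"

section \<open>Homomorphisms\<close>

definition mod_hom ::
    "('a, 'r) ring_scheme \<Rightarrow> ('a, 'b, 'c) module_scheme \<Rightarrow> ('a, 'd, 'e) module_scheme
      \<Rightarrow> ('b \<Rightarrow> 'd) set" where
  "mod_hom R M N = {f \<in> carrier M \<rightarrow> carrier N.
     (\<forall>x\<in>carrier M. \<forall>y\<in>carrier M. f (x \<oplus>\<^bsub>M\<^esub> y) = f x \<oplus>\<^bsub>N\<^esub> f y) \<and>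
     (\<forall>a\<in>carrier R. \<forall>x\<in>carrier M. f (a \<odot>\<^bsub>M\<^esub> x) = a \<odot>\<^bsub>N\<^esub> f x)}"

definition graded_hom ::
    "('a, 'r) ring_scheme \<Rightarrow> ('a, 'b, 'c) graded_module_scheme
      \<Rightarrow> ('a, 'd, 'e) graded_module_scheme \<Rightarrow> ('b \<Rightarrow> 'd) set" where
  "graded_hom R M N = {f \<in> mod_hom R M N. \<forall>n. f ` mgrade M n \<subseteq> mgrade N n}"

section \<open>Generation and presentation\<close>

definition submodule_span ::
    "('a, 'r) ring_scheme \<Rightarrow> ('a, 'b, 'c) module_scheme \<Rightarrow> 'b set \<Rightarrow> 'b set" where
  "submodule_span R M S = (\<lambda>N. submodule N R M) hull S"

definition finitely_generated ::
    "('a, 'r) ring_scheme \<Rightarrow> ('a, 'b, 'c) module_scheme \<Rightarrow> bool" where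
  "finitely_generated R M \<longleftrightarrow>
     (\<exists>S. finite S \<and> S \<subseteq> carrier M \<and> submodule_span R M S = carrier M)"

text \<open>Only the additive and scalar structure of a \<open>module\<close> record matters; its fields
  \<open>mult\<close> and \<open>one\<close>, inherited from \<open>ring\<close>, are left undefined in the constructions.\<close>

definition free_module :: "('a, 'r) ring_scheme \<Rightarrow> nat \<Rightarrow> ('a, nat \<Rightarrow> 'a) module" where
  "free_module R n =
     \<lparr>carrier = (\<Pi>\<^sub>E i\<in>{..<n}. carrier R), monoid.mult = undefined, one = undefined,
      ring.zero = (\<lambda>i\<in>{..<n}. \<zero>\<^bsub>R\<^esub>),
      add = (\<lambda>x y. \<lambda>i\<in>{..<n}. x i \<oplus>\<^bsub>R\<^esub> y i),
      smult = (\<lambda>a x. \<lambda>i\<in>{..<n}. a \<otimes>\<^bsub>R\<^esub> x i)\<rparr>"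

definition finitely_presented ::
    "('a, 'r) ring_scheme \<Rightarrow> ('a, 'b, 'c) module_scheme \<Rightarrow> bool" where
  "finitely_presented R M \<longleftrightarrow>
     (\<exists>n f. f \<in> mod_hom R (free_module R n) M \<and>
        f ` carrier (free_module R n) = carrier M \<and>
        finitely_generated R
          ((free_module R n)\<lparr>carrier := a_kernel (free_module R n) M f\<rparr>))"

section \<open>Initial terms and Groebner bases\<close>

definition hcomp :: "('a, 'b, 'c) graded_module_scheme \<Rightarrow> 'b \<Rightarrow> int \<Rightarrow> 'b" where
  "hcomp M x = (THE c. hom_decomp M (mgrade M) x c)"

definition homogeneous_submodule ::
    "'b set \<Rightarrow> ('a, 'r) ring_scheme \<Rightarrow> ('a, 'b, 'c) graded_module_scheme \<Rightarrow> bool" where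
  "homogeneous_submodule N R M \<longleftrightarrow> submodule N R M \<and> (\<forall>x\<in>N. \<forall>n. hcomp M x n \<in> N)"

text \<open>The degree is meaningful only for nonzero \<open>x\<close>; the convention that \<open>0\<close> has degree
  \<open>-\<infinity>\<close> and initial term \<open>0\<close> is realised by the case distinction in \<open>init_term\<close>.\<close>

definition mdeg :: "('a, 'b, 'c) graded_module_scheme \<Rightarrow> 'b \<Rightarrow> int" where
  "mdeg M x = Max {n. hcomp M x n \<noteq> \<zero>\<^bsub>M\<^esub>}"

definition init_term :: "('a, 'b, 'c) graded_module_scheme \<Rightarrow> 'b \<Rightarrow> 'b" where
  "init_term M x = (if x = \<zero>\<^bsub>M\<^esub> then \<zero>\<^bsub>M\<^esub> else hcomp M x (mdeg M x))"

definition init_submodule ::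
    "('a, 'r) ring_scheme \<Rightarrow> ('a, 'b, 'c) graded_module_scheme \<Rightarrow> 'b set \<Rightarrow> 'b set" where
  "init_submodule R M N = submodule_span R M (init_term M ` (N - {\<zero>\<^bsub>M\<^esub>}))"

definition groebner_basis ::
    "('a, 'r) ring_scheme \<Rightarrow> ('a, 'b, 'c) graded_module_scheme \<Rightarrow> 'b set \<Rightarrow> 'b set \<Rightarrow> bool" where
  "groebner_basis R M N B \<longleftrightarrow>
     B \<subseteq> N \<and> submodule_span R M (init_term M ` B) = init_submodule R M N"

section \<open>Coherence\<close>

definition graded_coherent ::
    "('a, 'r) graded_ring_scheme \<Rightarrow> ('a, 'b, 'c) graded_module_scheme \<Rightarrow> bool" where
  "graded_coherent R M \<longleftrightarrow>
     graded_module R M \<and> finitely_generated R M \<and>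
     (\<forall>N. homogeneous_submodule N R M \<and> finitely_generated R (M\<lparr>carrier := N\<rparr>)
        \<longrightarrow> finitely_presented R (M\<lparr>carrier := N\<rparr>))"

definition groebner_coherent ::
    "('a, 'r) graded_ring_scheme \<Rightarrow> ('a, 'b, 'c) graded_module_scheme \<Rightarrow> bool" where
  "groebner_coherent R M \<longleftrightarrow>
     graded_coherent R M \<and>
     (\<forall>N. submodule N R M \<and> finitely_generated R (M\<lparr>carrier := N\<rparr>)
        \<longrightarrow> (\<exists>B. finite B \<and> groebner_basis R M N B))"

section \<open>Constructions in the category of graded modules\<close>

definition kernel_module ::
    "('a, 'b) graded_module \<Rightarrow> ('a, 'c) graded_module \<Rightarrow> ('b \<Rightarrow> 'c)
      \<Rightarrow> ('a, 'b) graded_module" where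
  "kernel_module M N f =
     M\<lparr>carrier := a_kernel M N f, mgrade := (\<lambda>n. mgrade M n \<inter> a_kernel M N f)\<rparr>"

text \<open>As for \<open>FactRing\<close>, the quotient is carried by the additive cosets of \<open>I\<close>.\<close>

definition quotient_module ::
    "('a, 'b) graded_module \<Rightarrow> 'b set \<Rightarrow> ('a, 'b set) graded_module" where
  "quotient_module N I =
     \<lparr>carrier = a_rcosets\<^bsub>N\<^esub> I, monoid.mult = undefined, one = undefined,
      ring.zero = I, add = set_add N,
      smult = (\<lambda>a C. \<Union>x\<in>C. I +>\<^bsub>N\<^esub> (a \<odot>\<^bsub>N\<^esub> x)),
      mgrade = (\<lambda>n. (\<lambda>x. I +>\<^bsub>N\<^esub> x) ` mgrade N n)\<rparr>"

definition cokernel_module ::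
    "('a, 'b) graded_module \<Rightarrow> ('a, 'c) graded_module \<Rightarrow> ('b \<Rightarrow> 'c)
      \<Rightarrow> ('a, 'c set) graded_module" where
  "cokernel_module M N f = quotient_module N (f ` carrier M)"

text \<open>Meant for finite index sets only; \<open>I = {}\<close> yields the zero module.\<close>

definition direct_sum_module ::
    "'i set \<Rightarrow> ('i \<Rightarrow> ('a, 'b) graded_module) \<Rightarrow> ('a, 'i \<Rightarrow> 'b) graded_module" where
  "direct_sum_module I M =
     \<lparr>carrier = (\<Pi>\<^sub>E i\<in>I. carrier (M i)), monoid.mult = undefined, one = undefined,
      ring.zero = (\<lambda>i\<in>I. \<zero>\<^bsub>M i\<^esub>),
      add = (\<lambda>x y. \<lambda>i\<in>I. x i \<oplus>\<^bsub>M i\<^esub> y i),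
      smult = (\<lambda>a x. \<lambda>i\<in>I. a \<odot>\<^bsub>M i\<^esub> x i),
      mgrade = (\<lambda>n. \<Pi>\<^sub>E i\<in>I. mgrade (M i) n)\<rparr>"

text \<open>Exactness of \<open>0 \<rightarrow> L \<rightarrow> M \<rightarrow> N \<rightarrow> 0\<close> in the category of graded modules.\<close>

definition short_exact ::
    "('a, 'r) graded_ring_scheme \<Rightarrow> ('a, 'b) graded_module \<Rightarrow> ('a, 'c) graded_module
      \<Rightarrow> ('a, 'd) graded_module \<Rightarrow> ('b \<Rightarrow> 'c) \<Rightarrow> ('c \<Rightarrow> 'd) \<Rightarrow> bool" where
  "short_exact R L M N f g \<longleftrightarrow>
     graded_module R L \<and> graded_module R M \<and> graded_module R N \<and>
     f \<in> graded_hom R L M \<and> g \<in> graded_hom R M N \<and>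
     inj_on f (carrier L) \<and> f ` carrier L = a_kernel M N g \<and> g ` carrier M = carrier N"

end

theory Submission
  imports Defs
begin

text \<open>Filter a graded module \<open>M\<close> by the subgroups \<open>M\<^sub>\<le>\<^sub>d\<close> of elements of degree at most \<open>d\<close>. A submodule
  \<open>V\<close> has a finite Groebner basis iff the induced filtration \<open>V \<inter> M\<^sub>\<le>\<^sub>d\<close> is finitely generated: there
  are \<open>y\<^sub>j \<in> V\<close> of degree at most \<open>e\<^sub>j\<close> such that every element of \<open>V \<inter> M\<^sub>\<le>\<^sub>d\<close> is a combination of
  the \<open>y\<^sub>j\<close> with coefficients in \<open>R\<^sub>\<le>\<^sub>d\<^sub>-\<^sub>e\<^sub>j\<close> (this is homogenization over \<open>R[t]\<close>, without the
  variable \<open>t\<close>). Kernels inherit this condition directly; for cokernels one lifts \<open>V\<close> to its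
  preimage.

  For an extension of \<open>N\<close> by \<open>L\<close> the filtrations on \<open>V \<subseteq> M\<close> are not strictly exact. However, the
  image of \<open>V\<close> in \<open>N\<close> is finitely presented, because relations between leading terms lift to
  relations of a basis; hence \<open>V \<inter> L\<close> is finitely generated and has a filtration basis itself. Adding
  it to generators of \<open>V\<close> yields a finitely generated filtration \<open>F\<close> and a constant \<open>l\<close> with
  \<open>V \<inter> M\<^sub>\<le>\<^sub>d = F\<^sub>d\<^sub>+\<^sub>l \<inter> M\<^sub>\<le>\<^sub>d\<close>. Graded coherence of \<open>M\<close> shows that passing from \<open>F\<^sub>d\<close> to
  \<open>F\<^sub>d\<^sub>+\<^sub>1 \<inter> M\<^sub>\<le>\<^sub>d\<close> preserves finite generation, and \<open>l\<close> such steps suffice.\<close>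

section \<open>Finite sums and linear combinations\<close>

text \<open>The obstacle is that an element of the image of \<open>V\<close> in \<open>N\<close> may
  have smaller degree than every lift of it inside \<open>V\<close>. The constant \<open>l\<close>
  measures this loss: it bounds the excess of degree in the coefficients that write lifts of the
  basis of the image in terms of the given generators. On the side of \<open>L\<close> nothing is
  lost, because an injective degree-preserving map reflects degrees. The total discrepancy is thus
  one constant, and each decrease by one needs only the finitely many homogeneous relations between
  leading parts.

  Two descents on the degree occur, and they stop for different reasons. Division by a Groebner
  basis stops because \<open>M\<close> is bounded below; lifting relations stops because
  \<open>R\<close> vanishes in negative degrees, so that coefficients of sufficiently low degree are
  zero.

  Everything is phrased with finite tuples and explicit coefficients: degree bounds concern single
  coefficients, and the same coefficients are read in several modules at once.\<close>

primrec sumn :: "('b, 'c) ring_scheme \<Rightarrow> nat \<Rightarrow> (nat \<Rightarrow> 'b) \<Rightarrow> 'b" where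
  "sumn G 0 f = \<zero>\<^bsub>G\<^esub>"
| "sumn G (Suc n) f = sumn G n f \<oplus>\<^bsub>G\<^esub> f n"

lemma sumn_cong: "(\<And>i. i < n \<Longrightarrow> f i = g i) \<Longrightarrow> sumn G n f = sumn G n g"
  by (induction n) auto

context abelian_group begin

lemma sumn_closed [intro, simp]: "(\<And>i. i < n \<Longrightarrow> f i \<in> carrier G) \<Longrightarrow> sumn G n f \<in> carrier G"
  by (induction n) auto

lemma sumn_zero: "(\<And>i. i < n \<Longrightarrow> f i = \<zero>) \<Longrightarrow> sumn G n f = \<zero>"
  by (induction n) auto

lemma sumn_add:
  "(\<And>i. i < n \<Longrightarrow> f i \<in> carrier G) \<Longrightarrow> (\<And>i. i < n \<Longrightarrow> g i \<in> carrier G) \<Longrightarrow>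
    sumn G n (\<lambda>i. f i \<oplus> g i) = sumn G n f \<oplus> sumn G n g"
proof (induction n)
  case (Suc n)
  then have "sumn G n f \<in> carrier G" "sumn G n g \<in> carrier G" "f n \<in> carrier G" "g n \<in> carrier G"
    by auto
  then show ?case using Suc by (simp add: a_ac)
qed simp

lemma a_inv_zero [simp]: "\<ominus> \<zero> = \<zero>"
  by (metis l_zero minus_equality zero_closed)

lemma sumn_minus:
  "(\<And>i. i < n \<Longrightarrow> f i \<in> carrier G) \<Longrightarrow> sumn G n (\<lambda>i. \<ominus> f i) = \<ominus> sumn G n f"
  by (induction n) (auto simp: minus_add)

lemma sumn_append:
  "(\<And>i. i < n + m \<Longrightarrow> f i \<in> carrier G) \<Longrightarrow>
    sumn G (n + m) f = sumn G n f \<oplus> sumn G m (\<lambda>i. f (n + i))"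
  by (induction m) (auto simp: a_assoc)

lemma sumn_swap:
  "(\<And>i j. i < n \<Longrightarrow> j < m \<Longrightarrow> f i j \<in> carrier G) \<Longrightarrow>
    sumn G n (\<lambda>i. sumn G m (f i)) = sumn G m (\<lambda>j. sumn G n (\<lambda>i. f i j))"
proof (induction n)
  case 0
  then show ?case by (simp add: sumn_zero)
next
  case (Suc n)
  then have IH: "sumn G n (\<lambda>i. sumn G m (f i)) = sumn G m (\<lambda>j. sumn G n (\<lambda>i. f i j))"
    by simp
  have "sumn G m (\<lambda>j. sumn G n (\<lambda>i. f i j) \<oplus> f n j)
      = sumn G m (\<lambda>j. sumn G n (\<lambda>i. f i j)) \<oplus> sumn G m (f n)"
    by (rule sumn_add) (use Suc.prems in auto)
  then show ?case using IH by simp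
qed

lemma sumn_delta:
  assumes "j < n" "x \<in> carrier G"
  shows "sumn G n (\<lambda>i. if i = j then x else \<zero>) = x"
  using assms
proof (induction n)
  case (Suc n)
  show ?case
  proof (cases "j = n")
    case True
    then have "sumn G n (\<lambda>i. if i = j then x else \<zero>) = \<zero>"
      by (intro sumn_zero) auto
    with True Suc.prems show ?thesis by simp
  next
    case False
    with Suc show ?thesis by simp
  qed
qed simp

lemma sumn_mem:
  assumes "\<zero> \<in> V" "\<And>x y. x \<in> V \<Longrightarrow> y \<in> V \<Longrightarrow> x \<oplus> y \<in> V" "\<And>i. i < n \<Longrightarrow> f i \<in> V"
  shows "sumn G n f \<in> V"
  using assms by (induction n) auto

lemma diff_add [simp]: "x \<in> carrier G \<Longrightarrow> y \<in> carrier G \<Longrightarrow> x \<ominus> y \<oplus> y = x"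
  by (simp add: minus_eq a_assoc l_neg)

lemma minus_eq_zero_iff: "x \<in> carrier G \<Longrightarrow> y \<in> carrier G \<Longrightarrow> x \<ominus> y = \<zero> \<longleftrightarrow> x = y"
  by (metis a_inv_closed minus_eq minus_equality minus_minus r_neg)

end

text \<open>Only additivity is asked for: taking the component of a fixed degree is additive but in
  general not \<open>R\<close>-linear.\<close>

locale add_map = G?: abelian_group G + H?: abelian_group H
  for G (structure) and H (structure) +
  fixes f
  assumes map_closed [simp, intro]: "x \<in> carrier G \<Longrightarrow> f x \<in> carrier H"
    and map_add: "\<lbrakk>x \<in> carrier G; y \<in> carrier G\<rbrakk> \<Longrightarrow> f (x \<oplus> y) = f x \<oplus>\<^bsub>H\<^esub> f y"
begin

lemma map_zero [simp]: "f \<zero> = \<zero>\<^bsub>H\<^esub>"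
  using map_add[of \<zero> \<zero>] by (metis G.l_zero G.zero_closed H.add.r_cancel_one' map_closed)

lemma map_minus: "x \<in> carrier G \<Longrightarrow> f (\<ominus> x) = \<ominus>\<^bsub>H\<^esub> f x"
  using map_add[of "\<ominus> x" x] by (simp add: G.l_neg H.minus_equality)

lemma map_diff: "\<lbrakk>x \<in> carrier G; y \<in> carrier G\<rbrakk> \<Longrightarrow> f (x \<ominus> y) = f x \<ominus>\<^bsub>H\<^esub> f y"
  by (simp add: a_minus_def map_add map_minus)

lemma map_finsum:
  "(\<And>i. i \<in> A \<Longrightarrow> c i \<in> carrier G) \<Longrightarrow> f (finsum G c A) = finsum H (\<lambda>i. f (c i)) A"
proof (induction A rule: infinite_finite_induct)
  case (insert i A)
  then have "f (finsum G c (insert i A)) = f (c i \<oplus> finsum G c A)"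
    by (subst G.finsum_insert) auto
  also have "\<dots> = f (c i) \<oplus>\<^bsub>H\<^esub> f (finsum G c A)"
    using insert by (intro map_add G.finsum_closed) auto
  finally show ?case
    using insert by (subst H.finsum_insert) auto
qed auto

lemma map_sumn:
  "(\<And>i. i < n \<Longrightarrow> c i \<in> carrier G) \<Longrightarrow> f (sumn G n c) = sumn H n (\<lambda>i. f (c i))"
  by (induction n) (auto simp: map_add)

end

section \<open>Linear combinations and matrix products\<close>

definition lin :: "('a, 'b, 'c) module_scheme \<Rightarrow> nat \<Rightarrow> (nat \<Rightarrow> 'b) \<Rightarrow> (nat \<Rightarrow> 'a) \<Rightarrow> 'b" where
  "lin M n u a = sumn M n (\<lambda>i. a i \<odot>\<^bsub>M\<^esub> u i)"

text \<open>The \<open>i\<close>-th entry of the row vector \<open>b\<close> times the matrix with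
  rows \<open>s k\<close>.\<close>

definition comb :: "('a, 'r) ring_scheme \<Rightarrow> nat \<Rightarrow> (nat \<Rightarrow> 'a) \<Rightarrow> (nat \<Rightarrow> 'i \<Rightarrow> 'a) \<Rightarrow> 'i \<Rightarrow> 'a" where
  "comb R m b s i = sumn R m (\<lambda>k. b k \<otimes>\<^bsub>R\<^esub> s k i)"

lemma lin_cong:
  "\<lbrakk>\<And>i. i < n \<Longrightarrow> u i = v i; \<And>i. i < n \<Longrightarrow> a i = b i\<rbrakk> \<Longrightarrow> lin M n u a = lin M n v b"
  unfolding lin_def by (rule sumn_cong) auto

lemma comb_cong:
  "\<lbrakk>\<And>k. k < m \<Longrightarrow> b k = b' k; \<And>k. k < m \<Longrightarrow> s k i = s' k i\<rbrakk> \<Longrightarrow> comb R m b s i = comb R m b' s' i"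
  unfolding comb_def by (rule sumn_cong) auto

lemma (in ring) comb_closed [intro]:
  "\<lbrakk>\<And>k. k < m \<Longrightarrow> b k \<in> carrier R; \<And>k. k < m \<Longrightarrow> s k i \<in> carrier R\<rbrakk> \<Longrightarrow> comb R m b s i \<in> carrier R"
  unfolding comb_def by auto

context module begin

lemma sumn_smult_ldistr:
  assumes "a \<in> carrier R" "\<And>i. i < n \<Longrightarrow> f i \<in> carrier M"
  shows "a \<odot>\<^bsub>M\<^esub> sumn M n f = sumn M n (\<lambda>i. a \<odot>\<^bsub>M\<^esub> f i)"
  using assms(2) by (induction n) (auto simp: assms(1) smult_r_distr)

lemma sumn_smult_rdistr:
  assumes "x \<in> carrier M" "\<And>i. i < n \<Longrightarrow> c i \<in> carrier R"
  shows "sumn R n c \<odot>\<^bsub>M\<^esub> x = sumn M n (\<lambda>i. c i \<odot>\<^bsub>M\<^esub> x)"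
  using assms(2) by (induction n) (auto simp: assms(1) smult_l_distr)

lemma lin_closed [intro, simp]:
  "\<lbrakk>\<And>i. i < n \<Longrightarrow> u i \<in> carrier M; \<And>i. i < n \<Longrightarrow> a i \<in> carrier R\<rbrakk> \<Longrightarrow> lin M n u a \<in> carrier M"
  unfolding lin_def by auto

lemma lin_zero: "(\<And>i. i < n \<Longrightarrow> u i \<in> carrier M) \<Longrightarrow> lin M n u (\<lambda>i. \<zero>) = \<zero>\<^bsub>M\<^esub>"
  unfolding lin_def by (rule M.sumn_zero) auto

lemma lin_add:
  assumes "\<And>i. i < n \<Longrightarrow> u i \<in> carrier M" "\<And>i. i < n \<Longrightarrow> a i \<in> carrier R" "\<And>i. i < n \<Longrightarrow> b i \<in> carrier R"
  shows "lin M n u (\<lambda>i. a i \<oplus> b i) = lin M n u a \<oplus>\<^bsub>M\<^esub> lin M n u b"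
proof -
  have "lin M n u (\<lambda>i. a i \<oplus> b i) = sumn M n (\<lambda>i. a i \<odot>\<^bsub>M\<^esub> u i \<oplus>\<^bsub>M\<^esub> b i \<odot>\<^bsub>M\<^esub> u i)"
    unfolding lin_def by (rule sumn_cong) (auto simp: assms smult_l_distr)
  also have "\<dots> = lin M n u a \<oplus>\<^bsub>M\<^esub> lin M n u b"
    unfolding lin_def by (rule M.sumn_add) (auto simp: assms)
  finally show ?thesis .
qed

lemma lin_smult:
  assumes "\<And>i. i < n \<Longrightarrow> u i \<in> carrier M" "\<And>i. i < n \<Longrightarrow> a i \<in> carrier R" "r \<in> carrier R"
  shows "lin M n u (\<lambda>i. r \<otimes> a i) = r \<odot>\<^bsub>M\<^esub> lin M n u a"
  unfolding lin_def using assms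
  by (subst sumn_smult_ldistr) (auto intro!: sumn_cong simp: smult_assoc1)

lemma lin_minus:
  assumes "\<And>i. i < n \<Longrightarrow> u i \<in> carrier M" "\<And>i. i < n \<Longrightarrow> a i \<in> carrier R"
  shows "lin M n u (\<lambda>i. \<ominus> a i) = \<ominus>\<^bsub>M\<^esub> lin M n u a"
  unfolding lin_def using assms
  by (subst M.sumn_minus[symmetric]) (auto intro!: sumn_cong simp: smult_l_minus)

lemma lin_diff:
  assumes "\<And>i. i < n \<Longrightarrow> u i \<in> carrier M" "\<And>i. i < n \<Longrightarrow> a i \<in> carrier R" "\<And>i. i < n \<Longrightarrow> b i \<in> carrier R"
  shows "lin M n u (\<lambda>i. a i \<ominus> b i) = lin M n u a \<ominus>\<^bsub>M\<^esub> lin M n u b"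
  unfolding a_minus_def using assms by (simp add: lin_add lin_minus)

lemma lin_unit:
  assumes "\<And>i. i < n \<Longrightarrow> u i \<in> carrier M" "j < n"
  shows "lin M n u (\<lambda>i. if i = j then \<one> else \<zero>) = u j"
proof -
  have "lin M n u (\<lambda>i. if i = j then \<one> else \<zero>) = sumn M n (\<lambda>i. if i = j then u j else \<zero>\<^bsub>M\<^esub>)"
    unfolding lin_def by (rule sumn_cong) (auto simp: assms)
  then show ?thesis using assms by (simp add: M.sumn_delta)
qed

lemma lin_append:
  assumes "\<And>i. i < n + m \<Longrightarrow> u i \<in> carrier M" "\<And>i. i < n + m \<Longrightarrow> a i \<in> carrier R"
  shows "lin M (n + m) u a = lin M n u a \<oplus>\<^bsub>M\<^esub> lin M m (\<lambda>i. u (n + i)) (\<lambda>i. a (n + i))"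
  unfolding lin_def using assms by (intro M.sumn_append) auto

lemma lin_append_if:
  assumes "\<And>i. i < n \<Longrightarrow> x i \<in> carrier M" "\<And>i. i < m \<Longrightarrow> y i \<in> carrier M"
    and "\<And>i. i < n \<Longrightarrow> a i \<in> carrier R" "\<And>i. i < m \<Longrightarrow> b i \<in> carrier R"
  shows "lin M (n + m) (\<lambda>i. if i < n then x i else y (i - n)) (\<lambda>i. if i < n then a i else b (i - n))
    = lin M n x a \<oplus>\<^bsub>M\<^esub> lin M m y b"
  by (subst lin_append) (use assms in \<open>auto intro!: arg_cong2[where f="(\<oplus>\<^bsub>M\<^esub>)"] lin_cong\<close>)

text \<open>Associativity of matrix products, (b s) u = b (s u), by exchanging the two summations.
  It is the rule for substituting one system of expressions into another.\<close>

lemma lin_comb: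
  assumes "\<And>i. i < n \<Longrightarrow> u i \<in> carrier M" "\<And>k. k < m \<Longrightarrow> b k \<in> carrier R"
    "\<And>k i. k < m \<Longrightarrow> i < n \<Longrightarrow> s k i \<in> carrier R"
  shows "lin M n u (comb R m b s) = lin M m (\<lambda>k. lin M n u (s k)) b"
proof -
  have "lin M n u (comb R m b s) = sumn M n (\<lambda>i. sumn M m (\<lambda>k. b k \<odot>\<^bsub>M\<^esub> (s k i \<odot>\<^bsub>M\<^esub> u i)))"
    unfolding lin_def comb_def
    by (rule sumn_cong, subst sumn_smult_rdistr)
      (auto simp: assms smult_assoc1 intro!: sumn_cong)
  also have "\<dots> = sumn M m (\<lambda>k. sumn M n (\<lambda>i. b k \<odot>\<^bsub>M\<^esub> (s k i \<odot>\<^bsub>M\<^esub> u i)))"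
    by (rule M.sumn_swap) (auto simp: assms)
  also have "\<dots> = lin M m (\<lambda>k. lin M n u (s k)) b"
    unfolding lin_def
    by (rule sumn_cong, subst sumn_smult_ldistr) (auto simp: assms)
  finally show ?thesis .
qed

end

locale lin_map = M?: module R M + N?: module R N
  for R (structure) and M (structure) and N (structure) +
  fixes f
  assumes map_hom: "f \<in> mod_hom R M N"
begin

sublocale add_map M N f
  by unfold_locales (use map_hom in \<open>auto simp: mod_hom_def\<close>)

lemma map_smult: "\<lbrakk>a \<in> carrier R; x \<in> carrier M\<rbrakk> \<Longrightarrow> f (a \<odot>\<^bsub>M\<^esub> x) = a \<odot>\<^bsub>N\<^esub> f x"
  using map_hom by (auto simp: mod_hom_def)

lemma map_lin:
  assumes "\<And>i. i < n \<Longrightarrow> u i \<in> carrier M" "\<And>i. i < n \<Longrightarrow> a i \<in> carrier R"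
  shows "f (lin M n u a) = lin N n (\<lambda>i. f (u i)) a"
  unfolding lin_def using assms
  by (subst map_sumn) (auto intro!: sumn_cong simp: map_smult)

end

section \<open>Gradings and the degree filtration\<close>

text \<open>\<open>hcomp M\<close> is the case \<open>D = mgrade M\<close>. With the grading as an
  argument, the ring, the modules and shifted gradings share one theory.\<close>

definition gcomp :: "('b, 'c) ring_scheme \<Rightarrow> (int \<Rightarrow> 'b set) \<Rightarrow> 'b \<Rightarrow> int \<Rightarrow> 'b" where
  "gcomp G D x = (THE c. hom_decomp G D x c)"

text \<open>The bound on the degree is expressed by vanishing components, so zero lies in every step
  of the filtration and needs no degree of its own.\<close>

definition fil :: "('b, 'c) ring_scheme \<Rightarrow> (int \<Rightarrow> 'b set) \<Rightarrow> int \<Rightarrow> 'b set" where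
  "fil G D d = {x \<in> carrier G. \<forall>n>d. gcomp G D x n = \<zero>\<^bsub>G\<^esub>}"

locale graded_group = abelian_group G for G (structure) +
  fixes D
  assumes is_grading: "grading G D"
begin

abbreviation "part \<equiv> gcomp G D"

lemma D_subgroup: "additive_subgroup (D n) G"
  using is_grading by (auto simp: grading_def)

lemma D_carrier [intro]: "x \<in> D n \<Longrightarrow> x \<in> carrier G"
  using additive_subgroup.a_subset[OF D_subgroup] by blast

lemma D_zero [simp, intro]: "\<zero> \<in> D n"
  by (rule additive_subgroup.zero_closed[OF D_subgroup])

lemma D_add [intro]: "x \<in> D n \<Longrightarrow> y \<in> D n \<Longrightarrow> x \<oplus> y \<in> D n"
  by (rule additive_subgroup.a_closed[OF D_subgroup])

lemma D_minus [intro]: "x \<in> D n \<Longrightarrow> \<ominus> x \<in> D n"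
  by (rule additive_subgroup.a_inv_closed[OF D_subgroup])

lemma hom_decomp_gcomp: "x \<in> carrier G \<Longrightarrow> hom_decomp G D x (part x)"
  using is_grading unfolding grading_def gcomp_def by (metis (no_types, lifting) theI')

lemma gcomp_D [simp, intro]: "x \<in> carrier G \<Longrightarrow> part x n \<in> D n"
  using hom_decomp_gcomp unfolding hom_decomp_def by blast

lemma gcomp_closed [simp, intro]: "x \<in> carrier G \<Longrightarrow> part x n \<in> carrier G"
  by blast

lemma gcomp_finite: "x \<in> carrier G \<Longrightarrow> finite {n. part x n \<noteq> \<zero>}"
  using hom_decomp_gcomp unfolding hom_decomp_def by blast

lemma gcomp_sum:
  assumes "x \<in> carrier G" "finite A" "\<And>n. n \<notin> A \<Longrightarrow> part x n = \<zero>"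
  shows "x = finsum G (part x) A"
proof -
  have "x = finsum G (part x) {n. part x n \<noteq> \<zero>}"
    using hom_decomp_gcomp[OF assms(1)] unfolding hom_decomp_def by blast
  also have "\<dots> = finsum G (part x) A"
    by (rule add.finprod_mono_neutral_cong_left) (use assms in auto)
  finally show ?thesis .
qed

text \<open>Components are identified by uniqueness of the decomposition. The index set
  \<open>A\<close> may exceed the support, so that one set can serve two families at once, as in
  \<open>gcomp_add\<close>.\<close>

lemma gcomp_eqI:
  assumes "finite A" "\<And>n. c n \<in> D n" "\<And>n. n \<notin> A \<Longrightarrow> c n = \<zero>" "x = finsum G c A"
  shows "part x = c"
proof -
  have x: "x \<in> carrier G" using assms(2) unfolding assms(4) by (intro finsum_closed) auto
  have "finsum G c A = finsum G c {n. c n \<noteq> \<zero>}"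
    by (rule add.finprod_mono_neutral_cong_right) (use assms in auto)
  moreover have "finite {n. c n \<noteq> \<zero>}"
    by (rule finite_subset[OF _ assms(1)]) (use assms(3) in auto)
  ultimately have "hom_decomp G D x c"
    unfolding hom_decomp_def using assms by auto
  with hom_decomp_gcomp[OF x] x show ?thesis
    using is_grading unfolding grading_def by blast
qed

lemma gcomp_homog: "x \<in> D m \<Longrightarrow> part x = (\<lambda>n. if n = m then x else \<zero>)"
  by (rule gcomp_eqI[of "{m}"]) (auto simp: D_carrier)

lemma gcomp_zero [simp]: "part \<zero> n = \<zero>"
  using gcomp_homog[of \<zero> 0] by auto

lemma gcomp_add:
  assumes "x \<in> carrier G" "y \<in> carrier G"
  shows "part (x \<oplus> y) n = part x n \<oplus> part y n"
proof -
  let ?A = "{n. part x n \<noteq> \<zero>} \<union> {n. part y n \<noteq> \<zero>}"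
  have fin: "finite ?A" using assms by (simp add: gcomp_finite)
  have "x = finsum G (part x) ?A" "y = finsum G (part y) ?A"
    by (rule gcomp_sum[OF _ fin]; use assms in auto)+
  then have "x \<oplus> y = finsum G (part x) ?A \<oplus> finsum G (part y) ?A"
    by simp
  also have "\<dots> = finsum G (\<lambda>n. part x n \<oplus> part y n) ?A"
    by (subst finsum_addf) (use assms in auto)
  finally have "part (x \<oplus> y) = (\<lambda>n. part x n \<oplus> part y n)"
    by (intro gcomp_eqI[OF fin]) (use assms in auto)
  then show ?thesis by simp
qed

lemma gcomp_add_map: "add_map G G (\<lambda>x. part x n)"
  by unfold_locales (auto simp: gcomp_add)

lemma gcomp_minus: "x \<in> carrier G \<Longrightarrow> part (\<ominus> x) n = \<ominus> part x n"
  by (rule add_map.map_minus[OF gcomp_add_map])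

lemma gcomp_diff:
  "x \<in> carrier G \<Longrightarrow> y \<in> carrier G \<Longrightarrow> part (x \<ominus> y) n = part x n \<ominus> part y n"
  by (rule add_map.map_diff[OF gcomp_add_map])

lemma gcomp_sumn:
  "(\<And>i. i < m \<Longrightarrow> f i \<in> carrier G) \<Longrightarrow> part (sumn G m f) n = sumn G m (\<lambda>i. part (f i) n)"
  by (rule add_map.map_sumn[OF gcomp_add_map])

lemma D_diff [intro]: "x \<in> D n \<Longrightarrow> y \<in> D n \<Longrightarrow> x \<ominus> y \<in> D n"
  unfolding a_minus_def by (intro D_add D_minus)

lemma D_sumn [intro]: "(\<And>i. i < m \<Longrightarrow> f i \<in> D n) \<Longrightarrow> sumn G m f \<in> D n"
  by (rule sumn_mem) auto

lemma finsum_mem: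
  assumes "\<zero> \<in> V" "V \<subseteq> carrier G" "\<And>x y. x \<in> V \<Longrightarrow> y \<in> V \<Longrightarrow> x \<oplus> y \<in> V" "\<And>i. i \<in> A \<Longrightarrow> c i \<in> V"
  shows "finsum G c A \<in> V"
  using assms(4)
proof (induction A rule: infinite_finite_induct)
  case (insert i A)
  then show ?case using assms(2,3)
    by (subst finsum_insert) auto
qed (auto simp: assms(1))

lemma gcomp_in_imp_mem:
  assumes "x \<in> carrier G" "\<zero> \<in> V" "V \<subseteq> carrier G" "\<And>x y. x \<in> V \<Longrightarrow> y \<in> V \<Longrightarrow> x \<oplus> y \<in> V"
    "\<And>n. part x n \<in> V"
  shows "x \<in> V"
proof -
  have "x = finsum G (part x) {n. part x n \<noteq> \<zero>}"
    by (rule gcomp_sum) (use assms gcomp_finite in auto)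
  moreover have "finsum G (part x) {n. part x n \<noteq> \<zero>} \<in> V"
    by (rule finsum_mem) (use assms in auto)
  ultimately show ?thesis by simp
qed

abbreviation "F \<equiv> fil G D"


lemma F_closed [intro]: "x \<in> F d \<Longrightarrow> x \<in> carrier G"
  by (auto simp: fil_def)

lemma F_zero [simp, intro]: "\<zero> \<in> F d" by (auto simp: fil_def)

lemma F_add [intro]: "x \<in> F d \<Longrightarrow> y \<in> F d \<Longrightarrow> x \<oplus> y \<in> F d"
  by (auto simp: fil_def gcomp_add)

lemma F_minus [intro]: "x \<in> F d \<Longrightarrow> \<ominus> x \<in> F d"
  by (auto simp: fil_def gcomp_minus)

lemma F_diff [intro]: "x \<in> F d \<Longrightarrow> y \<in> F d \<Longrightarrow> x \<ominus> y \<in> F d"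
  unfolding a_minus_def by (intro F_add F_minus)

lemma F_sumn [intro]: "(\<And>i. i < m \<Longrightarrow> f i \<in> F n) \<Longrightarrow> sumn G m f \<in> F n"
  by (rule sumn_mem) auto

lemma F_mono: "x \<in> F d \<Longrightarrow> d \<le> e \<Longrightarrow> x \<in> F e"
  by (auto simp: fil_def)

lemma D_F: "x \<in> D n \<Longrightarrow> n \<le> d \<Longrightarrow> x \<in> F d"
  by (auto simp: fil_def gcomp_homog D_carrier)

lemma F_top_zero: "x \<in> F d \<Longrightarrow> d < n \<Longrightarrow> part x n = \<zero>"
  by (auto simp: fil_def)

lemma F_pred: "x \<in> F d \<Longrightarrow> part x d = \<zero> \<Longrightarrow> x \<in> F (d - 1)"
  by (auto simp: fil_def) (metis linorder_less_linear zless_imp_add1_zle add_le_cancel_right diff_add_cancel not_less)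

lemma F_exists: assumes "x \<in> carrier G" obtains d where "x \<in> F d"
proof -
  obtain d where "\<forall>n\<in>{n. part x n \<noteq> \<zero>}. n \<le> d"
    using gcomp_finite[OF assms] by (meson Max_ge)
  then have "x \<in> F d" using assms by (auto simp: fil_def)
  then show ?thesis by (rule that)
qed

text \<open>An element of degree at most \<open>d\<close> is a finite sum of homogeneous elements of
  degree at most \<open>d\<close>, so identities and bounds need to be checked on homogeneous
  elements only.\<close>

lemma F_induct [consumes 1, case_names homog add]:
  assumes x: "x \<in> F d"
    and homog: "\<And>j y. j \<le> d \<Longrightarrow> y \<in> D j \<Longrightarrow> P y"
    and add: "\<And>y z. y \<in> F d \<Longrightarrow> z \<in> F d \<Longrightarrow> P y \<Longrightarrow> P z \<Longrightarrow> P (y \<oplus> z)"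
  shows "P x"
proof -
  have "P \<zero>" by (rule homog[of d]) auto
  \<comment> \<open>Membership in \<open>F d\<close> travels with \<open>P\<close>, since the
    hypothesis \<open>add\<close> requires it of both summands.\<close>
  have "P (part x n) \<and> part x n \<in> F d" for n
    by (cases "n \<le> d") (use x \<open>P \<zero>\<close> homog[of n "part x n"] D_F[of "part x n" n d]
        in \<open>auto simp: F_top_zero\<close>)
  then have comp: "\<And>n. part x n \<in> {x \<in> F d. P x}" by blast
  have "x \<in> {x \<in> F d. P x}"
  proof (rule gcomp_in_imp_mem)
    show "\<And>y z. y \<in> {x \<in> F d. P x} \<Longrightarrow> z \<in> {x \<in> F d. P x} \<Longrightarrow> y \<oplus> z \<in> {x \<in> F d. P x}"
      using add by blast
    show "{x \<in> F d. P x} \<subseteq> carrier G" by blast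
    show "x \<in> carrier G" using x by blast
  qed (use comp \<open>P \<zero>\<close> in simp_all)
  then show ?thesis by simp
qed

lemma homog_induct [consumes 1, case_names homog add]:
  assumes x: "x \<in> carrier G"
    and homog: "\<And>j y. y \<in> D j \<Longrightarrow> P y"
    and add: "\<And>y z. y \<in> carrier G \<Longrightarrow> z \<in> carrier G \<Longrightarrow> P y \<Longrightarrow> P z \<Longrightarrow> P (y \<oplus> z)"
  shows "P x"
proof -
  obtain d where "x \<in> F d" using x by (rule F_exists)
  then show ?thesis
    by (induction rule: F_induct) (auto intro: homog add)
qed

lemma gcomp_ext:
  assumes "x \<in> carrier G" "y \<in> carrier G" "\<And>n. part x n = part y n"
  shows "x = y"
proof -
  let ?A = "{n. part x n \<noteq> \<zero>}"
  have "x = finsum G (part x) ?A"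
    by (rule gcomp_sum) (use assms(1) gcomp_finite in auto)
  also have "\<dots> = finsum G (part y) ?A"
    by (rule arg_cong[where f="\<lambda>c. finsum G c ?A"]) (use assms(3) in auto)
  also have "\<dots> = y"
    by (rule gcomp_sum[symmetric]) (use assms gcomp_finite in auto)
  finally show ?thesis .
qed

end

section \<open>Degree-preserving maps and transport of gradings\<close>

locale graded_add_map = add_map G H f + G: graded_group G D + H: graded_group H E
  for G (structure) and H (structure) and f and D and E +
  assumes map_D: "x \<in> D n \<Longrightarrow> f x \<in> E n"
begin

lemma map_gcomp:
  assumes "x \<in> carrier G"
  shows "gcomp H E (f x) n = f (gcomp G D x n)"
  using assms
proof (induction rule: G.homog_induct)
  case (homog j y)
  then show ?case using H.gcomp_homog[OF map_D[OF homog]] by (simp add: G.gcomp_homog)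
next
  case (add y z)
  then show ?case by (simp add: G.gcomp_add H.gcomp_add map_add)
qed

lemma map_fil: "x \<in> fil G D d \<Longrightarrow> f x \<in> fil H E d"
  by (auto simp: fil_def map_gcomp)

end

text \<open>The components of \<open>y\<close> are the images of the components of a preimage. For
  uniqueness, any decomposition of \<open>y\<close> is lifted to the decomposition of some preimage;
  two preimages differ by a kernel element, whose components are killed as well by the hypothesis
  \<open>ker\<close>.\<close>

lemma (in add_map) grading_surj:
  assumes "graded_group G D" and surj: "f ` carrier G = carrier H"
    and ker: "\<And>x n. x \<in> carrier G \<Longrightarrow> f x = \<zero>\<^bsub>H\<^esub> \<Longrightarrow> f (gcomp G D x n) = \<zero>\<^bsub>H\<^esub>"
    and E: "\<And>n. E n = f ` D n"
  shows "grading H E"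
proof -
  interpret G: graded_group G D by fact
  have "additive_subgroup (E n) H" for n
  proof -
    have "group_hom (add_monoid G) (add_monoid H) f"
      by (unfold_locales) (auto simp: hom_def map_add)
    then have "subgroup (f ` D n) (add_monoid H)"
      by (rule group_hom.subgroup_img_is_subgroup)
        (use G.D_subgroup in \<open>auto simp: additive_subgroup_def\<close>)
    then show ?thesis by (simp add: E additive_subgroup_def)
  qed
  moreover have "\<exists>!c. hom_decomp H E y c" if y: "y \<in> carrier H" for y
  proof (rule ex_ex1I)
    obtain x where x: "x \<in> carrier G" "y = f x" using y surj by auto
    let ?c = "\<lambda>n. f (gcomp G D x n)" and ?A = "{n. gcomp G D x n \<noteq> \<zero>}"
    have fin: "finite ?A" using x G.gcomp_finite by auto
    have "x = finsum G (gcomp G D x) ?A"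
      by (rule G.gcomp_sum) (use x fin in auto)
    then have "y = f (finsum G (gcomp G D x) ?A)" using x by simp
    also have "\<dots> = finsum H ?c ?A"
      by (rule map_finsum) (use x in auto)
    also have "\<dots> = finsum H ?c {n. ?c n \<noteq> \<zero>\<^bsub>H\<^esub>}"
      by (rule H.add.finprod_mono_neutral_cong_right) (use x fin in auto)
    finally have "y = finsum H ?c {n. ?c n \<noteq> \<zero>\<^bsub>H\<^esub>}" .
    moreover have "finite {n. ?c n \<noteq> \<zero>\<^bsub>H\<^esub>}"
      by (rule finite_subset[OF _ fin]) auto
    ultimately have "hom_decomp H E y ?c"
      unfolding hom_decomp_def E using x by auto
    then show "\<exists>c. hom_decomp H E y c" by (intro exI[of _ ?c])
  next
    have lift: "\<exists>x\<in>carrier G. y = f x \<and> (\<forall>n. c n = f (gcomp G D x n))"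
      if "hom_decomp H E y c" for c
    proof -
      have fin: "finite {n. c n \<noteq> \<zero>\<^bsub>H\<^esub>}" and ysum: "y = finsum H c {n. c n \<noteq> \<zero>\<^bsub>H\<^esub>}"
        and mem: "\<And>n. c n \<in> f ` D n"
        using that by (auto simp: hom_decomp_def E)
      \<comment> \<open>Choosing zero wherever \<open>c n\<close> vanishes gives the lifted family
        finite support.\<close>
      define l where "l n = (if c n = \<zero>\<^bsub>H\<^esub> then \<zero> else (SOME x. x \<in> D n \<and> f x = c n))" for n
      have l: "l n \<in> D n \<and> f (l n) = c n" for n
        unfolding l_def using mem[of n]
        by (auto, (metis (mono_tags, lifting) someI_ex)+)
      let ?x = "finsum G l {n. c n \<noteq> \<zero>\<^bsub>H\<^esub>}"
      have gl: "gcomp G D ?x = l"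
        by (rule G.gcomp_eqI[OF fin]) (use l in \<open>auto simp: l_def\<close>)
      have lc: "\<And>n. l n \<in> carrier G" using l by auto
      have "f ?x = finsum H (\<lambda>n. f (l n)) {n. c n \<noteq> \<zero>\<^bsub>H\<^esub>}"
        by (rule map_finsum) (use lc in auto)
      then have "f ?x = y" using ysum l by simp
      moreover have "?x \<in> carrier G" using lc by auto
      ultimately show ?thesis using gl l by metis
    qed
    fix c c' assume "hom_decomp H E y c" "hom_decomp H E y c'"
    then obtain x x' where x: "x \<in> carrier G" "y = f x" "\<And>n. c n = f (gcomp G D x n)"
      and x': "x' \<in> carrier G" "y = f x'" "\<And>n. c' n = f (gcomp G D x' n)"
      using lift by metis
    have "f (x \<ominus> x') = \<zero>\<^bsub>H\<^esub>" using x x' y by (simp add: map_diff H.minus_eq_zero_iff)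
    then have "f (gcomp G D (x \<ominus> x') n) = \<zero>\<^bsub>H\<^esub>" for n
      using ker x x' by auto
    then have "c n \<ominus>\<^bsub>H\<^esub> c' n = \<zero>\<^bsub>H\<^esub>" for n
      using x x' by (simp add: G.gcomp_diff map_diff)
    then have "c n = c' n" for n
      by (subst H.minus_eq_zero_iff[symmetric]) (use x x' in auto)
    then show "c = c'" by auto
  qed
  ultimately show ?thesis by (auto simp: grading_def)
qed

text \<open>The components of \<open>f x\<close> lie in the image, so they have unique preimages,
  and injectivity leaves the support unchanged. This serves homogeneous submodules, with
  \<open>f\<close> the inclusion, and the ring with shifted grading, with \<open>f\<close> the
  identity.\<close>

lemma (in add_map) grading_inj:
  assumes "graded_group H D" and inj: "inj_on f (carrier G)"
    and img: "\<And>x n. x \<in> carrier G \<Longrightarrow> gcomp H D (f x) n \<in> f ` carrier G"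
    and E: "\<And>n. E n = {x \<in> carrier G. f x \<in> D n}"
  shows "grading G E"
proof -
  interpret H: graded_group H D by fact
  have "additive_subgroup (E n) G" for n
    by (intro additive_subgroup.intro subgroup.intro)
      (auto simp: E map_add map_minus a_inv_def[symmetric])
  moreover have "\<exists>!c. hom_decomp G E x c" if x: "x \<in> carrier G" for x
  proof (rule ex_ex1I)
    define c where "c n = (SOME z. z \<in> carrier G \<and> f z = gcomp H D (f x) n)" for n
    have c: "c n \<in> carrier G \<and> f (c n) = gcomp H D (f x) n" for n
      unfolding c_def by (rule someI_ex) (use img[OF x, of n] in force)
    have c0: "c n = \<zero> \<longleftrightarrow> gcomp H D (f x) n = \<zero>\<^bsub>H\<^esub>" for n
      using c[of n] inj by (metis inj_onD map_zero G.zero_closed)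
    let ?A = "{n. c n \<noteq> \<zero>}"
    have fin: "finite ?A" using H.gcomp_finite[of "f x"] x by (simp add: c0)
    have "f (finsum G c ?A) = finsum H (gcomp H D (f x)) ?A"
      by (subst map_finsum) (use c in auto)
    also have "\<dots> = f x"
      by (rule H.gcomp_sum[symmetric]) (use fin x in \<open>auto simp: c0\<close>)
    finally have "x = finsum G c ?A"
      using inj x c by (metis (no_types, lifting) G.finsum_closed Pi_I inj_onD)
    then have "hom_decomp G E x c"
      unfolding hom_decomp_def using c fin x by (auto simp: E)
    then show "\<exists>c. hom_decomp G E x c" by (intro exI[of _ c])
  next
    have u: "gcomp H D (f x) = (\<lambda>n. f (c n))" if "hom_decomp G E x c" for c
    proof (rule H.gcomp_eqI[of "{n. c n \<noteq> \<zero>}"])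
      show "f x = finsum H (\<lambda>n. f (c n)) {n. c n \<noteq> \<zero>}"
      proof (subst map_finsum[symmetric])
        show "f x = f (finsum G c {n. c n \<noteq> \<zero>})"
          using that by (simp add: hom_decomp_def)
      qed (use that in \<open>auto simp: hom_decomp_def E\<close>)
    qed (use that in \<open>auto simp: hom_decomp_def E\<close>)
    fix c c' assume cc: "hom_decomp G E x c" "hom_decomp G E x c'"
    then have "f (c n) = f (c' n)" for n using u by metis
    moreover have "c n \<in> carrier G" "c' n \<in> carrier G" for n
      using cc by (auto simp: hom_decomp_def E)
    ultimately have "c n = c' n" for n using inj by (meson inj_onD)
    then show "c = c'" by blast
  qed
  ultimately show ?thesis by (auto simp: grading_def)
qed

section \<open>Filtered generation and S-pairs\<close>

sublocale graded_ring \<subseteq> gr: graded_group R "rgrade R"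
  by unfold_locales (rule grading)

context graded_ring begin

lemma gcomp_mult:
  assumes "b \<in> carrier R" "s \<in> rgrade R j"
  shows "gr.part (b \<otimes> s) n = gr.part b (n - j) \<otimes> s"
  using assms(1)
proof (induction rule: gr.homog_induct)
  case (homog i y)
  have "y \<otimes> s \<in> rgrade R (i + j)" using homog assms by (simp add: mult_grade)
  then show ?case using homog assms by (auto simp: gr.gcomp_homog gr.D_carrier)
next
  case (add y z)
  then show ?case using assms by (simp add: l_distr gr.gcomp_add gr.D_carrier)
qed

lemma F_mult:
  assumes "a \<in> gr.F p" "b \<in> gr.F q"
  shows "a \<otimes> b \<in> gr.F (p + q)"
  using assms(2)
proof (induction rule: gr.F_induct)
  case (homog j y)
  then show ?case using assms(1)
    by (auto simp: fil_def gcomp_mult gr.D_carrier)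
next
  case (add y z)
  then show ?case using assms(1) gr.F_closed by (simp add: r_distr gr.F_add)
qed

text \<open>Each \<open>s k i\<close> is homogeneous, so a component of the product is obtained by
  taking components of the coefficients \<open>b k\<close> alone.\<close>

lemma gcomp_comb:
  assumes "\<And>k. k < m \<Longrightarrow> b k \<in> carrier R" "\<And>k. k < m \<Longrightarrow> s k i \<in> rgrade R (eps k - e)"
  shows "gr.part (comb R m b s i) (d - e)
    = comb R m (\<lambda>k. gr.part (b k) (d - eps k)) s i"
proof -
  have "gr.part (b k \<otimes> s k i) (d - e) = gr.part (b k) (d - eps k) \<otimes> s k i"
    if "k < m" for k
    using gcomp_mult[OF assms(1)[OF that] assms(2)[OF that], of "d - e"] by simp
  moreover have "s k i \<in> carrier R" if "k < m" for k using assms(2) that by blast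
  ultimately show ?thesis
    unfolding comb_def using assms(1)
    by (subst gr.gcomp_sumn) (auto intro!: sumn_cong)
qed

end

sublocale graded_module \<subseteq> gm: graded_group M "mgrade M"
  by unfold_locales (rule mgrading)

section \<open>Spans, relations and coherence in terms of tuples\<close>

definition filspan :: "('a, 'r) graded_ring_scheme \<Rightarrow> ('a, 'b, 'c) graded_module_scheme
    \<Rightarrow> nat \<Rightarrow> (nat \<Rightarrow> 'b) \<Rightarrow> (nat \<Rightarrow> int) \<Rightarrow> int \<Rightarrow> 'b set" where
  "filspan R M n x e d = {lin M n x a |a. \<forall>i<n. a i \<in> fil R (rgrade R) (d - e i)}"

definition lspan :: "('a, 'r) ring_scheme \<Rightarrow> ('a, 'b, 'c) module_scheme
    \<Rightarrow> nat \<Rightarrow> (nat \<Rightarrow> 'b) \<Rightarrow> 'b set" where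
  "lspan R M n x = {lin M n x a |a. \<forall>i<n. a i \<in> carrier R}"

text \<open>The module of relations of \<open>u\<close> is generated by \<open>s 0, \<dots>, s (m - 1)\<close>.\<close>

definition syz_gen :: "('a, 'r) ring_scheme \<Rightarrow> ('a, 'b, 'c) module_scheme
    \<Rightarrow> nat \<Rightarrow> (nat \<Rightarrow> 'b) \<Rightarrow> nat \<Rightarrow> (nat \<Rightarrow> nat \<Rightarrow> 'a) \<Rightarrow> bool" where
  "syz_gen R M n u m s \<longleftrightarrow>
     (\<forall>k<m. (\<forall>i<n. s k i \<in> carrier R) \<and> lin M n u (s k) = \<zero>\<^bsub>M\<^esub>) \<and>
     (\<forall>a. (\<forall>i<n. a i \<in> carrier R) \<longrightarrow> lin M n u a = \<zero>\<^bsub>M\<^esub> \<longrightarrow>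
       (\<exists>b. (\<forall>k<m. b k \<in> carrier R) \<and> (\<forall>i<n. a i = comb R m b s i)))"

lemma syz_gen_carrier: "\<lbrakk>syz_gen R M n u m s; k < m; i < n\<rbrakk> \<Longrightarrow> s k i \<in> carrier R"
  by (simp add: syz_gen_def)

lemma syz_gen_zero: "\<lbrakk>syz_gen R M n u m s; k < m\<rbrakk> \<Longrightarrow> lin M n u (s k) = \<zero>\<^bsub>M\<^esub>"
  by (simp add: syz_gen_def)

lemma syz_genE:
  assumes "syz_gen R M n u m s" "\<forall>i<n. a i \<in> carrier R" "lin M n u a = \<zero>\<^bsub>M\<^esub>"
  obtains b where "\<forall>k<m. b k \<in> carrier R" "\<forall>i<n. a i = comb R m b s i"
  using assms unfolding syz_gen_def by blast

text \<open>\<open>s k\<close> is homogeneous of degree \<open>eps k\<close> in the free module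
  whose \<open>i\<close>-th basis vector has degree \<open>e i\<close>; hence the degree
  \<open>eps k - e i\<close> of its entries. This is the submodule clause of graded coherence, see
  \<open>graded_coherent_iff\<close>.\<close>

definition hom_syz_fg ::
    "('a, 'r) graded_ring_scheme \<Rightarrow> ('a, 'b, 'c) graded_module_scheme \<Rightarrow> bool" where
  "hom_syz_fg R M \<longleftrightarrow> (\<forall>n e u. (\<forall>i<n. u i \<in> mgrade M (e i)) \<longrightarrow>
     (\<exists>m eps s. (\<forall>k<m. \<forall>i<n. s k i \<in> rgrade R (eps k - e i)) \<and> syz_gen R M n u m s))"

definition hom_fg ::
    "('a, 'r) graded_ring_scheme \<Rightarrow> ('a, 'b, 'c) graded_module_scheme \<Rightarrow> bool" where
  "hom_fg R M \<longleftrightarrow> (\<exists>n e u. (\<forall>i<n. u i \<in> mgrade M (e i)) \<and> carrier M = lspan R M n u)"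

text \<open>The \<open>e j\<close> are weights: the degree of \<open>y j\<close> may be smaller, so
  the same weights remain valid after a map that lowers degrees. Only one inclusion is demanded,
  because \<open>submodule_lin\<close> and \<open>lin_F\<close> give the other when \<open>V\<close>
  is a submodule.\<close>

definition fil_basis :: "('a, 'r) graded_ring_scheme \<Rightarrow> ('a, 'b, 'c) graded_module_scheme
    \<Rightarrow> 'b set \<Rightarrow> nat \<Rightarrow> (nat \<Rightarrow> 'b) \<Rightarrow> (nat \<Rightarrow> int) \<Rightarrow> bool" where
  "fil_basis R M V m y e \<longleftrightarrow> (\<forall>j<m. y j \<in> V \<and> y j \<in> fil M (mgrade M) (e j)) \<and>
     (\<forall>d. V \<inter> fil M (mgrade M) d \<subseteq> filspan R M m y e d)"

text \<open>Tuple form of \<open>groebner_coherent\<close>; the two agree over non-negatively graded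
  rings by \<open>groebner_coherent_gcoh\<close>.\<close>

definition gcoh ::
    "('a, 'r) graded_ring_scheme \<Rightarrow> ('a, 'b, 'c) graded_module_scheme \<Rightarrow> bool" where
  "gcoh R M \<longleftrightarrow> graded_module R M \<and> hom_fg R M \<and> hom_syz_fg R M \<and>
     (\<forall>n x. (\<forall>i<n. x i \<in> carrier M) \<longrightarrow> (\<exists>m y e. fil_basis R M (lspan R M n x) m y e))"

context module begin

lemma lspan_subset: "(\<And>i. i < n \<Longrightarrow> x i \<in> carrier M) \<Longrightarrow> lspan R M n x \<subseteq> carrier M"
  by (auto simp: lspan_def)

lemma lspan_gen: "\<lbrakk>\<And>i. i < n \<Longrightarrow> x i \<in> carrier M; i < n\<rbrakk> \<Longrightarrow> x i \<in> lspan R M n x"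
  unfolding lspan_def
  by (rule CollectI, rule exI[of _ "\<lambda>j. if j = i then \<one> else \<zero>"]) (simp add: lin_unit)

lemma lspan_zero: "(\<And>i. i < n \<Longrightarrow> x i \<in> carrier M) \<Longrightarrow> \<zero>\<^bsub>M\<^esub> \<in> lspan R M n x"
  unfolding lspan_def
  by (rule CollectI, rule exI[of _ "\<lambda>j. \<zero>"]) (simp add: lin_zero)

lemma lspan_add:
  assumes "\<And>i. i < n \<Longrightarrow> x i \<in> carrier M" "y \<in> lspan R M n x" "z \<in> lspan R M n x"
  shows "y \<oplus>\<^bsub>M\<^esub> z \<in> lspan R M n x"
proof -
  from assms obtain a b where "\<forall>i<n. a i \<in> carrier R" "\<forall>i<n. b i \<in> carrier R"
    "y = lin M n x a" "z = lin M n x b" by (auto simp: lspan_def)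
  then show ?thesis unfolding lspan_def
    by (intro CollectI exI[of _ "\<lambda>i. a i \<oplus> b i"]) (simp add: lin_add assms)
qed

lemma lspan_smult:
  assumes "\<And>i. i < n \<Longrightarrow> x i \<in> carrier M" "r \<in> carrier R" "y \<in> lspan R M n x"
  shows "r \<odot>\<^bsub>M\<^esub> y \<in> lspan R M n x"
proof -
  from assms obtain a where "\<forall>i<n. a i \<in> carrier R" "y = lin M n x a"
    by (auto simp: lspan_def)
  then show ?thesis unfolding lspan_def
    by (intro CollectI exI[of _ "\<lambda>i. r \<otimes> a i"]) (simp add: lin_smult assms)
qed

lemma lspan_submodule:
  assumes "\<And>i. i < n \<Longrightarrow> x i \<in> carrier M"
  shows "submodule (lspan R M n x) R M"
proof (rule submoduleI)
  fix y assume y: "y \<in> lspan R M n x"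
  then have "\<ominus>\<^bsub>M\<^esub> y = (\<ominus> \<one>) \<odot>\<^bsub>M\<^esub> y"
    using lspan_subset[of n x] assms by (subst smult_l_minus) auto
  then show "\<ominus>\<^bsub>M\<^esub> y \<in> lspan R M n x"
    using lspan_smult[OF assms _ y, of "\<ominus> \<one>"] by simp
qed (use assms in \<open>auto intro: lspan_add lspan_smult lspan_zero dest: lspan_subset[THEN subsetD, rotated]\<close>)

lemma submodule_lin:
  assumes "submodule V R M" "\<And>i. i < n \<Longrightarrow> x i \<in> V" "\<And>i. i < n \<Longrightarrow> a i \<in> carrier R"
  shows "lin M n x a \<in> V"
  unfolding lin_def
proof (rule M.sumn_mem)
  show "\<zero>\<^bsub>M\<^esub> \<in> V"
    using submoduleE(1,2,4)[OF assms(1)] by (metis R.zero_closed ex_in_conv smult_l_null subsetD)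
qed (use submoduleE[OF assms(1)] assms in auto)

lemma lspan_least:
  "\<lbrakk>submodule V R M; \<And>i. i < n \<Longrightarrow> x i \<in> V\<rbrakk> \<Longrightarrow> lspan R M n x \<subseteq> V"
  by (auto simp: lspan_def submodule_lin)

lemma lspan_append:
  assumes "\<And>i. i < n \<Longrightarrow> x i \<in> carrier M" "\<And>i. i < m \<Longrightarrow> y i \<in> carrier M"
    "z \<in> lspan R M n x" "w \<in> lspan R M m y"
  shows "z \<oplus>\<^bsub>M\<^esub> w \<in> lspan R M (n + m) (\<lambda>i. if i < n then x i else y (i - n))"
proof -
  from assms obtain a b where a: "\<forall>i<n. a i \<in> carrier R" "z = lin M n x a"
    and b: "\<forall>i<m. b i \<in> carrier R" "w = lin M m y b"
    by (auto simp: lspan_def)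
  have "lin M (n + m) (\<lambda>i. if i < n then x i else y (i - n)) (\<lambda>i. if i < n then a i else b (i - n))
      = z \<oplus>\<^bsub>M\<^esub> w"
    unfolding a b by (rule lin_append_if) (use assms a b in auto)
  then show ?thesis unfolding lspan_def
    by (intro CollectI exI[of _ "\<lambda>i. if i < n then a i else b (i - n)"]) (use a b in auto)
qed

end

section \<open>Leading parts of linear combinations\<close>

context graded_module begin

lemma gcomp_smult:
  assumes "a \<in> carrier R" "x \<in> mgrade M j"
  shows "gm.part (a \<odot>\<^bsub>M\<^esub> x) n = gr.part a (n - j) \<odot>\<^bsub>M\<^esub> x"
  using assms(1)
proof (induction rule: gr.homog_induct)
  case (homog i y)
  have "y \<odot>\<^bsub>M\<^esub> x \<in> mgrade M (i + j)" using homog assms by (simp add: smult_grade)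
  then show ?case using homog assms
    by (auto simp: gr.gcomp_homog gm.gcomp_homog gm.D_carrier)
next
  case (add y z)
  then show ?case using assms by (simp add: smult_l_distr gr.gcomp_add gm.gcomp_add gm.D_carrier)
qed

lemma gcomp_lin:
  assumes "\<And>i. i < n \<Longrightarrow> u i \<in> mgrade M (e i)" "\<And>i. i < n \<Longrightarrow> a i \<in> carrier R"
  shows "gm.part (lin M n u a) d
    = lin M n u (\<lambda>i. gr.part (a i) (d - e i))"
  unfolding lin_def using assms
  by (subst gm.gcomp_sumn) (auto intro!: sumn_cong simp: gcomp_smult gm.D_carrier)

text \<open>Every product of components other than those of degrees \<open>p\<close> and
  \<open>q\<close> lands strictly below \<open>p + q\<close>. The two parts may vanish:
  \<open>p\<close> and \<open>q\<close> are bounds, not the actual degrees.\<close>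

lemma F_smult:
  assumes a: "a \<in> gr.F p" and x: "x \<in> gm.F q"
  shows "a \<odot>\<^bsub>M\<^esub> x \<in> gm.F (p + q) \<and>
    gm.part (a \<odot>\<^bsub>M\<^esub> x) (p + q) = gr.part a p \<odot>\<^bsub>M\<^esub> gm.part x q"
  using x
proof (induction rule: gm.F_induct)
  case (homog j y)
  have ac: "a \<in> carrier R" using a by blast
  have "gm.part (a \<odot>\<^bsub>M\<^esub> y) n = \<zero>\<^bsub>M\<^esub>" if "n > p + q" for n
    using homog ac gr.F_top_zero[OF a, of "n - j"] that
    by (simp add: gcomp_smult gm.D_carrier)
  moreover have "gm.part (a \<odot>\<^bsub>M\<^esub> y) (p + q)
      = gr.part a p \<odot>\<^bsub>M\<^esub> gm.part y q"
    using homog ac gr.F_top_zero[OF a, of "p + q - j"]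
    by (cases "j = q") (auto simp: gcomp_smult gm.gcomp_homog gm.D_carrier)
  ultimately show ?case using homog ac by (auto simp: fil_def gm.D_carrier)
next
  case (add y z)
  then have "y \<in> carrier M" "z \<in> carrier M" "a \<in> carrier R" using a by auto
  then show ?case using add
    by (auto simp: smult_r_distr gm.gcomp_add gm.F_add)
qed

lemma lin_F:
  assumes "\<And>i. i < n \<Longrightarrow> x i \<in> gm.F (e i)" "\<And>i. i < n \<Longrightarrow> a i \<in> gr.F (d - e i)"
  shows "lin M n x a \<in> gm.F d"
  unfolding lin_def
proof (rule gm.F_sumn)
  fix i assume "i < n"
  then show "a i \<odot>\<^bsub>M\<^esub> x i \<in> gm.F d"
    using F_smult[OF assms(2) assms(1), of i i] by auto
qed

text \<open>Cancellation in degree \<open>d\<close> thus amounts to a relation between the parts of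
  the \<open>x i\<close> in degree \<open>e i\<close>. Every S-pair argument below rests on
  this.\<close>

lemma gcomp_lin_top:
  assumes "\<And>i. i < n \<Longrightarrow> x i \<in> gm.F (e i)" "\<And>i. i < n \<Longrightarrow> a i \<in> gr.F (d - e i)"
  shows "gm.part (lin M n x a) d
    = lin M n (\<lambda>i. gm.part (x i) (e i)) (\<lambda>i. gr.part (a i) (d - e i))"
proof -
  have c: "x i \<in> carrier M" "a i \<in> carrier R" if "i < n" for i
    using that assms by auto
  show ?thesis
    unfolding lin_def
  proof (subst gm.gcomp_sumn)
    show "sumn M n (\<lambda>i. gm.part (a i \<odot>\<^bsub>M\<^esub> x i) d) =
      sumn M n (\<lambda>i. gr.part (a i) (d - e i) \<odot>\<^bsub>M\<^esub> gm.part (x i) (e i))"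
    proof (rule sumn_cong)
      fix i assume "i < n"
      then show "gm.part (a i \<odot>\<^bsub>M\<^esub> x i) d =
          gr.part (a i) (d - e i) \<odot>\<^bsub>M\<^esub> gm.part (x i) (e i)"
        using F_smult[OF assms(2) assms(1), of i i] by simp
    qed
  qed (use c in auto)
qed

lemma lin_D:
  assumes "\<And>i. i < n \<Longrightarrow> u i \<in> mgrade M (e i)" "\<And>i. i < n \<Longrightarrow> a i \<in> rgrade R (d - e i)"
  shows "lin M n u a \<in> mgrade M d"
  unfolding lin_def
proof (rule gm.D_sumn)
  fix i assume "i < n"
  then show "a i \<odot>\<^bsub>M\<^esub> u i \<in> mgrade M d"
    using smult_grade[OF assms(2) assms(1), of i i] by auto
qed

lemma hom_syzE:
  assumes "hom_syz_fg R M" "\<And>i. i < n \<Longrightarrow> u i \<in> mgrade M (e i)"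
  obtains m eps s where "\<forall>k<m. \<forall>i<n. s k i \<in> rgrade R (eps k - e i)" "syz_gen R M n u m s"
  using assms unfolding hom_syz_fg_def by blast

text \<open>Comparing \<open>a = b s\<close> in a single degree allows each \<open>b k\<close> to be
  replaced by its component of degree \<open>d - eps k\<close>; the left side does not change, being
  homogeneous.\<close>

lemma syz_gen_homogE:
  assumes s: "\<forall>k<m. \<forall>i<n. s k i \<in> rgrade R (eps k - e i)" and gen: "syz_gen R M n u m s"
    and a: "\<And>i. i < n \<Longrightarrow> a i \<in> rgrade R (d - e i)" "lin M n u a = \<zero>\<^bsub>M\<^esub>"
  obtains b where "\<forall>k<m. b k \<in> rgrade R (d - eps k)" "\<forall>i<n. a i = comb R m b s i"
proof -
  have "\<forall>i<n. a i \<in> carrier R" using a(1) by blast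
  then obtain b where b: "\<forall>k<m. b k \<in> carrier R" "\<forall>i<n. a i = comb R m b s i"
    using syz_genE[OF gen _ a(2)] by blast
  have "a i = comb R m (\<lambda>k. gr.part (b k) (d - eps k)) s i" if i: "i < n" for i
  proof -
    have "a i = gr.part (a i) (d - e i)" using a(1)[OF i] by (simp add: gr.gcomp_homog)
    also have "\<dots> = gr.part (comb R m b s i) (d - e i)" using b i by simp
    also have "\<dots> = comb R m (\<lambda>k. gr.part (b k) (d - eps k)) s i"
      by (rule gcomp_comb) (use b s i in auto)
    finally show ?thesis .
  qed
  then show ?thesis
    by (intro that[of "\<lambda>k. gr.part (b k) (d - eps k)"]) (use b in auto)
qed

text \<open>A relation between the leading terms lowers the degree: this is the S-pair step of
  Buchberger's algorithm.\<close>

lemma filspan_pred: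
  assumes P: "hom_syz_fg R M" and x: "\<And>i. i < n \<Longrightarrow> x i \<in> gm.F (e i)"
  shows "\<exists>m y c. (\<forall>j<m. y j \<in> gm.F (c j) \<and> y j \<in> lspan R M n x) \<and>
    (\<forall>d. filspan R M n x e (d + 1) \<inter> gm.F d \<subseteq> filspan R M m y c d)"
proof -
  define u where "u i = gm.part (x i) (e i)" for i
  have xc: "x i \<in> carrier M" if "i < n" for i using x that by blast
  have u: "\<And>i. i < n \<Longrightarrow> u i \<in> mgrade M (e i)" by (simp add: u_def xc)
  obtain m eps s where s': "\<forall>k<m. \<forall>i<n. s k i \<in> rgrade R (eps k - e i)"
    and gen: "syz_gen R M n u m s"
    by (rule hom_syzE[OF P u])
  have s: "\<And>k i. k < m \<Longrightarrow> i < n \<Longrightarrow> s k i \<in> rgrade R (eps k - e i)" using s' by blast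
  have sc: "s k i \<in> carrier R" if "k < m" "i < n" for k i using s that by blast
  \<comment> \<open>The S-polynomial of the leading relation \<open>s k\<close>. Its part in degree
    \<open>eps k\<close> cancels, so it receives the weight \<open>eps k - 1\<close>.\<close>
  define w where "w k = lin M n x (s k)" for k
  have wF: "w k \<in> gm.F (eps k - 1)" if k: "k < m" for k
  proof (rule gm.F_pred)
    have sF: "s k i \<in> gr.F (eps k - e i)" if "i < n" for i
      by (rule gr.D_F[OF s[OF k that]]) simp
    show "w k \<in> gm.F (eps k)" unfolding w_def by (rule lin_F[OF x sF])
    have "gm.part (w k) (eps k)
        = lin M n u (\<lambda>i. gr.part (s k i) (eps k - e i))"
      unfolding w_def u_def by (rule gcomp_lin_top[OF x sF])
    also have "\<dots> = lin M n u (s k)"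
      by (rule lin_cong) (use k in \<open>simp_all add: gr.gcomp_homog[OF s]\<close>)
    finally show "gm.part (w k) (eps k) = \<zero>\<^bsub>M\<^esub>" using syz_gen_zero[OF gen k] by simp
  qed
  have wl: "w k \<in> lspan R M n x" if "k < m" for k
    unfolding w_def lspan_def using sc that by auto
  have wc: "w k \<in> carrier M" if "k < m" for k using wF that by blast
  let ?y = "\<lambda>j. if j < n then x j else w (j - n)"
  let ?c = "\<lambda>j. if j < n then e j else eps (j - n) - 1"
  have "z \<in> filspan R M (n + m) ?y ?c d" if z: "z \<in> filspan R M n x e (d + 1)" "z \<in> gm.F d" for z d
  proof -
    from z obtain a where a: "\<And>i. i < n \<Longrightarrow> a i \<in> gr.F (d + 1 - e i)" and za: "z = lin M n x a"
      by (auto simp: filspan_def)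
    have ac: "a i \<in> carrier R" if "i < n" for i using a that by blast
    \<comment> \<open>\<open>t\<close> collects the top parts of the coefficients. As
      \<open>z\<close> has degree at most \<open>d\<close>, its part in degree \<open>d + 1\<close>
      vanishes, which makes \<open>t\<close> a relation between the \<open>u i\<close>.\<close>
    define t where "t i = gr.part (a i) (d + 1 - e i)" for i
    have t: "t i \<in> rgrade R (d + 1 - e i)" if "i < n" for i by (simp add: t_def ac that)
    have tc: "t i \<in> carrier R" if "i < n" for i using t that by blast
    have "lin M n u t = gm.part z (d + 1)"
      unfolding za u_def t_def by (rule gcomp_lin_top[OF x a, symmetric])
    then have "lin M n u t = \<zero>\<^bsub>M\<^esub>" using gm.F_top_zero[OF z(2)] by simp
    then obtain b where b: "\<forall>k<m. b k \<in> rgrade R (d + 1 - eps k)" "\<forall>i<n. t i = comb R m b s i"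
      by (rule syz_gen_homogE[OF s' gen t, rotated])
    have bc: "b k \<in> carrier R" if "k < m" for k using b that by blast
    \<comment> \<open>The tails \<open>a' i\<close> are one degree lower, hence admissible for the
      old generators at level \<open>d\<close>; the top parts \<open>t\<close> are rewritten through
      the \<open>w k\<close>.\<close>
    define a' where "a' i = a i \<ominus> t i" for i
    have a': "a' i \<in> gr.F (d - e i)" if i: "i < n" for i
    proof -
      have "a' i \<in> gr.F (d + 1 - e i)"
        unfolding a'_def using a t i gr.D_F[of "t i" "d + 1 - e i"] by auto
      moreover have "gr.part (a' i) (d + 1 - e i) = \<zero>"
        unfolding a'_def using ac tc t i
        by (simp add: gr.gcomp_diff gr.gcomp_homog[OF t[OF i]]) (simp add: t_def)
      ultimately show ?thesis using gr.F_pred[of "a' i" "d + 1 - e i"]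
        by (simp add: algebra_simps)
    qed
    have a'c: "a' i \<in> carrier R" if "i < n" for i using a' that by blast
    have "z = lin M n x (\<lambda>i. a' i \<oplus> t i)"
      unfolding za by (rule lin_cong) (use ac tc in \<open>auto simp: a'_def\<close>)
    also have "\<dots> = lin M n x a' \<oplus>\<^bsub>M\<^esub> lin M n x t"
      by (rule lin_add) (use xc a'c tc in auto)
    also have "lin M n x t = lin M n x (comb R m b s)"
      by (rule lin_cong) (use b in auto)
    also have "\<dots> = lin M m w b"
      unfolding w_def by (rule lin_comb) (use xc bc sc in auto)
    also have "lin M n x a' \<oplus>\<^bsub>M\<^esub> lin M m w b
        = lin M (n + m) ?y (\<lambda>j. if j < n then a' j else b (j - n))"
      by (rule lin_append_if[symmetric]) (use xc wc a'c bc in auto)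
    finally have z_eq: "z = lin M (n + m) ?y (\<lambda>j. if j < n then a' j else b (j - n))" .
    \<comment> \<open>\<open>d + 1 - eps k\<close> equals \<open>d - (eps k - 1)\<close>, exactly
      the degree allowed for the coefficient of \<open>w k\<close>.\<close>
    have "b k \<in> gr.F (d - (eps k - 1))" if "k < m" for k
      by (rule gr.D_F[of _ "d + 1 - eps k"]) (use b that in auto)
    then show ?thesis unfolding filspan_def z_eq
      by (intro CollectI exI[of _ "\<lambda>j. if j < n then a' j else b (j - n)"]) (use a' in auto)
  qed
  moreover have "?y j \<in> gm.F (?c j) \<and> ?y j \<in> lspan R M n x" if "j < n + m" for j
    using that x wF wl lspan_gen[of n x j] xc by auto
  ultimately show ?thesis
    by (intro exI[of _ "n + m"] exI[of _ ?y] exI[of _ ?c] conjI allI impI subsetI) blast+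
qed

text \<open>Each application of \<open>filspan_pred\<close> lowers the shift by one at the cost of
  new generators inside \<open>V\<close>. It is applied at level \<open>d + l\<close>, which is
  legitimate because an element of degree at most \<open>d\<close> also has degree at most
  \<open>d + l\<close>.\<close>

lemma fil_basis_of_shift:
  assumes P: "hom_syz_fg R M" and V: "submodule V R M"
    and "\<And>i. i < n \<Longrightarrow> x i \<in> gm.F (e i)" "\<And>i. i < n \<Longrightarrow> x i \<in> V"
    and "\<And>d. V \<inter> gm.F d \<subseteq> filspan R M n x e (d + int l)"
  shows "\<exists>m y c. fil_basis R M V m y c"
  using assms(3-)
proof (induction l arbitrary: n x e)
  case 0
  then have "fil_basis R M V n x e" by (auto simp: fil_basis_def)
  then show ?case by blast
next
  case (Suc l)
  have "\<exists>m y c. (\<forall>j<m. y j \<in> gm.F (c j) \<and> y j \<in> lspan R M n x) \<and>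
      (\<forall>d. filspan R M n x e (d + 1) \<inter> gm.F d \<subseteq> filspan R M m y c d)"
    by (rule filspan_pred[OF P]) (rule Suc.prems(1))
  then obtain m y c where y: "\<forall>j<m. y j \<in> gm.F (c j) \<and> y j \<in> lspan R M n x"
    and sub: "\<forall>d. filspan R M n x e (d + 1) \<inter> gm.F d \<subseteq> filspan R M m y c d"
    by (elim exE conjE)
  have "V \<inter> gm.F d \<subseteq> filspan R M m y c (d + int l)" for d
  proof
    fix z assume z: "z \<in> V \<inter> gm.F d"
    then have "z \<in> filspan R M n x e (d + int l + 1)"
      using Suc.prems(3)[of d] by (auto simp: algebra_simps)
    moreover have "z \<in> gm.F (d + int l)" using z gm.F_mono[of z d] by auto
    ultimately show "z \<in> filspan R M m y c (d + int l)" using sub by blast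
  qed
  moreover have "y j \<in> V" if "j < m" for j
    using y that lspan_least[of V n x, OF V Suc.prems(2)] by blast
  ultimately show ?case using Suc.IH[of m y c] y by blast
qed

end

section \<open>Relations of a filtration basis\<close>

text \<open>Associativity (c t) s = c (t s) of matrix products.\<close>

lemma (in ring) comb_assoc:
  assumes "\<And>l. l < p \<Longrightarrow> c l \<in> carrier R" "\<And>l k. l < p \<Longrightarrow> k < m \<Longrightarrow> t l k \<in> carrier R"
    "\<And>k. k < m \<Longrightarrow> s k i \<in> carrier R"
  shows "comb R m (comb R p c t) s i = comb R p c (\<lambda>l. comb R m (t l) s) i"
proof -
  have l: "sumn R q f \<otimes> x = sumn R q (\<lambda>k. f k \<otimes> x)"
    if "\<And>k. k < q \<Longrightarrow> f k \<in> carrier R" "x \<in> carrier R" for q f x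
    using that(1) by (induction q) (auto simp: that(2) l_distr)
  have r: "x \<otimes> sumn R q f = sumn R q (\<lambda>k. x \<otimes> f k)"
    if "\<And>k. k < q \<Longrightarrow> f k \<in> carrier R" "x \<in> carrier R" for q f x
    using that(1) by (induction q) (auto simp: that(2) r_distr)
  have "comb R m (comb R p c t) s i = sumn R m (\<lambda>k. sumn R p (\<lambda>l. c l \<otimes> (t l k \<otimes> s k i)))"
    unfolding comb_def
    by (rule sumn_cong, subst l) (auto simp: assms m_assoc intro!: sumn_cong)
  also have "\<dots> = sumn R p (\<lambda>l. sumn R m (\<lambda>k. c l \<otimes> (t l k \<otimes> s k i)))"
    by (rule sumn_swap) (auto simp: assms)
  also have "\<dots> = comb R p c (\<lambda>l. comb R m (t l) s) i"
    unfolding comb_def by (rule sumn_cong, subst r) (auto simp: assms)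
  finally show ?thesis .
qed

context graded_ring begin

text \<open>Turns non-negativity of the grading into the stopping criterion for lifting
  relations.\<close>

lemma F_neg:
  assumes "\<forall>n<0. rgrade R n = {\<zero>}" "x \<in> gr.F d" "d < 0"
  shows "x = \<zero>"
proof (rule gr.gcomp_ext)
  fix n
  show "gr.part x n = gr.part \<zero> n"
  proof (cases "d < n")
    case False
    then have "rgrade R n = {\<zero>}" using assms by auto
    then show ?thesis using assms(2) gr.gcomp_D[of x n] by auto
  qed (use assms in \<open>auto simp: fil_def\<close>)
qed (use assms in auto)

lemma comb_D:
  assumes "\<And>k. k < m \<Longrightarrow> b k \<in> rgrade R (d - eps k)" "\<And>k. k < m \<Longrightarrow> s k i \<in> rgrade R (eps k - e)"
  shows "comb R m b s i \<in> rgrade R (d - e)"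
  unfolding comb_def
proof (rule gr.D_sumn)
  fix k assume "k < m"
  then show "b k \<otimes> s k i \<in> rgrade R (d - e)"
    using mult_grade[OF assms(1) assms(2), of k k] by simp
qed

lemma comb_F:
  assumes "\<And>k. k < m \<Longrightarrow> b k \<in> gr.F (d - eps k)" "\<And>k. k < m \<Longrightarrow> s k i \<in> gr.F (eps k - e)"
  shows "comb R m b s i \<in> gr.F (d - e)"
  unfolding comb_def
proof (rule gr.F_sumn)
  fix k assume "k < m"
  then show "b k \<otimes> s k i \<in> gr.F (d - e)"
    using F_mult[OF assms(1) assms(2), of k k] by simp
qed

text \<open>Finitely many entries have a common bound for the excess over the expected degree
  \<open>d j - e i\<close>. For lifts of a basis of the quotient, this bound is the shift of the
  extension argument.\<close>

lemma common_shift: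
  fixes k n :: nat
  assumes "\<And>j i. j < k \<Longrightarrow> i < n \<Longrightarrow> r j i \<in> carrier R"
  shows "\<exists>l::nat. \<forall>j<k. \<forall>i<n. r j i \<in> gr.F (d j - e i + int l)"
proof -
  have "\<exists>l::nat. r j i \<in> gr.F (d j - e i + int l)" if ji: "j < k" "i < n" for j i
  proof -
    obtain q where "r j i \<in> gr.F q" using gr.F_exists assms ji by blast
    then have "r j i \<in> gr.F (d j - e i + int (nat (q - d j + e i)))"
      by (rule gr.F_mono) simp
    then show ?thesis by blast
  qed
  then obtain l where l: "\<And>j i. j < k \<Longrightarrow> i < n \<Longrightarrow> r j i \<in> gr.F (d j - e i + int (l j i))"
    by metis
  let ?A = "(\<lambda>(j, i). l j i) ` ({..<k} \<times> {..<n})"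
  have "r j i \<in> gr.F (d j - e i + int (Max ?A))" if "j < k" "i < n" for j i
  proof (rule gr.F_mono[OF l[OF that]])
    have "l j i \<le> Max ?A" by (rule Max_ge) (use that in auto)
    then show "d j - e i + int (l j i) \<le> d j - e i + int (Max ?A)" by simp
  qed
  then show ?thesis by blast
qed

end

context graded_module begin

text \<open>Relations of leading terms lift to relations of the basis, as in Schreyer's theorem; the
  descent on the degree terminates since \<open>R\<close> vanishes in negative degrees.\<close>

lemma syz_gen_fil_basis:
  assumes nonneg: "\<forall>n<0. rgrade R n = {\<zero>}" and P: "hom_syz_fg R M"
    and V: "submodule V R M" and fb: "fil_basis R M V n y e"
  shows "\<exists>m s. syz_gen R M n y m s"
proof -
  have yV: "y i \<in> V" and yF: "y i \<in> gm.F (e i)" if "i < n" for i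
    using fb that by (auto simp: fil_basis_def)
  have yc: "y i \<in> carrier M" if "i < n" for i using yF that by blast
  define u where "u i = gm.part (y i) (e i)" for i
  have u: "\<And>i. i < n \<Longrightarrow> u i \<in> mgrade M (e i)" by (simp add: u_def yc)
  obtain m eps s where s': "\<forall>k<m. \<forall>i<n. s k i \<in> rgrade R (eps k - e i)"
    and gen: "syz_gen R M n u m s"
    by (rule hom_syzE[OF P u])
  have s: "\<And>k i. k < m \<Longrightarrow> i < n \<Longrightarrow> s k i \<in> rgrade R (eps k - e i)" using s' by blast
  have sc: "s k i \<in> carrier R" if "k < m" "i < n" for k i using s that by blast
  \<comment> \<open>The S-polynomial lies in \<open>V\<close> and has degree at most
    \<open>eps k - 1\<close>, so the basis rewrites it with coefficients of that weight.\<close>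
  have "\<exists>r. (\<forall>i<n. r i \<in> gr.F (eps k - 1 - e i)) \<and> lin M n y (s k) = lin M n y r" if k: "k < m" for k
  proof -
    have sF: "s k i \<in> gr.F (eps k - e i)" if "i < n" for i
      by (rule gr.D_F[OF s[OF k that]]) simp
    have "gm.part (lin M n y (s k)) (eps k)
        = lin M n u (\<lambda>i. gr.part (s k i) (eps k - e i))"
      unfolding u_def by (rule gcomp_lin_top[OF yF sF])
    also have "\<dots> = lin M n u (s k)"
      by (rule lin_cong) (use k in \<open>simp_all add: gr.gcomp_homog[OF s]\<close>)
    also have "\<dots> = \<zero>\<^bsub>M\<^esub>" by (rule syz_gen_zero[OF gen k])
    finally have "gm.part (lin M n y (s k)) (eps k) = \<zero>\<^bsub>M\<^esub>" .
    moreover have "lin M n y (s k) \<in> gm.F (eps k)" by (rule lin_F[OF yF sF])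
    ultimately have "lin M n y (s k) \<in> gm.F (eps k - 1)" by (rule gm.F_pred[rotated])
    moreover have "lin M n y (s k) \<in> V"
      by (rule submodule_lin[OF V yV]) (use sc k in auto)
    ultimately show ?thesis using fb unfolding fil_basis_def filspan_def by blast
  qed
  then obtain r where r: "\<And>k i. k < m \<Longrightarrow> i < n \<Longrightarrow> r k i \<in> gr.F (eps k - 1 - e i)"
    and rs: "\<And>k. k < m \<Longrightarrow> lin M n y (s k) = lin M n y (r k)" by metis
  have rc: "r k i \<in> carrier R" if "k < m" "i < n" for k i using r that by blast
  \<comment> \<open>A leading relation minus its rewriting: a genuine relation of \<open>y\<close>
    whose leading part is \<open>s k\<close>.\<close>
  define sg where "sg k i = s k i \<ominus> r k i" for k i
  have sgc: "sg k i \<in> carrier R" if "k < m" "i < n" for k i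
    using sc rc that by (simp add: sg_def)
  have sg0: "lin M n y (sg k) = \<zero>\<^bsub>M\<^esub>" if k: "k < m" for k
  proof -
    have "lin M n y (sg k) = lin M n y (s k) \<ominus>\<^bsub>M\<^esub> lin M n y (r k)"
      unfolding sg_def by (rule lin_diff) (use k yc sc rc in auto)
    then show ?thesis using rs[OF k] k yc rc by (simp add: M.minus_eq_zero_iff)
  qed
  obtain e0 where e0: "\<And>i. i < n \<Longrightarrow> e0 \<le> e i"
    using finite_lessThan[of n] by (metis Min_le finite_imageI imageI lessThan_iff)
  \<comment> \<open>Induction on the height of \<open>a\<close> above the level
    \<open>e0 - 1\<close>. At height zero every coefficient has degree at most
    \<open>e0 - 1 - e i\<close>, which is negative, and therefore vanishes.\<close>
  have main: "\<exists>b. (\<forall>k<m. b k \<in> carrier R) \<and> (\<forall>i<n. a i = comb R m b sg i)"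
    if "\<forall>i<n. a i \<in> gr.F (e0 - 1 + int q - e i)" "lin M n y a = \<zero>\<^bsub>M\<^esub>" for a q
    using that
  proof (induction q arbitrary: a)
    case 0
    have "a i = \<zero>" if "i < n" for i
      by (rule F_neg[OF nonneg, of _ "e0 - 1 - e i"]) (use 0 that e0[of i] in auto)
    moreover have "comb R m (\<lambda>k. \<zero>) sg i = \<zero>" if "i < n" for i
      unfolding comb_def by (rule R.sumn_zero) (use sgc that in auto)
    ultimately show ?case by (intro exI[of _ "\<lambda>k. \<zero>"]) auto
  next
    case (Suc q)
    define d where "d = e0 + int q"
    have aF: "a i \<in> gr.F (d - e i)" if "i < n" for i
      using Suc.prems(1) that by (simp add: d_def)
    have ac: "a i \<in> carrier R" if "i < n" for i using aF that by blast
    define t where "t i = gr.part (a i) (d - e i)" for i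
    have t: "t i \<in> rgrade R (d - e i)" if "i < n" for i by (simp add: t_def ac that)
    have "lin M n u t = gm.part (lin M n y a) d"
      unfolding u_def t_def by (rule gcomp_lin_top[OF yF aF, symmetric])
    then have "lin M n u t = \<zero>\<^bsub>M\<^esub>" using Suc.prems(2) by simp
    then obtain b where b: "\<forall>k<m. b k \<in> rgrade R (d - eps k)" "\<forall>i<n. t i = comb R m b s i"
      by (rule syz_gen_homogE[OF s' gen t, rotated])
    have bc: "b k \<in> carrier R" if "k < m" for k using b that by blast
    \<comment> \<open>Subtracting \<open>b sg\<close> removes the leading parts, because
      \<open>b s = t\<close>, and adds back only \<open>b r\<close>, which has lower weight
      already.\<close>
    define a' where "a' i = a i \<ominus> comb R m b sg i" for i
    have cc: "comb R m b sg i \<in> carrier R" if "i < n" for i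
      using bc sgc that by auto
    have "a' i \<in> gr.F (e0 - 1 + int q - e i)" if i: "i < n" for i
    proof -
      have "comb R m b sg i = comb R m b s i \<ominus> comb R m b r i"
        unfolding comb_def sg_def a_minus_def using bc sc rc i
        by (subst R.sumn_minus[symmetric], simp, subst R.sumn_add[symmetric])
          (auto simp: r_distr r_minus intro!: sumn_cong)
      then have "a' i = (a i \<ominus> t i) \<oplus> comb R m b r i"
        unfolding a'_def using b i ac t bc rc comb_closed[of m b r i] gr.D_carrier[OF t[OF i]]
        by (simp add: R.minus_eq R.minus_add R.a_assoc)
      moreover have "a i \<ominus> t i \<in> gr.F (d - e i - 1)"
      proof (rule gr.F_pred)
        show "a i \<ominus> t i \<in> gr.F (d - e i)"
          using aF[OF i] gr.D_F[OF t[OF i]] by auto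
        show "gr.part (a i \<ominus> t i) (d - e i) = \<zero>"
          using ac[OF i] gr.D_carrier[OF t[OF i]]
          by (simp add: gr.gcomp_diff gr.gcomp_homog[OF t[OF i]]) (simp add: t_def R.minus_eq R.r_neg)
      qed
      moreover have "comb R m b r i \<in> gr.F (d - 1 - e i)"
      proof (rule comb_F)
        show "b k \<in> gr.F (d - 1 - (eps k - 1))" if "k < m" for k
          by (rule gr.D_F[of _ "d - eps k"]) (use b that in auto)
      qed (use r i in auto)
      ultimately show ?thesis using gr.F_add by (simp add: d_def algebra_simps)
    qed
    moreover have "lin M n y a' = \<zero>\<^bsub>M\<^esub>"
    proof -
      have "lin M n y (comb R m b sg) = lin M m (\<lambda>k. lin M n y (sg k)) b"
        by (rule lin_comb) (use yc bc sgc in auto)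
      also have "\<dots> = \<zero>\<^bsub>M\<^esub>" unfolding lin_def[of M m]
        by (rule M.sumn_zero) (use sg0 bc in auto)
      finally have "lin M n y (comb R m b sg) = \<zero>\<^bsub>M\<^esub>" .
      moreover have "lin M n y a' = lin M n y a \<ominus>\<^bsub>M\<^esub> lin M n y (comb R m b sg)"
        unfolding a'_def by (rule lin_diff) (use yc ac cc in auto)
      ultimately show ?thesis using Suc.prems(2) by (simp add: M.minus_eq)
    qed
    ultimately obtain b' where b': "\<forall>k<m. b' k \<in> carrier R" "\<forall>i<n. a' i = comb R m b' sg i"
      using Suc.IH by blast
    have "a i = comb R m (\<lambda>k. b' k \<oplus> b k) sg i" if i: "i < n" for i
    proof -
      have "comb R m (\<lambda>k. b' k \<oplus> b k) sg i = comb R m b' sg i \<oplus> comb R m b sg i"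
        unfolding comb_def using bc b' sgc i
        by (subst R.sumn_add[symmetric]) (auto simp: l_distr intro!: sumn_cong)
      also have "\<dots> = a' i \<oplus> comb R m b sg i" using b' i by simp
      also have "\<dots> = a i" unfolding a'_def using ac cc i by simp
      finally show ?thesis ..
    qed
    then show ?case by (intro exI[of _ "\<lambda>k. b' k \<oplus> b k"]) (use b' bc in auto)
  qed
  have "\<exists>b. (\<forall>k<m. b k \<in> carrier R) \<and> (\<forall>i<n. a i = comb R m b sg i)"
    if a: "\<forall>i<n. a i \<in> carrier R" "lin M n y a = \<zero>\<^bsub>M\<^esub>" for a
  proof -
    \<comment> \<open>The tuple \<open>a\<close> is viewed as a matrix with one row, to find a
      height at which the induction applies.\<close>
    obtain l :: nat where "\<forall>j<(1::nat). \<forall>i<n. a i \<in> gr.F (e0 - 1 - e i + int l)"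
      using common_shift[of 1 n "\<lambda>j. a" "\<lambda>j. e0 - 1" e] a by (auto simp del: all_simps)
    then have "\<forall>i<n. a i \<in> gr.F (e0 - 1 + int l - e i)" by (simp add: algebra_simps)
    then show ?thesis using main a by blast
  qed
  then have "syz_gen R M n y m sg"
    unfolding syz_gen_def using sgc sg0 by blast
  then show ?thesis by blast
qed

end

section \<open>Graded homomorphisms\<close>

lemma gcoh_fil_basis:
  "\<lbrakk>gcoh R M; \<forall>i<n. x i \<in> carrier M\<rbrakk> \<Longrightarrow> \<exists>m y e. fil_basis R M (lspan R M n x) m y e"
  unfolding gcoh_def by blast

locale graded_lin_map = M?: graded_module R M + N?: graded_module R N
  for R (structure) and M (structure) and N (structure) +
  fixes f
  assumes graded_hom: "f \<in> graded_hom R M N"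
begin

sublocale lin_map R M N f
  by unfold_locales (use graded_hom in \<open>auto simp: graded_hom_def\<close>)

sublocale graded_add_map M N f "mgrade M" "mgrade N"
  by unfold_locales (use graded_hom in \<open>auto simp: graded_hom_def\<close>)

lemma map_lspan:
  assumes "\<And>i. i < n \<Longrightarrow> x i \<in> carrier M"
  shows "f ` lspan R M n x = lspan R N n (\<lambda>i. f (x i))"
proof
  show "f ` lspan R M n x \<subseteq> lspan R N n (\<lambda>i. f (x i))"
    using assms by (auto simp: lspan_def map_lin)
  show "lspan R N n (\<lambda>i. f (x i)) \<subseteq> f ` lspan R M n x"
  proof
    fix z assume "z \<in> lspan R N n (\<lambda>i. f (x i))"
    then obtain a where a: "\<forall>i<n. a i \<in> carrier R" "z = lin N n (\<lambda>i. f (x i)) a"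
      by (auto simp: lspan_def)
    then have "z = f (lin M n x a)" using assms by (simp add: map_lin)
    moreover have "lin M n x a \<in> lspan R M n x" using a by (auto simp: lspan_def)
    ultimately show "z \<in> f ` lspan R M n x" by blast
  qed
qed

text \<open>A combination of generators \<open>u i\<close> of \<open>M\<close> lies in the kernel
  exactly when its coefficients form a relation of the \<open>f (u i)\<close>. Evaluating
  homogeneous generators of these relations at \<open>u\<close> gives homogeneous generators of the
  kernel.\<close>

lemma ker_hom_fg:
  assumes "hom_fg R M" "hom_syz_fg R N"
  shows "\<exists>m eps w. (\<forall>k<m. w k \<in> mgrade M (eps k) \<and> f (w k) = \<zero>\<^bsub>N\<^esub>) \<and>
    (\<forall>x\<in>carrier M. f x = \<zero>\<^bsub>N\<^esub> \<longrightarrow> x \<in> lspan R M m w)"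
proof -
  from assms(1) obtain n e u where u: "\<forall>i<n. u i \<in> mgrade M (e i)" "carrier M = lspan R M n u"
    unfolding hom_fg_def by blast
  have uc: "u i \<in> carrier M" if "i < n" for i using u(1) that M.gm.D_carrier by blast
  have fu: "f (u i) \<in> mgrade N (e i)" if "i < n" for i using u(1) that map_D by blast
  obtain m eps s where s: "\<forall>k<m. \<forall>i<n. s k i \<in> rgrade R (eps k - e i)"
    and gen: "syz_gen R N n (\<lambda>i. f (u i)) m s"
    by (rule N.hom_syzE[OF assms(2) fu])
  have sc: "s k i \<in> carrier R" if "k < m" "i < n" for k i using s that M.R.gr.D_carrier by blast
  define w where "w k = lin M n u (s k)" for k
  have "w k \<in> mgrade M (eps k)" if "k < m" for k
    unfolding w_def by (rule M.lin_D) (use u s that in auto)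
  moreover have "f (w k) = \<zero>\<^bsub>N\<^esub>" if "k < m" for k
    unfolding w_def using syz_gen_zero[OF gen that] that uc sc by (simp add: map_lin)
  moreover have "x \<in> lspan R M m w" if x: "x \<in> carrier M" "f x = \<zero>\<^bsub>N\<^esub>" for x
  proof -
    obtain a where a: "\<forall>i<n. a i \<in> carrier R" "x = lin M n u a"
      using x u(2) by (auto simp: lspan_def)
    then have "lin N n (\<lambda>i. f (u i)) a = \<zero>\<^bsub>N\<^esub>" using x uc by (simp add: map_lin)
    then obtain b where b: "\<forall>k<m. b k \<in> carrier R" "\<forall>i<n. a i = comb R m b s i"
      by (rule syz_genE[OF gen a(1)])
    have "x = lin M n u (comb R m b s)" unfolding a by (rule lin_cong) (use b in auto)
    also have "\<dots> = lin M m w b" unfolding w_def by (rule M.M.lin_comb) (use uc b sc in auto)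
    finally show ?thesis using b by (auto simp: lspan_def)
  qed
  ultimately show ?thesis by blast
qed

section \<open>Injective graded maps\<close>

lemma inj_zero: "inj_on f (carrier M) \<Longrightarrow> x \<in> carrier M \<Longrightarrow> f x = \<zero>\<^bsub>N\<^esub> \<Longrightarrow> x = \<zero>\<^bsub>M\<^esub>"
  by (metis M.M.M.zero_closed inj_onD map_zero)

lemma inj_D:
  assumes "inj_on f (carrier M)" "x \<in> carrier M" "f x \<in> mgrade N d"
  shows "x \<in> mgrade M d"
proof -
  have "f (gcomp M (mgrade M) x d) = f x"
    using map_gcomp[OF assms(2), of d] assms(3) by (simp add: N.gm.gcomp_homog)
  then have "gcomp M (mgrade M) x d = x"
    using assms by (meson M.gm.gcomp_closed inj_onD)
  then show ?thesis using M.gm.gcomp_D[OF assms(2), of d] by simp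
qed

text \<open>\<open>f\<close> commutes with components and kills no nonzero one, so it reflects
  degrees.\<close>

lemma inj_fil:
  assumes "inj_on f (carrier M)" "x \<in> carrier M" "f x \<in> fil N (mgrade N) d"
  shows "x \<in> fil M (mgrade M) d"
  using assms(2,3) inj_zero[OF assms(1)] by (auto simp: fil_def map_gcomp)

text \<open>A tuple and its image under an injective map have the same relations, so generators
  found in \<open>N\<close> serve unchanged.\<close>

lemma inj_hom_syz_fg:
  assumes inj: "inj_on f (carrier M)" and P: "hom_syz_fg R N"
  shows "hom_syz_fg R M"
  unfolding hom_syz_fg_def
proof (intro allI impI)
  fix n :: nat and e u assume u: "\<forall>i<n. u i \<in> mgrade M (e i)"
  have eq: "lin M n u a = \<zero>\<^bsub>M\<^esub> \<longleftrightarrow> lin N n (\<lambda>i. f (u i)) a = \<zero>\<^bsub>N\<^esub>"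
    if "\<forall>i<n. a i \<in> carrier R" for a
  proof -
    have uc: "u i \<in> carrier M" if "i < n" for i using u that M.gm.D_carrier by blast
    then have "lin M n u a \<in> carrier M" by (rule M.M.lin_closed) (use that in blast)+
    moreover have "f (lin M n u a) = lin N n (\<lambda>i. f (u i)) a"
      by (rule map_lin[OF uc]) (use that in blast)+
    ultimately show ?thesis using inj_zero[OF inj] map_zero by metis
  qed
  have fu: "f (u i) \<in> mgrade N (e i)" if "i < n" for i using u map_D that by blast
  obtain m eps s where s: "\<forall>k<m. \<forall>i<n. s k i \<in> rgrade R (eps k - e i)"
    and gen: "syz_gen R N n (\<lambda>i. f (u i)) m s"
    by (rule N.hom_syzE[OF P fu])
  have "syz_gen R M n u m s"
    unfolding syz_gen_def
  proof (intro conjI allI impI)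
    show sc: "s k i \<in> carrier R" if "k < m" "i < n" for k i by (rule syz_gen_carrier[OF gen that])
    show "lin M n u (s k) = \<zero>\<^bsub>M\<^esub>" if "k < m" for k
      using eq sc syz_gen_zero[OF gen that] that by blast
    show "\<exists>b. (\<forall>k<m. b k \<in> carrier R) \<and> (\<forall>i<n. a i = comb R m b s i)"
      if a: "\<forall>i<n. a i \<in> carrier R" "lin M n u a = \<zero>\<^bsub>M\<^esub>" for a
    proof -
      have "lin N n (\<lambda>i. f (u i)) a = \<zero>\<^bsub>N\<^esub>" using eq[OF a(1)] a(2) by simp
      then show ?thesis by (rule syz_genE[OF gen a(1)]) blast
    qed
  qed
  with s show "\<exists>m eps s. (\<forall>k<m. \<forall>i<n. s k i \<in> rgrade R (eps k - e i)) \<and> syz_gen R M n u m s" by blast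
qed

text \<open>A filtration basis of the image of a span is pulled back element by element with the
  same weights. \<open>hom_fg\<close> is assumed because a submodule of a finitely generated module
  need not be finitely generated.\<close>

lemma gcoh_inj:
  assumes inj: "inj_on f (carrier M)" and fg: "hom_fg R M" and N: "gcoh R N"
  shows "gcoh R M"
proof -
  have P: "hom_syz_fg R M" using inj_hom_syz_fg[OF inj] N by (auto simp: gcoh_def)
  have "\<exists>m y e. fil_basis R M (lspan R M n x) m y e" if x: "\<forall>i<n. x i \<in> carrier M" for n x
  proof -
    have img: "f ` lspan R M n x = lspan R N n (\<lambda>i. f (x i))"
      by (rule map_lspan) (use x in auto)
    have "\<forall>i<n. f (x i) \<in> carrier N" using x by auto
    from gcoh_fil_basis[OF N this]
    obtain m y e where "fil_basis R N (lspan R N n (\<lambda>i. f (x i))) m y e" by blast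
    then have fb: "fil_basis R N (f ` lspan R M n x) m y e" by (simp add: img)
    have sub: "lspan R M n x \<subseteq> carrier M" using M.M.lspan_subset[of n x] x by auto
    have "\<forall>j<m. \<exists>y'. y' \<in> lspan R M n x \<and> y j = f y'"
      using fb by (auto simp: fil_basis_def)
    then obtain y' where y': "\<And>j. j < m \<Longrightarrow> y' j \<in> lspan R M n x \<and> y j = f (y' j)" by metis
    have y'c: "y' j \<in> carrier M" if "j < m" for j using y'[OF that] sub by blast
    have "z \<in> filspan R M m y' e d" if z: "z \<in> lspan R M n x" "z \<in> fil M (mgrade M) d" for z d
    proof -
      have "f z \<in> filspan R N m y e d" using fb z map_fil by (fastforce simp: fil_basis_def)
      then obtain a where a: "\<forall>j<m. a j \<in> fil R (rgrade R) (d - e j)" "f z = lin N m y a"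
        by (auto simp: filspan_def)
      have ac: "a j \<in> carrier R" if "j < m" for j using a(1) that M.R.gr.F_closed by blast
      have "f z = lin N m (\<lambda>j. f (y' j)) a" unfolding a by (rule lin_cong) (use y' in auto)
      also have "\<dots> = f (lin M m y' a)" by (rule map_lin[symmetric]) (use y'c ac in auto)
      finally have "z = lin M m y' a"
        using inj z sub M.M.lin_closed[of m y' a] y'c ac by (meson inj_onD subsetD)
      then show ?thesis using a by (auto simp: filspan_def)
    qed
    moreover have "y' j \<in> fil M (mgrade M) (e j)" if "j < m" for j
      by (rule inj_fil[OF inj y'c[OF that]]) (use y' fb that in \<open>auto simp: fil_basis_def\<close>)
    ultimately have "fil_basis R M (lspan R M n x) m y' e"
      using y' by (auto simp: fil_basis_def)
    then show ?thesis by blast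
  qed
  then show ?thesis using P fg M.graded_module_axioms by (auto simp: gcoh_def)
qed

section \<open>Surjective graded maps\<close>

lemma surj_D:
  assumes "f ` carrier M = carrier N" "y \<in> mgrade N d"
  shows "\<exists>x\<in>mgrade M d. f x = y"
proof -
  obtain x where x: "x \<in> carrier M" "f x = y" using assms N.gm.D_carrier by (metis imageE)
  have "f (gcomp M (mgrade M) x d) = y"
    using map_gcomp[OF x(1), of d] x assms by (simp add: N.gm.gcomp_homog)
  then show ?thesis using x by auto
qed

text \<open>Homogeneous summands lift to homogeneous elements of the same degree. An arbitrary
  preimage could exceed the bound.\<close>

lemma surj_fil:
  assumes "f ` carrier M = carrier N" "y \<in> fil N (mgrade N) d"
  shows "\<exists>x\<in>fil M (mgrade M) d. f x = y"
  using assms(2)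
proof (induction rule: N.gm.F_induct)
  case (homog j y)
  then show ?case using surj_D[OF assms(1)] M.gm.D_F by metis
next
  case (add y z)
  then obtain x x' where "x \<in> fil M (mgrade M) d" "f x = y" "x' \<in> fil M (mgrade M) d" "f x' = z"
    by blast
  then show ?case
    by (intro bexI[of _ "x \<oplus>\<^bsub>M\<^esub> x'"]) (auto simp: map_add M.gm.F_closed)
qed

text \<open>The tuple \<open>v\<close> generates the kernel. Relations in \<open>N\<close> are
  relations in \<open>M\<close> of lifts together with \<open>v\<close>, cut to the first
  \<open>n\<close> entries; a span in \<open>N\<close> is studied through its full preimage, whose
  filtration basis maps to a filtration basis.\<close>

lemma gcoh_surj:
  assumes surj: "f ` carrier M = carrier N"
    and v: "\<And>k. k < q \<Longrightarrow> v k \<in> mgrade M (c k)" "\<And>k. k < q \<Longrightarrow> f (v k) = \<zero>\<^bsub>N\<^esub>"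
    and ker: "\<And>x. x \<in> carrier M \<Longrightarrow> f x = \<zero>\<^bsub>N\<^esub> \<Longrightarrow> x \<in> lspan R M q v"
    and M: "gcoh R M"
  shows "gcoh R N"
proof -
  have vc: "v k \<in> carrier M" if "k < q" for k using v that by blast
  have lv: "f (lin M q v a) = \<zero>\<^bsub>N\<^esub>" if "\<And>k. k < q \<Longrightarrow> a k \<in> carrier R" for a
  proof -
    have "f (lin M q v a) = lin N q (\<lambda>k. f (v k)) a" by (rule map_lin) (use vc that in auto)
    also have "\<dots> = \<zero>\<^bsub>N\<^esub>" unfolding lin_def by (rule N.M.M.sumn_zero) (use v that in auto)
    finally show ?thesis .
  qed
  \<comment> \<open>The last \<open>q\<close> generators go to zero under \<open>f\<close>, so their
    coefficients disappear in \<open>N\<close>.\<close>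
  have lift: "f (lin M (n + q) (\<lambda>i. if i < n then x i else v (i - n)) a) = lin N n u a"
    if x: "\<And>i. i < n \<Longrightarrow> x i \<in> carrier M" "\<And>i. i < n \<Longrightarrow> f (x i) = u i"
      and a: "\<And>i. i < n + q \<Longrightarrow> a i \<in> carrier R" for n x u a
  proof -
    have "lin M (n + q) (\<lambda>i. if i < n then x i else v (i - n)) a
        = lin M n x a \<oplus>\<^bsub>M\<^esub> lin M q v (\<lambda>i. a (n + i))"
      by (subst M.M.lin_append)
        (use x vc a in \<open>auto intro!: arg_cong2[where f="(\<oplus>\<^bsub>M\<^esub>)"] lin_cong\<close>)
    then have "f (lin M (n + q) (\<lambda>i. if i < n then x i else v (i - n)) a)
        = f (lin M n x a) \<oplus>\<^bsub>N\<^esub> f (lin M q v (\<lambda>i. a (n + i)))"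
      using x vc a by (simp add: map_add)
    also have "f (lin M q v (\<lambda>i. a (n + i))) = \<zero>\<^bsub>N\<^esub>" by (rule lv) (use a in auto)
    also have "f (lin M n x a) = lin N n (\<lambda>i. f (x i)) a" by (rule map_lin) (use x a in auto)
    also have "\<dots> \<oplus>\<^bsub>N\<^esub> \<zero>\<^bsub>N\<^esub> = lin N n (\<lambda>i. f (x i)) a"
      using N.M.lin_closed[of n "\<lambda>i. f (x i)" a] x(1) a by simp
    also have "\<dots> = lin N n u a" by (rule lin_cong) (use x in auto)
    finally show ?thesis .
  qed
  have "hom_fg R N"
  proof -
    obtain n e u where u: "\<forall>i<n. u i \<in> mgrade M (e i)" "carrier M = lspan R M n u"
      using M by (auto simp: gcoh_def hom_fg_def)
    have uc: "u i \<in> carrier M" if "i < n" for i using u(1) that M.gm.D_carrier by blast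
    have "carrier N = lspan R N n (\<lambda>i. f (u i))"
      using map_lspan[of n u, OF uc] surj u(2) by simp
    moreover have "\<forall>i<n. f (u i) \<in> mgrade N (e i)" using u(1) map_D by blast
    ultimately show ?thesis unfolding hom_fg_def by (intro exI conjI)
  qed
  moreover have "hom_syz_fg R N"
    unfolding hom_syz_fg_def
  proof (intro allI impI)
    fix n :: nat and e u assume u: "\<forall>i<n. u i \<in> mgrade N (e i)"
    then have "\<forall>i. \<exists>x. i < n \<longrightarrow> x \<in> mgrade M (e i) \<and> f x = u i" using surj_D[OF surj] by blast
    then obtain x where x: "\<And>i. i < n \<Longrightarrow> x i \<in> mgrade M (e i)" "\<And>i. i < n \<Longrightarrow> f (x i) = u i" by metis
    have xc: "x i \<in> carrier M" if "i < n" for i using x that by blast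
    let ?x = "\<lambda>i. if i < n then x i else v (i - n)" and ?e = "\<lambda>i. if i < n then e i else c (i - n)"
    have "hom_syz_fg R M" using M by (auto simp: gcoh_def)
    moreover have "?x i \<in> mgrade M (?e i)" if "i < n + q" for i using that x v by auto
    ultimately obtain m eps s where s: "\<forall>k<m. \<forall>i<n+q. s k i \<in> rgrade R (eps k - ?e i)"
      and gen: "syz_gen R M (n+q) ?x m s"
      by (rule M.hom_syzE)
    have sc: "s k i \<in> carrier R" if "k < m" "i < n + q" for k i
      using s that M.R.gr.D_carrier by blast
    have sD: "s k i \<in> rgrade R (eps k - e i)" if "k < m" "i < n" for k i
      using s[rule_format, of k i] that by simp
    have "lin N n u (s k) = \<zero>\<^bsub>N\<^esub>" if "k < m" for k
      using lift[of n x u "s k"] xc x(2) sc syz_gen_zero[OF gen that] that by simp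
    moreover have "\<exists>b. (\<forall>k<m. b k \<in> carrier R) \<and> (\<forall>i<n. a i = comb R m b s i)"
      if a: "\<forall>i<n. a i \<in> carrier R" "lin N n u a = \<zero>\<^bsub>N\<^esub>" for a
    proof -
      have "f (lin M n x a) = lin N n (\<lambda>i. f (x i)) a" by (rule map_lin) (use xc a in auto)
      also have "\<dots> = lin N n u a" by (rule lin_cong) (use x in auto)
      finally have "f (lin M n x a) = \<zero>\<^bsub>N\<^esub>" using a by simp
      then have "lin M n x a \<in> lspan R M q v" using ker xc a by auto
      then obtain b where b: "\<forall>k<q. b k \<in> carrier R" "lin M n x a = lin M q v b"
        by (auto simp: lspan_def)
      \<comment> \<open>\<open>a\<close> is a relation of the lifts only modulo the kernel; the last
        \<open>q\<close> entries cancel the kernel element \<open>lin M q v b\<close>.\<close>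
      let ?a = "\<lambda>i. if i < n then a i else \<ominus> b (i - n)"
      have ac: "?a i \<in> carrier R" if "i < n + q" for i using that a b by auto
      have "lin M (n+q) ?x ?a = lin M n x a \<oplus>\<^bsub>M\<^esub> lin M q v (\<lambda>i. \<ominus> b i)"
        by (rule M.M.lin_append_if) (use xc vc a b in auto)
      also have "\<dots> = \<zero>\<^bsub>M\<^esub>" using b vc by (simp add: M.M.lin_minus M.M.M.r_neg)
      finally have z: "lin M (n+q) ?x ?a = \<zero>\<^bsub>M\<^esub>" .
      have "\<forall>i<n+q. ?a i \<in> carrier R" using ac by blast
      then obtain b' where b': "\<forall>k<m. b' k \<in> carrier R" "\<forall>i<n+q. ?a i = comb R m b' s i"
        by (rule syz_genE[OF gen _ z])
      have "a i = comb R m b' s i" if "i < n" for i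
        using b'(2)[rule_format, of i] that by simp
      with b'(1) show ?thesis by blast
    qed
    ultimately have "syz_gen R N n u m s" unfolding syz_gen_def using sc by simp
    moreover have "\<forall>k<m. \<forall>i<n. s k i \<in> rgrade R (eps k - e i)" using sD by blast
    ultimately show "\<exists>m eps s. (\<forall>k<m. \<forall>i<n. s k i \<in> rgrade R (eps k - e i)) \<and> syz_gen R N n u m s" by blast
  qed
  moreover have "\<exists>m y e. fil_basis R N (lspan R N n u) m y e" if u: "\<forall>i<n. u i \<in> carrier N" for n u
  proof -
    have "\<forall>i. \<exists>x. i < n \<longrightarrow> x \<in> carrier M \<and> f x = u i" using u surj by (metis imageE)
    then obtain x where x: "\<And>i. i < n \<Longrightarrow> x i \<in> carrier M" "\<And>i. i < n \<Longrightarrow> f (x i) = u i" by metis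
    let ?x = "\<lambda>i. if i < n then x i else v (i - n)"
    let ?V = "lspan R M (n + q) ?x"
    have xc: "?x i \<in> carrier M" if "i < n + q" for i using that x vc by auto
    have "\<forall>i<n+q. ?x i \<in> carrier M" using xc by blast
    from gcoh_fil_basis[OF M this] obtain m y e where fb: "fil_basis R M ?V m y e" by blast
    have yc: "y j \<in> carrier M" if "j < m" for j
      using fb that M.gm.F_closed by (auto simp: fil_basis_def)
    have fV: "f z \<in> lspan R N n u" if z: "z \<in> ?V" for z
    proof -
      obtain a where a: "\<forall>i<n+q. a i \<in> carrier R" "z = lin M (n+q) ?x a"
        using z by (auto simp: lspan_def)
      then have "f z = lin N n u a" using lift[of n x u a] x by simp
      then show ?thesis using a by (auto simp: lspan_def)
    qed
    have "z \<in> filspan R N m (\<lambda>j. f (y j)) e d"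
      if z: "z \<in> lspan R N n u" "z \<in> fil N (mgrade N) d" for z d
    proof -
      \<comment> \<open>\<open>z1\<close> is chosen for its degree alone. It still lies in
        \<open>?V\<close>, as it differs from a combination of the \<open>x i\<close> by a kernel
        element.\<close>
      obtain z1 where z1: "z1 \<in> fil M (mgrade M) d" "f z1 = z" using surj_fil[OF surj z(2)] by blast
      obtain a where a: "\<forall>i<n. a i \<in> carrier R" "z = lin N n u a" using z by (auto simp: lspan_def)
      have "z = lin N n (\<lambda>i. f (x i)) a" unfolding a by (rule lin_cong) (use x in auto)
      also have "\<dots> = f (lin M n x a)" by (rule map_lin[symmetric]) (use x a in auto)
      finally have zx: "z = f (lin M n x a)" .
      have z1c: "z1 \<in> carrier M" using z1 by blast
      have lc: "lin M n x a \<in> carrier M" using x a by auto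
      have "f (z1 \<ominus>\<^bsub>M\<^esub> lin M n x a) = \<zero>\<^bsub>N\<^esub>"
        using zx z1 z1c lc by (simp add: map_diff N.M.M.minus_eq_zero_iff)
      then have "z1 \<ominus>\<^bsub>M\<^esub> lin M n x a \<in> lspan R M q v" using ker z1c lc by auto
      moreover have "lin M n x a \<in> lspan R M n x" using a by (auto simp: lspan_def)
      ultimately have "lin M n x a \<oplus>\<^bsub>M\<^esub> (z1 \<ominus>\<^bsub>M\<^esub> lin M n x a) \<in> ?V"
        using M.M.lspan_append[of n x q v] x vc by blast
      moreover have "lin M n x a \<oplus>\<^bsub>M\<^esub> (z1 \<ominus>\<^bsub>M\<^esub> lin M n x a) = z1"
        using z1c lc M.M.M.a_comm[of "lin M n x a" "z1 \<ominus>\<^bsub>M\<^esub> lin M n x a"] by simp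
      ultimately have "z1 \<in> ?V" by simp
      then obtain b where b: "\<forall>j<m. b j \<in> fil R (rgrade R) (d - e j)" "z1 = lin M m y b"
        using fb z1 unfolding fil_basis_def filspan_def by blast
      have "z = lin N m (\<lambda>j. f (y j)) b"
        unfolding z1(2)[symmetric] b(2) by (rule map_lin) (use yc b M.R.gr.F_closed in auto)
      then show ?thesis using b by (auto simp: filspan_def)
    qed
    moreover have "f (y j) \<in> lspan R N n u \<and> f (y j) \<in> fil N (mgrade N) (e j)" if "j < m" for j
      using fb that fV map_fil by (auto simp: fil_basis_def)
    ultimately have "fil_basis R N (lspan R N n u) m (\<lambda>j. f (y j)) e"
      by (auto simp: fil_basis_def)
    then show ?thesis by blast
  qed
  ultimately show ?thesis using N.graded_module_axioms by (auto simp: gcoh_def)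
qed

end

section \<open>Extensions\<close>

locale graded_short_exact =
  f: graded_lin_map R L M f + g: graded_lin_map R M N g
  for R (structure) and L and M and N and f and g +
  assumes nonneg: "\<forall>n<0. rgrade R n = {\<zero>}"
    and inj: "inj_on f (carrier L)"
    and exact: "f ` carrier L = {x \<in> carrier M. g x = \<zero>\<^bsub>N\<^esub>}"
    and surj: "g ` carrier M = carrier N"
    and L: "gcoh R L" and N: "gcoh R N"
begin

lemma ker_imgE:
  assumes "x \<in> carrier M" "g x = \<zero>\<^bsub>N\<^esub>"
  obtains l where "l \<in> carrier L" "f l = x"
  using assms exact by (metis (mono_tags, lifting) imageE mem_Collect_eq)

lemma gf_zero: "l \<in> carrier L \<Longrightarrow> g (f l) = \<zero>\<^bsub>N\<^esub>"
  using exact by blast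

text \<open>Images of homogeneous generators of \<open>L\<close> are joined with lifts of generators
  of \<open>N\<close>, which can be taken homogeneous of the same degrees by
  \<open>surj_D\<close>.\<close>

lemma ext_hom_fg: "hom_fg R M"
proof -
  obtain n e u where u: "\<forall>i<n. u i \<in> mgrade L (e i)" "carrier L = lspan R L n u"
    using L by (auto simp: gcoh_def hom_fg_def)
  obtain k c v where v: "\<forall>i<k. v i \<in> mgrade N (c i)" "carrier N = lspan R N k v"
    using N by (auto simp: gcoh_def hom_fg_def)
  have "\<forall>i. \<exists>x. i < k \<longrightarrow> x \<in> mgrade M (c i) \<and> g x = v i" using v g.surj_D[OF surj] by blast
  then obtain w where w: "\<And>i. i < k \<Longrightarrow> w i \<in> mgrade M (c i)" "\<And>i. i < k \<Longrightarrow> g (w i) = v i" by metis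
  have uc: "u i \<in> carrier L" if "i < n" for i using u(1) that f.M.gm.D_carrier by blast
  have wc: "w i \<in> carrier M" if "i < k" for i using w(1) that f.N.gm.D_carrier by blast
  let ?u = "\<lambda>i. if i < n then f (u i) else w (i - n)" and ?e = "\<lambda>i. if i < n then e i else c (i - n)"
  have um: "\<forall>i<n+k. ?u i \<in> mgrade M (?e i)" using u(1) w f.map_D by auto
  have ucM: "?u i \<in> carrier M" if "i < n + k" for i using um that f.N.gm.D_carrier by blast
  have "x \<in> lspan R M (n + k) ?u" if x: "x \<in> carrier M" for x
  proof -
    have "g x \<in> lspan R N k v" using x v(2) by auto
    then obtain b where b: "\<forall>i<k. b i \<in> carrier R" "g x = lin N k v b" by (auto simp: lspan_def)
    let ?y = "lin M k w b"
    have y: "?y \<in> carrier M" by (rule f.N.M.lin_closed) (use wc b in auto)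
    have "g ?y = lin N k (\<lambda>i. g (w i)) b" by (rule g.map_lin) (use wc b in auto)
    also have "\<dots> = g x" unfolding b(2) by (rule lin_cong) (use w in auto)
    finally have "g (x \<ominus>\<^bsub>M\<^esub> ?y) = \<zero>\<^bsub>N\<^esub>"
      using x y by (simp add: g.map_diff g.N.M.M.minus_eq_zero_iff)
    then obtain l where l: "l \<in> carrier L" "f l = x \<ominus>\<^bsub>M\<^esub> ?y"
      using ker_imgE[of "x \<ominus>\<^bsub>M\<^esub> ?y"] x y by auto
    have "l \<in> lspan R L n u" using l u(2) by simp
    then have "f l \<in> lspan R M n (\<lambda>i. f (u i))"
      using f.map_lspan[of n u, OF uc] by blast
    moreover have "?y \<in> lspan R M k w" using b by (auto simp: lspan_def)
    ultimately have "f l \<oplus>\<^bsub>M\<^esub> ?y \<in> lspan R M (n + k) ?u"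
      using f.N.M.lspan_append[of n "\<lambda>i. f (u i)" k w] uc wc by auto
    then show ?thesis using l x y by simp
  qed
  moreover have "lspan R M (n + k) ?u \<subseteq> carrier M"
    using f.N.M.lspan_subset[of "n + k" ?u] ucM by blast
  ultimately have "carrier M = lspan R M (n + k) ?u" by blast
  then show ?thesis unfolding hom_fg_def
    by (intro exI[of _ "n + k"] exI[of _ ?e] exI[of _ ?u] conjI um)
qed

text \<open>Two stages. Relations \<open>s\<close> of the images \<open>g (u i)\<close> produce
  elements \<open>w k\<close> of \<open>L\<close>, which measure how far \<open>s k\<close> is from
  a relation of the \<open>u i\<close>. Relations \<open>t\<close> of the \<open>w k\<close> correct
  this, and the rows of \<open>t s\<close> generate the relations of \<open>u\<close>.\<close>

lemma ext_hom_syz_fg: "hom_syz_fg R M"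
  unfolding hom_syz_fg_def
proof (intro allI impI)
  fix n :: nat and e u assume u: "\<forall>i<n. u i \<in> mgrade M (e i)"
  have uc: "u i \<in> carrier M" if "i < n" for i using u(1) that f.N.gm.D_carrier by blast
  have PL: "hom_syz_fg R L" and PN: "hom_syz_fg R N" using L N by (auto simp: gcoh_def)
  have gu: "g (u i) \<in> mgrade N (e i)" if "i < n" for i using u g.map_D that by blast
  obtain m eps s where s: "\<forall>k<m. \<forall>i<n. s k i \<in> rgrade R (eps k - e i)"
    and sgen: "syz_gen R N n (\<lambda>i. g (u i)) m s"
    by (rule g.N.hom_syzE[OF PN gu])
  have sc: "s k i \<in> carrier R" if "k < m" "i < n" for k i using s that f.M.R.gr.D_carrier by blast
  have "\<exists>w. w \<in> mgrade L (eps k) \<and> f w = lin M n u (s k)" if k: "k < m" for k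
  proof -
    have D: "lin M n u (s k) \<in> mgrade M (eps k)" by (rule f.N.lin_D) (use u s k in auto)
    then have c: "lin M n u (s k) \<in> carrier M" by (rule f.N.gm.D_carrier)
    have "g (lin M n u (s k)) = \<zero>\<^bsub>N\<^esub>"
      using g.map_lin[of n u "s k", OF uc] sc syz_gen_zero[OF sgen k] k by simp
    then obtain w where "w \<in> carrier L" "f w = lin M n u (s k)" using c ker_imgE by blast
    then show ?thesis using f.inj_D[OF inj] D by metis
  qed
  then obtain w where w: "\<And>k. k < m \<Longrightarrow> w k \<in> mgrade L (eps k)"
    and fw: "\<And>k. k < m \<Longrightarrow> f (w k) = lin M n u (s k)" by metis
  have wc: "w k \<in> carrier L" if "k < m" for k using w[OF that] f.M.gm.D_carrier by blast
  obtain p \<eta> t where t: "\<forall>l<p. \<forall>k<m. t l k \<in> rgrade R (\<eta> l - eps k)"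
    and tgen: "syz_gen R L m w p t"
    by (rule f.M.hom_syzE[OF PL w])
  have tc: "t l k \<in> carrier R" if "l < p" "k < m" for l k using t that f.M.R.gr.D_carrier by blast
  have lin_w: "lin M n u (comb R m b s) = f (lin L m w b)" if b: "\<forall>k<m. b k \<in> carrier R" for b
  proof -
    have "lin M n u (comb R m b s) = lin M m (\<lambda>k. lin M n u (s k)) b"
      by (rule f.N.M.lin_comb) (use uc sc b in auto)
    also have "\<dots> = lin M m (\<lambda>k. f (w k)) b" by (rule lin_cong) (use fw in auto)
    also have "\<dots> = f (lin L m w b)" by (rule f.map_lin[symmetric]) (use wc b in auto)
    finally show ?thesis .
  qed
  define r where "r l = comb R m (t l) s" for l
  have rD: "r l i \<in> rgrade R (\<eta> l - e i)" if "l < p" "i < n" for l i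
    unfolding r_def by (rule f.M.R.comb_D) (use s t that in auto)
  have "lin M n u (r l) = \<zero>\<^bsub>M\<^esub>" if "l < p" for l
    unfolding r_def using lin_w[of "t l"] syz_gen_zero[OF tgen that] tc that by simp
  moreover have "\<exists>c. (\<forall>l<p. c l \<in> carrier R) \<and> (\<forall>i<n. a i = comb R p c r i)"
    if a: "\<forall>i<n. a i \<in> carrier R" "lin M n u a = \<zero>\<^bsub>M\<^esub>" for a
  proof -
    have "lin N n (\<lambda>i. g (u i)) a = g (lin M n u a)"
      by (rule g.map_lin[symmetric]) (use uc a in auto)
    then have "lin N n (\<lambda>i. g (u i)) a = \<zero>\<^bsub>N\<^esub>" using a by simp
    then obtain b where b: "\<forall>k<m. b k \<in> carrier R" "\<forall>i<n. a i = comb R m b s i"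
      by (rule syz_genE[OF sgen a(1)])
    have "f (lin L m w b) = lin M n u (comb R m b s)" using lin_w b by simp
    also have "\<dots> = lin M n u a" by (rule lin_cong) (use b in auto)
    finally have "f (lin L m w b) = \<zero>\<^bsub>M\<^esub>" using a by simp
    then have "lin L m w b = \<zero>\<^bsub>L\<^esub>"
      by (rule f.inj_zero[OF inj, rotated]) (use wc b in auto)
    then obtain c where c: "\<forall>l<p. c l \<in> carrier R" "\<forall>k<m. b k = comb R p c t k"
      by (rule syz_genE[OF tgen b(1)])
    have "a i = comb R p c r i" if i: "i < n" for i
    proof -
      have "a i = comb R m b s i" using b i by simp
      also have "\<dots> = comb R m (comb R p c t) s i" by (rule comb_cong) (use c in auto)
      also have "\<dots> = comb R p c r i"
        unfolding r_def by (rule f.M.R.comb_assoc) (use c tc sc i in auto)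
      finally show ?thesis .
    qed
    with c show ?thesis by blast
  qed
  ultimately have "syz_gen R M n u p r"
    unfolding syz_gen_def using rD f.M.R.gr.D_carrier by blast
  then show "\<exists>m eps s. (\<forall>k<m. \<forall>i<n. s k i \<in> rgrade R (eps k - e i)) \<and> syz_gen R M n u m s"
    using rD by blast
qed

text \<open>The filtration that \<open>x\<close> induces on its span \<open>V\<close> is compared with the one induced from \<open>M\<close>:
  on the image of \<open>V\<close> in \<open>N\<close> they differ by a bounded shift, and on \<open>V \<inter> L\<close> they agree once a
  basis of \<open>V \<inter> L\<close> has been added to \<open>x\<close>.\<close>

lemma ext_fil_basis:
  assumes x: "\<forall>i<n. x i \<in> carrier M"
  shows "\<exists>m y e. fil_basis R M (lspan R M n x) m y e"
proof -
  let ?V = "lspan R M n x"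
  have PN: "hom_syz_fg R N" using N by (auto simp: gcoh_def)
  have xc: "x i \<in> carrier M" if "i < n" for i using x that by blast
  have V: "submodule ?V R M" by (rule f.N.M.lspan_submodule[OF xc])
  have VM: "?V \<subseteq> carrier M" using f.N.M.lspan_subset[of n x, OF xc] by blast
  have gV: "g ` ?V = lspan R N n (\<lambda>i. g (x i))" by (rule g.map_lspan[OF xc])
  have gx: "\<forall>i<n. g (x i) \<in> carrier N" using xc by auto
  from gcoh_fil_basis[OF N gx] obtain k y d where fb: "fil_basis R N (g ` ?V) k y d"
    unfolding gV by blast
  have VN: "submodule (g ` ?V) R N" unfolding gV by (rule g.N.M.lspan_submodule) (use gx in auto)
  obtain m s where "syz_gen R N k y m s"
    using g.N.syz_gen_fil_basis[OF _ PN VN fb] nonneg by blast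
  then have sc: "\<And>l j. l < m \<Longrightarrow> j < k \<Longrightarrow> s l j \<in> carrier R"
    and s0: "\<And>l. l < m \<Longrightarrow> lin N k y (s l) = \<zero>\<^bsub>N\<^esub>"
    and sgen: "\<And>a. \<forall>j<k. a j \<in> carrier R \<Longrightarrow> lin N k y a = \<zero>\<^bsub>N\<^esub> \<Longrightarrow>
       \<exists>b. (\<forall>l<m. b l \<in> carrier R) \<and> (\<forall>j<k. a j = comb R m b s j)"
    by (auto simp: syz_gen_def)
  have "\<forall>j. \<exists>r. j < k \<longrightarrow> (\<forall>i<n. r i \<in> carrier R) \<and> y j = g (lin M n x r)"
  proof (intro allI)
    fix j
    show "\<exists>r. j < k \<longrightarrow> (\<forall>i<n. r i \<in> carrier R) \<and> y j = g (lin M n x r)"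
    proof (cases "j < k")
      case True
      then have "y j \<in> g ` ?V" using fb by (simp add: fil_basis_def)
      then show ?thesis by (auto simp: lspan_def)
    qed simp
  qed
  then obtain r where rc: "\<And>j i. j < k \<Longrightarrow> i < n \<Longrightarrow> r j i \<in> carrier R"
    and yr: "\<And>j. j < k \<Longrightarrow> y j = g (lin M n x (r j))" by metis
  \<comment> \<open>Lifts of the basis elements to \<open>V\<close>. Their coefficients
    \<open>r j i\<close> come without any bound in terms of \<open>d j - e i\<close>.\<close>
  define z where "z j = lin M n x (r j)" for j
  have zc: "z j \<in> carrier M" if "j < k" for j
    unfolding z_def by (rule f.N.M.lin_closed) (use xc rc that in auto)
  have zV: "z j \<in> ?V" if "j < k" for j using rc that by (auto simp: z_def lspan_def)
  have gz: "g (z j) = y j" if "j < k" for j using yr that by (simp add: z_def)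
  have glin: "g (lin M k z a) = lin N k y a" if a: "\<forall>j<k. a j \<in> carrier R" for a
  proof -
    have "g (lin M k z a) = lin N k (\<lambda>j. g (z j)) a" by (rule g.map_lin) (use zc a in auto)
    also have "\<dots> = lin N k y a" by (rule lin_cong) (use gz in auto)
    finally show ?thesis .
  qed
  have "\<exists>q. (\<forall>j<k. q j \<in> carrier R) \<and> g (x i) = lin N k y q" if i: "i < n" for i
  proof -
    obtain D where D: "g (x i) \<in> fil N (mgrade N) D" using gx i g.N.gm.F_exists by blast
    have "g (x i) \<in> g ` ?V" using f.N.M.lspan_gen[of n x i, OF xc i] by blast
    with D fb have "g (x i) \<in> filspan R N k y d D" by (auto simp: fil_basis_def)
    then obtain a where a: "\<forall>j<k. a j \<in> fil R (rgrade R) (D - d j)" "g (x i) = lin N k y a"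
      by (auto simp: filspan_def)
    then have "\<forall>j<k. a j \<in> carrier R" using f.M.R.gr.F_closed by blast
    with a(2) show ?thesis by blast
  qed
  then obtain q where qc: "\<And>i j. i < n \<Longrightarrow> j < k \<Longrightarrow> q i j \<in> carrier R"
    and gq: "\<And>i. i < n \<Longrightarrow> g (x i) = lin N k y (q i)" by metis
  \<comment> \<open>A relation \<open>s l\<close> of the \<open>y j\<close>, evaluated at the lifts
    \<open>z j\<close>, falls into \<open>L\<close>: the first kind of generators of
    \<open>V \<inter> L\<close>.\<close>
  have "\<exists>p. p \<in> carrier L \<and> f p = lin M k z (s l)" if l: "l < m" for l
  proof -
    have "lin M k z (s l) \<in> carrier M" by (rule f.N.M.lin_closed) (use zc sc l in auto)
    moreover have "g (lin M k z (s l)) = \<zero>\<^bsub>N\<^esub>" using glin s0 sc l by simp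
    ultimately show ?thesis by (rule ker_imgE) blast
  qed
  then obtain p where pc: "\<And>l. l < m \<Longrightarrow> p l \<in> carrier L"
    and fp: "\<And>l. l < m \<Longrightarrow> f (p l) = lin M k z (s l)" by metis
  have lzq: "lin M k z (q i) \<in> carrier M" if "i < n" for i
    by (rule f.N.M.lin_closed) (use zc qc that in auto)
  \<comment> \<open>The second kind: the error made when \<open>x i\<close> is replaced by its
    expression \<open>q i\<close> in the lifts \<open>z j\<close>.\<close>
  have "\<exists>p. p \<in> carrier L \<and> f p = x i \<ominus>\<^bsub>M\<^esub> lin M k z (q i)" if i: "i < n" for i
  proof -
    have "x i \<ominus>\<^bsub>M\<^esub> lin M k z (q i) \<in> carrier M" using xc lzq i by simp
    moreover have "g (x i \<ominus>\<^bsub>M\<^esub> lin M k z (q i)) = \<zero>\<^bsub>N\<^esub>"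
      using xc[OF i] lzq[OF i] glin[of "q i"] gq[OF i] qc[OF i] gx[rule_format, OF i]
      by (simp add: g.map_diff g.N.M.M.minus_eq_zero_iff)
    ultimately show ?thesis by (rule ker_imgE) blast
  qed
  then obtain p' where p'c: "\<And>i. i < n \<Longrightarrow> p' i \<in> carrier L"
    and fp': "\<And>i. i < n \<Longrightarrow> f (p' i) = x i \<ominus>\<^bsub>M\<^esub> lin M k z (q i)" by metis
  let ?p = "\<lambda>i. if i < n then p' i else p (i - n)"
  have ppc: "\<forall>i<n+m. ?p i \<in> carrier L" using pc p'c by auto
  \<comment> \<open>Write a x = a (x - q z) + (a q) z. The first summand is a combination of the
    errors \<open>p'\<close>. For an element of \<open>L\<close> the coefficients \<open>a q\<close>
    form a relation of \<open>y\<close>, so they are a combination of the rows of \<open>s\<close>,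
    and the second summand is a combination of the \<open>p\<close>.\<close>
  have inW: "l \<in> lspan R L (n + m) ?p" if l: "l \<in> carrier L" "f l \<in> ?V" for l
  proof -
    obtain a where a: "\<forall>i<n. a i \<in> carrier R" "f l = lin M n x a"
      using l by (auto simp: lspan_def)
    let ?b = "comb R n a q"
    have bc: "?b j \<in> carrier R" if "j < k" for j by (rule f.M.R.comb_closed) (use a qc that in auto)
    have fpa: "f (lin L n p' a) = f l \<ominus>\<^bsub>M\<^esub> lin M k z ?b"
    proof -
      have "f (lin L n p' a) = lin M n (\<lambda>i. f (p' i)) a" by (rule f.map_lin) (use p'c a in auto)
      also have "\<dots> = lin M n (\<lambda>i. x i \<ominus>\<^bsub>M\<^esub> lin M k z (q i)) a" by (rule lin_cong) (use fp' in auto)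
      also have "\<dots> = sumn M n (\<lambda>i. a i \<odot>\<^bsub>M\<^esub> x i \<oplus>\<^bsub>M\<^esub> \<ominus>\<^bsub>M\<^esub> (a i \<odot>\<^bsub>M\<^esub> lin M k z (q i)))"
        unfolding lin_def[of M n] by (rule sumn_cong)
          (use a xc lzq in \<open>simp add: a_minus_def f.N.M.smult_r_distr f.N.M.smult_r_minus\<close>)
      also have "\<dots> = lin M n x a \<ominus>\<^bsub>M\<^esub> lin M n (\<lambda>i. lin M k z (q i)) a"
        unfolding lin_def[of M n] a_minus_def using a xc lzq
        by (subst f.N.M.M.sumn_add) (auto simp: f.N.M.M.sumn_minus)
      also have "lin M n (\<lambda>i. lin M k z (q i)) a = lin M k z ?b"
        by (rule f.N.M.lin_comb[symmetric]) (use a zc qc in auto)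
      finally show ?thesis using a by simp
    qed
    have lzb: "lin M k z ?b \<in> carrier M" by (rule f.N.M.lin_closed) (use zc bc in auto)
    have lpa: "lin L n p' a \<in> carrier L" by (rule f.M.M.lin_closed) (use p'c a in auto)
    have "lin N k y ?b = g (lin M k z ?b)" using glin bc by simp
    also have "lin M k z ?b = f (l \<ominus>\<^bsub>L\<^esub> lin L n p' a)"
    proof -
      have "lin M k z ?b = f l \<ominus>\<^bsub>M\<^esub> (f l \<ominus>\<^bsub>M\<^esub> lin M k z ?b)"
        using l(1) lzb f.map_closed[OF l(1)]
        by (simp add: a_minus_def f.N.M.M.minus_add f.N.M.M.a_assoc[symmetric] f.N.M.M.r_neg)
      then show ?thesis using fpa f.map_diff[OF l(1) lpa] by simp
    qed
    also have "g \<dots> = \<zero>\<^bsub>N\<^esub>" using gf_zero l lpa by simp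
    finally obtain c where c: "\<forall>l<m. c l \<in> carrier R" "\<forall>j<k. ?b j = comb R m c s j"
      using sgen[of ?b] bc by blast
    have "lin M k z ?b = lin M k z (comb R m c s)" by (rule lin_cong) (use c in auto)
    also have "\<dots> = lin M m (\<lambda>l. lin M k z (s l)) c" by (rule f.N.M.lin_comb) (use c zc sc in auto)
    also have "\<dots> = lin M m (\<lambda>l. f (p l)) c" by (rule lin_cong) (use fp in auto)
    also have "\<dots> = f (lin L m p c)" by (rule f.map_lin[symmetric]) (use pc c in auto)
    finally have "lin M k z ?b = f (lin L m p c)" .
    moreover have lpc: "lin L m p c \<in> carrier L" by (rule f.M.M.lin_closed) (use pc c in auto)
    moreover have "f l = f (lin L n p' a) \<oplus>\<^bsub>M\<^esub> lin M k z ?b"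
      unfolding fpa using l lzb by simp
    ultimately have "f l = f (lin L n p' a \<oplus>\<^bsub>L\<^esub> lin L m p c)" using lpa by (simp add: f.map_add)
    then have "l = lin L n p' a \<oplus>\<^bsub>L\<^esub> lin L m p c"
      using inj l lpa lpc by (meson f.M.M.M.a_closed inj_onD)
    moreover have "lin L n p' a \<in> lspan R L n p'" "lin L m p c \<in> lspan R L m p"
      using a c by (auto simp: lspan_def)
    ultimately show ?thesis using f.M.M.lspan_append[of n p' m p] p'c pc by blast
  qed
  from gcoh_fil_basis[OF L ppc] obtain h w c where fbL: "fil_basis R L (lspan R L (n + m) ?p) h w c"
    by blast
  have wc: "w j \<in> carrier L" if "j < h" for j
    using fbL that f.M.gm.F_closed by (auto simp: fil_basis_def)
  have WV: "f l \<in> ?V" if l: "l \<in> lspan R L (n + m) ?p" for l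
  proof -
    have "f l \<in> lspan R M (n + m) (\<lambda>i. f (?p i))"
      using f.map_lspan[of "n + m" ?p] ppc l by blast
    moreover have "f (?p i) \<in> ?V" if "i < n + m" for i
    proof (cases "i < n")
      case True
      have "x i \<ominus>\<^bsub>M\<^esub> lin M k z (q i) \<in> ?V" unfolding a_minus_def
        using f.N.M.submoduleE(3,5)[OF V] f.N.M.lspan_gen[of n x i, OF xc True]
          f.N.M.submodule_lin[OF V, of k z "q i"] zV qc True by auto
      then show ?thesis using True fp' by simp
    next
      case False
      then show ?thesis
        using f.N.M.submodule_lin[OF V, of k z "s (i - n)"] zV sc fp that by auto
    qed
    ultimately show ?thesis using f.N.M.lspan_least[of ?V "n + m" "\<lambda>i. f (?p i)", OF V] by blast
  qed
  have "\<forall>i. \<exists>e. i < n \<longrightarrow> x i \<in> fil M (mgrade M) e" using xc f.N.gm.F_exists by blast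
  then obtain e where e: "\<And>i. i < n \<Longrightarrow> x i \<in> fil M (mgrade M) (e i)" by metis
  \<comment> \<open>The cost in degree of replacing each \<open>y j\<close> by its lift written in
    the \<open>x i\<close>.\<close>
  obtain l where l: "\<And>j i. j < k \<Longrightarrow> i < n \<Longrightarrow> r j i \<in> fil R (rgrade R) (d j - e i + int l)"
    using f.M.R.common_shift[of k n r d e] rc by blast
  let ?X = "\<lambda>i. if i < n then x i else f (w (i - n))"
  let ?E = "\<lambda>i. if i < n then e i else c (i - n)"
  show ?thesis
  proof (rule f.N.fil_basis_of_shift[of "?V" "n + h" ?X ?E l])
    show "hom_syz_fg R M" by (rule ext_hom_syz_fg)
    show "submodule ?V R M" by (rule V)
    show "?X i \<in> fil M (mgrade M) (?E i)" if "i < n + h" for i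
      using that e fbL f.map_fil by (auto simp: fil_basis_def)
    show "?X i \<in> ?V" if "i < n + h" for i
      using that f.N.M.lspan_gen[of n x i, OF xc] WV fbL by (auto simp: fil_basis_def)
    show "?V \<inter> fil M (mgrade M) D \<subseteq> filspan R M (n + h) ?X ?E (D + int l)" for D
    proof
      fix v assume v: "v \<in> ?V \<inter> fil M (mgrade M) D"
      then have "g v \<in> g ` ?V \<inter> fil N (mgrade N) D" using g.map_fil by blast
      then have "g v \<in> filspan R N k y d D" using fb unfolding fil_basis_def by blast
      then obtain a where a: "\<forall>j<k. a j \<in> fil R (rgrade R) (D - d j)" "g v = lin N k y a"
        by (auto simp: filspan_def)
      have ac: "\<forall>j<k. a j \<in> carrier R" using a(1) f.M.R.gr.F_closed by blast
      \<comment> \<open>The expression of \<open>g v\<close> in the basis, transferred to the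
        \<open>x i\<close>. By the choice of \<open>l\<close> its coefficients are bounded at level
        \<open>D + l\<close> instead of \<open>D\<close>.\<close>
      let ?b = "comb R k a r"
      have bF: "?b i \<in> fil R (rgrade R) (D + int l - e i)" if i: "i < n" for i
      proof (rule f.M.R.comb_F)
        show "a j \<in> fil R (rgrade R) ((D + int l) - (d j + int l))" if "j < k" for j
          using a(1) that by simp
        show "r j i \<in> fil R (rgrade R) ((d j + int l) - e i)" if "j < k" for j
          using l[OF that i] by (simp add: algebra_simps)
      qed
      have bc: "?b i \<in> carrier R" if "i < n" for i using bF[OF that] f.M.R.gr.F_closed by blast
      have vc: "v \<in> carrier M" using v VM by blast
      have lc: "lin M n x ?b \<in> carrier M" by (rule f.N.M.lin_closed) (use xc bc in auto)
      have "lin M n x ?b = lin M k z a"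
        unfolding z_def by (rule f.N.M.lin_comb) (use xc ac rc in auto)
      then have "g (v \<ominus>\<^bsub>M\<^esub> lin M n x ?b) = \<zero>\<^bsub>N\<^esub>"
        using vc lc glin[OF ac] a(2) g.map_closed[OF vc] by (simp add: g.map_diff g.N.M.M.minus_eq_zero_iff)
      \<comment> \<open>The error lies in \<open>V \<inter> L\<close> and has degree at most
        \<open>D + l\<close>; the basis \<open>w\<close> expresses it at this very level, so no
        further shift arises.\<close>
      then obtain t where t: "t \<in> carrier L" "f t = v \<ominus>\<^bsub>M\<^esub> lin M n x ?b"
        using ker_imgE[of "v \<ominus>\<^bsub>M\<^esub> lin M n x ?b"] vc lc by auto
      have "lin M n x ?b \<in> fil M (mgrade M) (D + int l)"
        by (rule f.N.lin_F[OF e bF])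
      moreover have "v \<in> fil M (mgrade M) (D + int l)"
        using v f.N.gm.F_mono[of v D "D + int l"] by auto
      ultimately have "f t \<in> fil M (mgrade M) (D + int l)" using t by auto
      then have tF: "t \<in> fil L (mgrade L) (D + int l)" by (rule f.inj_fil[OF inj t(1)])
      have "lin M n x ?b \<in> ?V" using bc by (auto simp: lspan_def)
      then have "f t \<in> ?V" unfolding t(2) a_minus_def
        using f.N.M.submoduleE(3,5)[OF V] v by auto
      then have "t \<in> filspan R L h w c (D + int l)"
        using inW t(1) tF fbL by (auto simp: fil_basis_def)
      then obtain b' where b': "\<forall>j<h. b' j \<in> fil R (rgrade R) (D + int l - c j)" "t = lin L h w b'"
        by (auto simp: filspan_def)
      have b'c: "b' j \<in> carrier R" if "j < h" for j using b'(1) that f.M.R.gr.F_closed by blast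
      let ?B = "\<lambda>i. if i < n then ?b i else b' (i - n)"
      have "f t = lin M h (\<lambda>j. f (w j)) b'" unfolding b'(2)
        by (rule f.map_lin) (use wc b'c in auto)
      moreover have "v = lin M n x ?b \<oplus>\<^bsub>M\<^esub> f t"
        unfolding t(2)
        using vc lc f.N.M.M.a_comm[of "lin M n x ?b" "v \<ominus>\<^bsub>M\<^esub> lin M n x ?b"] by simp
      moreover have "lin M (n + h) ?X ?B = lin M n x ?b \<oplus>\<^bsub>M\<^esub> lin M h (\<lambda>j. f (w j)) b'"
        by (rule f.N.M.lin_append_if) (use xc wc bc b'c in auto)
      ultimately have "v = lin M (n + h) ?X ?B" by simp
      moreover have "\<forall>i<n+h. ?B i \<in> fil R (rgrade R) (D + int l - ?E i)"
        using bF b' by auto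
      ultimately show "v \<in> filspan R M (n + h) ?X ?E (D + int l)"
        unfolding filspan_def by blast
    qed
  qed
qed

lemma gcoh_ext: "gcoh R M"
  using ext_hom_fg ext_hom_syz_fg ext_fil_basis f.N.graded_module_axioms
  by (auto simp: gcoh_def)

end

section \<open>Graded submodules, quotients and direct sums\<close>

text \<open>The module axioms see only these fields, so a change of \<open>mgrade\<close> may
  accompany a change of carrier.\<close>

lemma module_cong:
  assumes "module R M" "carrier M' = carrier M" "add M' = add M" "ring.zero M' = ring.zero M"
    "smult M' = smult M"
  shows "module R M'"
proof -
  interpret module R M by fact
  show ?thesis
  proof (rule moduleI)
    show "abelian_group M'"
    proof (rule abelian_groupI)
      show "\<exists>y\<in>carrier M'. y \<oplus>\<^bsub>M'\<^esub> x = \<zero>\<^bsub>M'\<^esub>" if "x \<in> carrier M'" for x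
        using that assms by (auto intro!: bexI[of _ "\<ominus>\<^bsub>M\<^esub> x"] simp: M.l_neg)
    qed (use assms in \<open>auto simp: M.a_ac\<close>)
  qed (use assms in \<open>auto simp: smult_l_distr smult_r_distr smult_assoc1 R.is_cring\<close>)
qed

text \<open>\<open>sumn\<close> never consults the carrier, as \<open>finsum\<close> does.
  Combinations formed in a submodule are therefore literally those formed in the ambient
  module.\<close>

lemma sumn_eq: "\<lbrakk>add G = add H; ring.zero G = ring.zero H\<rbrakk> \<Longrightarrow> sumn G n f = sumn H n f"
  by (induction n) auto

lemma lin_eq: "\<lbrakk>add M = add N; ring.zero M = ring.zero N; smult M = smult N\<rbrakk> \<Longrightarrow> lin M n u a = lin N n u a"
  unfolding lin_def by (subst sumn_eq[of M N]) simp_all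

lemma lspan_eq:
  "\<lbrakk>add M = add N; ring.zero M = ring.zero N; smult M = smult N\<rbrakk> \<Longrightarrow> lspan R M n u = lspan R N n u"
  unfolding lspan_def using lin_eq[of M N n u] by auto

lemma finite_enum: "finite S \<Longrightarrow> \<exists>n u. S = u ` {..<n::nat}"
  by (metis finite_imp_nat_seg_image_inj_on lessThan_def)

context module begin

lemma submodule_span_lspan:
  assumes "\<And>i. i < n \<Longrightarrow> u i \<in> carrier M"
  shows "submodule_span R M (u ` {..<n}) = lspan R M n u"
proof
  show "submodule_span R M (u ` {..<n}) \<subseteq> lspan R M n u"
    unfolding submodule_span_def
    by (rule hull_minimal) (use lspan_gen[of n u] lspan_submodule[of n u] assms in auto)
  show "lspan R M n u \<subseteq> submodule_span R M (u ` {..<n})"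
    unfolding submodule_span_def hull_def
    by (rule Inter_greatest, rule lspan_least) auto
qed

lemma finitely_generated_iff:
  "finitely_generated R M \<longleftrightarrow> (\<exists>n u. (\<forall>i<n. u i \<in> carrier M) \<and> carrier M = lspan R M n u)"
proof
  assume "finitely_generated R M"
  then obtain S where S: "finite S" "S \<subseteq> carrier M" "submodule_span R M S = carrier M"
    by (auto simp: finitely_generated_def)
  from finite_enum[OF S(1)] obtain n u where u: "S = u ` {..<n::nat}" by (elim exE)
  then have "u i \<in> carrier M" if "i < n" for i using S(2) that by auto
  moreover have "carrier M = lspan R M n u"
    using submodule_span_lspan[of n u] calculation S u by auto
  ultimately show "\<exists>n u. (\<forall>i<n. u i \<in> carrier M) \<and> carrier M = lspan R M n u" by blast
next
  assume "\<exists>n u. (\<forall>i<n. u i \<in> carrier M) \<and> carrier M = lspan R M n u"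
  then obtain n u where u: "\<forall>i<n. u i \<in> carrier M" "carrier M = lspan R M n u" by blast
  then have "submodule_span R M (u ` {..<n}) = carrier M" using submodule_span_lspan[of n u] by auto
  then show "finitely_generated R M" unfolding finitely_generated_def
    by (intro exI[of _ "u ` {..<n}"]) (use u in auto)
qed

lemma finitely_generated_sub_iff:
  assumes "submodule V R M"
  shows "finitely_generated R (M\<lparr>carrier := V\<rparr>) \<longleftrightarrow> (\<exists>n u. (\<forall>i<n. u i \<in> V) \<and> V = lspan R M n u)"
proof -
  interpret V: module R "M\<lparr>carrier := V\<rparr>"
    by (rule submodule.submodule_is_module[OF assms module_axioms])
  have "lspan R (M\<lparr>carrier := V\<rparr>) n u = lspan R M n u" for n u by (rule lspan_eq) auto
  then show ?thesis using V.finitely_generated_iff by simp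
qed

end

text \<open>The nonzero components of the given generators work: there are finitely many, they lie
  in \<open>V\<close> by homogeneity, and each generator is a sum of them.\<close>

lemma (in graded_module) homogeneous_generators:
  assumes u: "\<And>i. i < n \<Longrightarrow> u i \<in> carrier M" and V: "V = lspan R M n u"
    and hom: "\<And>x d. x \<in> V \<Longrightarrow> gm.part x d \<in> V"
  shows "\<exists>m e v. (\<forall>i<m. v i \<in> mgrade M (e i)) \<and> V = lspan R M m v"
proof -
  have subV: "submodule V R M" unfolding V by (rule lspan_submodule[OF u])
  have uV: "u i \<in> V" if "i < n" for i unfolding V by (rule lspan_gen) (use u that in auto)
  define S where "S = (\<Union>i<n. gm.part (u i) ` {d. gm.part (u i) d \<noteq> \<zero>\<^bsub>M\<^esub>})"
  have "finite S" unfolding S_def using gm.gcomp_finite u by blast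
  from finite_enum[OF this] obtain m v where v: "S = v ` {..<m::nat}" by (elim exE)
  have vS: "v i \<in> S" if "i < m" for i using v that by auto
  have "\<exists>d. x \<in> mgrade M d" if x: "x \<in> S" for x
  proof -
    obtain i d where "i < n" "x = gm.part (u i) d" using x unfolding S_def by blast
    then show ?thesis using gm.gcomp_D[OF u] by blast
  qed
  then have "\<forall>i. \<exists>d. i < m \<longrightarrow> v i \<in> mgrade M d" using vS by blast
  then obtain e where e: "\<And>i. i < m \<Longrightarrow> v i \<in> mgrade M (e i)" by metis
  have vc: "v i \<in> carrier M" if "i < m" for i using e[OF that] by blast
  have "S \<subseteq> V" unfolding S_def using hom uV by auto
  then have "lspan R M m v \<subseteq> V" using lspan_least[of V m v, OF subV] vS by blast
  moreover have "V \<subseteq> lspan R M m v"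
  proof -
    let ?W = "lspan R M m v"
    have W: "submodule ?W R M" by (rule lspan_submodule[OF vc])
    have "u i \<in> ?W" if i: "i < n" for i
    proof (rule gm.gcomp_in_imp_mem)
      show "gm.part (u i) d \<in> ?W" for d
      proof (cases "gm.part (u i) d = \<zero>\<^bsub>M\<^esub>")
        case False
        then have "gm.part (u i) d \<in> S" unfolding S_def using i by auto
        then show ?thesis using v lspan_gen[of m v] vc by auto
      qed (simp add: lspan_zero vc)
    qed (use u i submoduleE[OF W] lspan_zero[of m v] vc in auto)
    then show ?thesis unfolding V using lspan_least[of ?W n u, OF W] by blast
  qed
  ultimately show ?thesis using e by blast
qed

section \<open>Graded structures on submodules, quotients and direct sums\<close>

lemma graded_moduleI:
  assumes "graded_ring R" "module R M" "grading M (mgrade M)"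
    "\<And>a x i j. \<lbrakk>a \<in> rgrade R i; x \<in> mgrade M j\<rbrakk> \<Longrightarrow> a \<odot>\<^bsub>M\<^esub> x \<in> mgrade M (i + j)"
    "\<forall>n<lo. mgrade M n = {\<zero>\<^bsub>M\<^esub>}"
  shows "graded_module R M"
  using assms by (auto simp: graded_module_def graded_module_axioms_def)

lemma graded_module_submodule:
  assumes M: "graded_module R M" and V: "submodule V R M"
    and hom: "\<And>x d. x \<in> V \<Longrightarrow> gcomp M (mgrade M) x d \<in> V"
  shows "graded_module R (M\<lparr>carrier := V, mgrade := \<lambda>n. mgrade M n \<inter> V\<rparr>)" (is "graded_module R ?K")
proof -
  interpret M: graded_module R M by fact
  have VM: "V \<subseteq> carrier M" using M.M.submoduleE(1)[OF V] .
  have z: "\<zero>\<^bsub>M\<^esub> \<in> V" using subgroup.one_closed[OF submodule.axioms(1)[OF V]] by simp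
  have K: "module R ?K"
    by (rule module_cong[OF submodule.submodule_is_module[OF V M.M.module_axioms]]) auto
  interpret K: module R ?K by fact
  interpret i: add_map ?K M "\<lambda>x. x" by unfold_locales (use VM in auto)
  have "grading ?K (mgrade ?K)"
    by (rule i.grading_inj[where D = "mgrade M"])
      (use hom M.gm.graded_group_axioms in \<open>auto simp: inj_on_def\<close>)
  moreover obtain n0 where "\<forall>n<n0. mgrade M n = {\<zero>\<^bsub>M\<^esub>}" using M.bounded_below by blast
  ultimately show ?thesis using M.smult_grade submodule.smult_closed[OF V] M.R.gr.D_carrier z
    by (intro graded_moduleI[where lo = n0, OF M.R.graded_ring_axioms K]) auto
qed

text \<open>All operations are computed on representatives through the projection. The grading then
  comes from \<open>grading_surj\<close>, whose condition on the kernel is the homogeneity of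
  \<open>I\<close>.\<close>

lemma quotient_graded_module:
  fixes M :: "('a, 'b) graded_module"
  assumes M: "graded_module R M" and I: "submodule I R M"
    and hom: "\<And>x d. x \<in> I \<Longrightarrow> gcomp M (mgrade M) x d \<in> I"
  shows "graded_module R (quotient_module M I)" (is ?graded)
    and "(\<lambda>x. I +>\<^bsub>M\<^esub> x) \<in> graded_hom R M (quotient_module M I)" (is ?hom)
    and "(\<lambda>x. I +>\<^bsub>M\<^esub> x) ` carrier M = carrier (quotient_module M I)" (is ?surj)
    and "x \<in> carrier M \<Longrightarrow> I +>\<^bsub>M\<^esub> x = \<zero>\<^bsub>quotient_module M I\<^esub> \<longleftrightarrow> x \<in> I"
proof -
  interpret M: graded_module R M by fact
  let ?Q = "quotient_module M I" and ?\<pi> = "\<lambda>x. I +>\<^bsub>M\<^esub> x"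
  interpret S: abelian_subgroup I M
    by (rule abelian_subgroupI3)
      (use submodule.axioms(1)[OF I] in \<open>auto simp: additive_subgroup_def M.M.M.abelian_group_axioms\<close>)
  have eq: "?\<pi> x = ?\<pi> y \<longleftrightarrow> x \<ominus>\<^bsub>M\<^esub> y \<in> I" if "x \<in> carrier M" "y \<in> carrier M" for x y
    using that S.a_rcos_module[of y x] S.a_repr_independence'[of x y] S.a_rcos_self[of x]
    by (auto simp: a_minus_def)
  have zero: "\<zero>\<^bsub>?Q\<^esub> = ?\<pi> \<zero>\<^bsub>M\<^esub>"
    using M.M.M.a_coset_add_zero[OF S.a_subset] by (simp add: quotient_module_def)
  have carr: "carrier ?Q = ?\<pi> ` carrier M"
    by (auto simp: quotient_module_def A_RCOSETS_def')
  have add: "?\<pi> x \<oplus>\<^bsub>?Q\<^esub> ?\<pi> y = ?\<pi> (x \<oplus>\<^bsub>M\<^esub> y)" if "x \<in> carrier M" "y \<in> carrier M" for x y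
    using S.a_rcos_sum[OF that] by (simp add: quotient_module_def)
  \<comment> \<open>The union in the definition runs over equal cosets: \<open>y - x\<close> in
    \<open>I\<close> gives \<open>a (y - x)\<close> in \<open>I\<close>.\<close>
  have smult: "a \<odot>\<^bsub>?Q\<^esub> ?\<pi> x = ?\<pi> (a \<odot>\<^bsub>M\<^esub> x)" if a: "a \<in> carrier R" and x: "x \<in> carrier M" for a x
  proof -
    have "?\<pi> (a \<odot>\<^bsub>M\<^esub> y) = ?\<pi> (a \<odot>\<^bsub>M\<^esub> x)" if y: "y \<in> ?\<pi> x" for y
    proof -
      have yc: "y \<in> carrier M" using S.a_elemrcos_carrier[OF x y] .
      have "y \<ominus>\<^bsub>M\<^esub> x \<in> I" using S.a_rcos_module[OF x yc] y by (simp add: a_minus_def)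
      then have "a \<odot>\<^bsub>M\<^esub> (y \<ominus>\<^bsub>M\<^esub> x) \<in> I" using submodule.smult_closed[OF I a] by blast
      then show ?thesis using a x yc
        by (subst eq) (auto simp: a_minus_def M.M.smult_r_distr M.M.smult_r_minus)
    qed
    moreover have "x \<in> ?\<pi> x" using S.a_rcos_self[OF x] .
    ultimately have "(\<Union>y\<in>?\<pi> x. ?\<pi> (a \<odot>\<^bsub>M\<^esub> y)) = ?\<pi> (a \<odot>\<^bsub>M\<^esub> x)" by blast
    then show ?thesis by (simp add: quotient_module_def)
  qed
  have mod: "module R ?Q"
  proof (rule moduleI)
    show "cring R" by (rule M.R.is_cring)
    show "abelian_group ?Q"
    proof (rule abelian_groupI)
      show "\<exists>y\<in>carrier ?Q. y \<oplus>\<^bsub>?Q\<^esub> x = \<zero>\<^bsub>?Q\<^esub>" if "x \<in> carrier ?Q" for x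
      proof -
        obtain y where "y \<in> carrier M" "x = ?\<pi> y" using \<open>x \<in> carrier ?Q\<close> carr by auto
        then show ?thesis
          by (intro bexI[of _ "?\<pi> (\<ominus>\<^bsub>M\<^esub> y)"]) (auto simp: carr add zero M.M.M.l_neg)
      qed
    qed (auto simp: carr add zero M.M.M.a_ac)
  qed (auto simp: carr add smult M.M.smult_l_distr M.M.smult_r_distr M.M.smult_assoc1)
  interpret Q: module R ?Q by fact
  interpret p: add_map M ?Q ?\<pi>
    by unfold_locales (auto simp: carr add)
  have ker: "?\<pi> x = \<zero>\<^bsub>?Q\<^esub> \<longleftrightarrow> x \<in> I" if "x \<in> carrier M" for x
    unfolding zero using eq[OF that, of "\<zero>\<^bsub>M\<^esub>"] that by (simp add: a_minus_def)
  have grade: "mgrade ?Q n = ?\<pi> ` mgrade M n" for n by (simp add: quotient_module_def)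
  have "grading ?Q (mgrade ?Q)"
    by (rule p.grading_surj[OF M.gm.graded_group_axioms])
      (use hom ker in \<open>auto simp: carr grade S.a_Hcarr\<close>)
  moreover obtain n0 where n0: "\<forall>n<n0. mgrade M n = {\<zero>\<^bsub>M\<^esub>}" using M.bounded_below by blast
  moreover have sg: "a \<odot>\<^bsub>?Q\<^esub> x \<in> mgrade ?Q (i + j)"
    if a: "a \<in> rgrade R i" and x: "x \<in> mgrade ?Q j" for a x i j
  proof -
    obtain y where y: "y \<in> mgrade M j" "x = ?\<pi> y" using x by (auto simp: grade)
    have "a \<odot>\<^bsub>?Q\<^esub> x = ?\<pi> (a \<odot>\<^bsub>M\<^esub> y)"
      unfolding y(2) by (rule smult[OF M.R.gr.D_carrier[OF a] M.gm.D_carrier[OF y(1)]])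
    then show ?thesis using M.smult_grade[OF a y(1)] by (auto simp: grade)
  qed
  moreover have "\<forall>n<n0. mgrade ?Q n = {\<zero>\<^bsub>?Q\<^esub>}" using n0 unfolding grade zero by simp
  ultimately show ?graded
    by (intro graded_moduleI[where lo = n0, OF M.R.graded_ring_axioms mod])
  show ?hom by (auto simp: graded_hom_def mod_hom_def carr add smult grade)
  show ?surj by (simp add: carr)
  show "x \<in> carrier M \<Longrightarrow> ?\<pi> x = \<zero>\<^bsub>?Q\<^esub> \<longleftrightarrow> x \<in> I" by (rule ker)
qed

text \<open>Components are taken coordinatewise. Finiteness of \<open>I\<close> makes their joint
  support finite and supplies a common lower bound for the degrees.\<close>

lemma direct_sum_graded_module:
  fixes M :: "'i \<Rightarrow> ('a, 'b) graded_module"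
  assumes R: "graded_ring R" and fin: "finite I" and M: "\<And>i. i \<in> I \<Longrightarrow> graded_module R (M i)"
  shows "graded_module R (direct_sum_module I M)"
proof -
  interpret R: graded_ring R by fact
  let ?S = "direct_sum_module I M"
  have carr: "carrier ?S = (\<Pi>\<^sub>E i\<in>I. carrier (M i))"
    and zero: "\<zero>\<^bsub>?S\<^esub> = (\<lambda>i\<in>I. \<zero>\<^bsub>M i\<^esub>)"
    and add: "x \<oplus>\<^bsub>?S\<^esub> y = (\<lambda>i\<in>I. x i \<oplus>\<^bsub>M i\<^esub> y i)"
    and smult: "a \<odot>\<^bsub>?S\<^esub> x = (\<lambda>i\<in>I. a \<odot>\<^bsub>M i\<^esub> x i)"
    and grade: "mgrade ?S n = (\<Pi>\<^sub>E i\<in>I. mgrade (M i) n)" for x y a n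
    by (auto simp: direct_sum_module_def)
  have mm: "module R (M i)" if "i \<in> I" for i using M[OF that] by (auto simp: graded_module_def)
  have gg: "graded_group (M i) (mgrade (M i))" if "i \<in> I" for i
  proof -
    interpret graded_module R "M i" by (rule M[OF that])
    show ?thesis by (rule gm.graded_group_axioms)
  qed
  have ag: "abelian_group (M i)" if "i \<in> I" for i using mm[OF that] by (auto simp: module_def)
  have am: "abelian_monoid (M i)" if "i \<in> I" for i using ag[OF that] by (auto simp: abelian_group_def)
  have D_c: "x \<in> carrier (M i)" if "i \<in> I" "x \<in> mgrade (M i) n" for i x n
    using graded_group.D_carrier[OF gg] that by blast
  have cm: "x i \<in> carrier (M i)" if "x \<in> carrier ?S" "i \<in> I" for x i using that by (auto simp: carr)
  have mod: "module R ?S"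
  proof (rule moduleI)
    show "cring R" by (rule R.is_cring)
    show "abelian_group ?S"
    proof (rule abelian_groupI)
      show "\<exists>y\<in>carrier ?S. y \<oplus>\<^bsub>?S\<^esub> x = \<zero>\<^bsub>?S\<^esub>" if x: "x \<in> carrier ?S" for x
      proof
        show "(\<lambda>i\<in>I. \<ominus>\<^bsub>M i\<^esub> x i) \<in> carrier ?S"
          using x abelian_group.a_inv_closed[OF ag] by (auto simp: carr PiE_mem)
        show "(\<lambda>i\<in>I. \<ominus>\<^bsub>M i\<^esub> x i) \<oplus>\<^bsub>?S\<^esub> x = \<zero>\<^bsub>?S\<^esub>"
          unfolding add zero
          by (rule restrict_ext) (use x in \<open>auto simp: carr intro!: abelian_group.l_neg[OF ag]\<close>)
      qed
      show "\<zero>\<^bsub>?S\<^esub> \<oplus>\<^bsub>?S\<^esub> x = x" if x: "x \<in> carrier ?S" for x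
        unfolding add zero
        by (rule PiE_ext[of _ I "\<lambda>i. carrier (M i)"])
          (use x cm[OF x] in \<open>auto simp: carr abelian_monoid.l_zero[OF am]\<close>)
      show "x \<oplus>\<^bsub>?S\<^esub> y \<oplus>\<^bsub>?S\<^esub> z = x \<oplus>\<^bsub>?S\<^esub> (y \<oplus>\<^bsub>?S\<^esub> z)"
        if "x \<in> carrier ?S" "y \<in> carrier ?S" "z \<in> carrier ?S" for x y z
        unfolding add
        by (rule restrict_ext) (use that[THEN cm] in \<open>auto simp: abelian_monoid.a_assoc[OF am]\<close>)
      show "x \<oplus>\<^bsub>?S\<^esub> y = y \<oplus>\<^bsub>?S\<^esub> x" if "x \<in> carrier ?S" "y \<in> carrier ?S" for x y
        unfolding add
        by (rule restrict_ext) (use that[THEN cm] in \<open>auto simp: abelian_monoid.a_comm[OF am]\<close>)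
    qed (auto simp: carr add zero intro!: abelian_monoid.a_closed[OF am] abelian_monoid.zero_closed[OF am])
    show "\<one>\<^bsub>R\<^esub> \<odot>\<^bsub>?S\<^esub> x = x" if x: "x \<in> carrier ?S" for x
      unfolding smult
      by (rule PiE_ext[of _ I "\<lambda>i. carrier (M i)"])
        (use x cm[OF x] in \<open>auto simp: carr module.smult_one[OF mm]\<close>)
    show "(a \<otimes>\<^bsub>R\<^esub> b) \<odot>\<^bsub>?S\<^esub> x = a \<odot>\<^bsub>?S\<^esub> (b \<odot>\<^bsub>?S\<^esub> x)"
      if "a \<in> carrier R" "b \<in> carrier R" "x \<in> carrier ?S" for a b x
      unfolding smult
      by (rule restrict_ext) (use that that(3)[THEN cm] in \<open>auto simp: module.smult_assoc1[OF mm]\<close>)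
    show "(a \<oplus>\<^bsub>R\<^esub> b) \<odot>\<^bsub>?S\<^esub> x = a \<odot>\<^bsub>?S\<^esub> x \<oplus>\<^bsub>?S\<^esub> b \<odot>\<^bsub>?S\<^esub> x"
      if "a \<in> carrier R" "b \<in> carrier R" "x \<in> carrier ?S" for a b x
      unfolding smult add
      by (rule restrict_ext) (use that that(3)[THEN cm] in \<open>auto simp: module.smult_l_distr[OF mm]\<close>)
    show "a \<odot>\<^bsub>?S\<^esub> (x \<oplus>\<^bsub>?S\<^esub> y) = a \<odot>\<^bsub>?S\<^esub> x \<oplus>\<^bsub>?S\<^esub> a \<odot>\<^bsub>?S\<^esub> y"
      if "a \<in> carrier R" "x \<in> carrier ?S" "y \<in> carrier ?S" for a x y
      unfolding smult add
      by (rule restrict_ext) (use that that(2,3)[THEN cm] in \<open>auto simp: module.smult_r_distr[OF mm]\<close>)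
  qed (auto simp: carr smult intro!: module.smult_closed[OF mm])
  interpret S: module R ?S by fact
  have ev: "add_map ?S (M i) (\<lambda>x. x i)" if "i \<in> I" for i
    by (intro add_map.intro add_map_axioms.intro S.M.abelian_group_axioms ag[OF that])
      (use that in \<open>auto simp: carr add\<close>)
  have ext: "x = y" if "x \<in> carrier ?S" "y \<in> carrier ?S" "\<And>i. i \<in> I \<Longrightarrow> x i = y i" for x y
    using that by (intro PiE_ext[of x I "\<lambda>i. carrier (M i)"]) (auto simp: carr)
  have "grading ?S (mgrade ?S)"
    unfolding grading_def
  proof (intro conjI allI ballI)
    fix n
    have "\<ominus>\<^bsub>?S\<^esub> x \<in> mgrade ?S n" if x: "x \<in> mgrade ?S n" for x
    proof -
      have xc: "x \<in> carrier ?S" using x D_c by (auto simp: grade carr PiE_iff)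
      have "(\<ominus>\<^bsub>?S\<^esub> x) i = \<ominus>\<^bsub>M i\<^esub> x i" if "i \<in> I" for i by (rule add_map.map_minus[OF ev[OF that] xc])
      moreover have "\<ominus>\<^bsub>?S\<^esub> x \<in> extensional I" using S.M.a_inv_closed[OF xc] by (auto simp: carr PiE_iff)
      ultimately show ?thesis using x graded_group.D_minus[OF gg] by (auto simp: grade PiE_iff)
    qed
    moreover have "x \<oplus>\<^bsub>?S\<^esub> y \<in> mgrade ?S n" if "x \<in> mgrade ?S n" "y \<in> mgrade ?S n" for x y
      using that by (auto simp: grade add intro!: graded_group.D_add[OF gg])
    moreover have "mgrade ?S n \<subseteq> carrier ?S"
      unfolding grade carr by (rule PiE_mono) (use D_c in auto)
    moreover have "\<zero>\<^bsub>?S\<^esub> \<in> mgrade ?S n"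
      using graded_group.D_zero[OF gg] by (auto simp: grade zero)
    ultimately show "additive_subgroup (mgrade ?S n) ?S"
      by (intro additive_subgroup.intro subgroup.intro) (simp_all add: a_inv_def[symmetric] subset_iff)
  next
    fix x assume x: "x \<in> carrier ?S"
    have xi: "x i \<in> carrier (M i)" if "i \<in> I" for i using x that by (auto simp: carr)
    let ?c = "\<lambda>n. \<lambda>i\<in>I. gcomp (M i) (mgrade (M i)) (x i) n"
    have cm: "?c n \<in> mgrade ?S n" for n
      using graded_group.gcomp_D[OF gg] xi by (auto simp: grade)
    have gS: "y \<in> carrier ?S" if "y \<in> mgrade ?S n" for y n
      using that D_c by (auto simp: grade carr PiE_iff)
    let ?A = "{n. ?c n \<noteq> \<zero>\<^bsub>?S\<^esub>}"
    have "?A \<subseteq> (\<Union>i\<in>I. {n. gcomp (M i) (mgrade (M i)) (x i) n \<noteq> \<zero>\<^bsub>M i\<^esub>})"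
      by (auto simp: zero intro!: restrict_ext)
    then have finA: "finite ?A"
      by (rule finite_subset) (use fin xi graded_group.gcomp_finite[OF gg] in blast)
    have sumc: "finsum ?S ?c ?A \<in> carrier ?S"
      by (rule S.M.finsum_closed) (use gS[OF cm] in blast)
    have "x = finsum ?S ?c ?A"
    proof (rule ext[OF x sumc])
      fix i assume i: "i \<in> I"
      have "(finsum ?S ?c ?A) i = finsum (M i) (\<lambda>n. ?c n i) ?A"
        by (rule add_map.map_finsum[OF ev[OF i]]) (use gS[OF cm] in blast)
      also have "(\<lambda>n. ?c n i) = gcomp (M i) (mgrade (M i)) (x i)" using i by auto
      also have "finsum (M i) \<dots> ?A = x i"
        by (rule graded_group.gcomp_sum[OF gg[OF i] xi[OF i] finA, symmetric])
          (use i in \<open>auto simp: zero dest!: fun_cong[of _ _ i]\<close>)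
      finally show "x i = (finsum ?S ?c ?A) i" by (rule sym)
    qed
    then have "hom_decomp ?S (mgrade ?S) x ?c"
      unfolding hom_decomp_def using cm finA by blast
    moreover have "c = ?c" if c: "hom_decomp ?S (mgrade ?S) x c" for c
    proof
      fix n
      have cm': "c n \<in> mgrade ?S n" for n using c by (auto simp: hom_decomp_def)
      have "gcomp (M i) (mgrade (M i)) (x i) = (\<lambda>n. c n i)" if i: "i \<in> I" for i
      proof (rule graded_group.gcomp_eqI[OF gg[OF i]])
        show "finite {n. c n \<noteq> \<zero>\<^bsub>?S\<^esub>}" using c by (auto simp: hom_decomp_def)
        show "c n i \<in> mgrade (M i) n" for n using cm' i by (auto simp: grade)
        show "c n i = \<zero>\<^bsub>M i\<^esub>" if "n \<notin> {n. c n \<noteq> \<zero>\<^bsub>?S\<^esub>}" for n using that i by (simp add: zero)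
        have "x = finsum ?S c {n. c n \<noteq> \<zero>\<^bsub>?S\<^esub>}" using c by (auto simp: hom_decomp_def)
        then show "x i = finsum (M i) (\<lambda>n. c n i) {n. c n \<noteq> \<zero>\<^bsub>?S\<^esub>}"
          using add_map.map_finsum[OF ev[OF i], of "{n. c n \<noteq> \<zero>\<^bsub>?S\<^esub>}" c] gS[OF cm'] by simp
      qed
      then show "c n = ?c n" using gS[OF cm'] gS[OF cm] by (intro ext) auto
    qed
    ultimately show "\<exists>!c. hom_decomp ?S (mgrade ?S) x c" by blast
  qed
  moreover obtain n0 where "\<forall>n<n0. mgrade ?S n = {\<zero>\<^bsub>?S\<^esub>}"
  proof -
    have "\<forall>i\<in>I. \<exists>m. \<forall>n<m. mgrade (M i) n = {\<zero>\<^bsub>M i\<^esub>}"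
      using graded_module.bounded_below[OF M] by blast
    then obtain m where m: "\<And>i n. i \<in> I \<Longrightarrow> n < m i \<Longrightarrow> mgrade (M i) n = {\<zero>\<^bsub>M i\<^esub>}" by metis
    \<comment> \<open>Inserting \<open>0\<close> keeps the minimum meaningful for empty
      \<open>I\<close>.\<close>
    have "mgrade ?S n = {\<zero>\<^bsub>?S\<^esub>}" if "n < Min (insert 0 (m ` I))" for n
    proof -
      have "mgrade (M i) n = {\<zero>\<^bsub>M i\<^esub>}" if i: "i \<in> I" for i
        by (rule m[OF i]) (use \<open>n < _\<close> fin i in auto)
      then have "mgrade ?S n = (\<Pi>\<^sub>E i\<in>I. {\<zero>\<^bsub>M i\<^esub>})" unfolding grade by (rule PiE_cong)
      also have "\<dots> = {\<zero>\<^bsub>?S\<^esub>}" by (auto simp: zero PiE_iff fun_eq_iff extensional_def)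
      finally show ?thesis .
    qed
    then show ?thesis using that by blast
  qed
  moreover have "a \<odot>\<^bsub>?S\<^esub> x \<in> mgrade ?S (i + j)" if "a \<in> rgrade R i" "x \<in> mgrade ?S j" for a x i j
    using that by (auto simp: grade smult intro!: graded_module.smult_grade[OF M])
  ultimately show ?thesis
    by (intro graded_moduleI[where lo = n0, OF R mod])
qed

section \<open>Free modules and finite presentation\<close>

lemma (in graded_group) graded_group_shift: "graded_group G (\<lambda>n. D (n - d))"
proof -
  have "\<exists>!c. hom_decomp G (\<lambda>n. D (n - d)) x c" if x: "x \<in> carrier G" for x
  proof (rule ex1I)
    let ?A = "{m. gcomp G D x m \<noteq> \<zero>}" and ?c = "\<lambda>n. gcomp G D x (n - d)"
    have A: "{n. ?c n \<noteq> \<zero>} = (\<lambda>m. m + d) ` ?A"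
    proof
      show "{n. ?c n \<noteq> \<zero>} \<subseteq> (\<lambda>m. m + d) ` ?A"
      proof
        fix n assume "n \<in> {n. ?c n \<noteq> \<zero>}"
        then show "n \<in> (\<lambda>m. m + d) ` ?A" by (intro image_eqI[of _ _ "n - d"]) auto
      qed
    qed auto
    have "finsum G ?c ((\<lambda>m. m + d) ` ?A) = finsum G (\<lambda>m. ?c (m + d)) ?A"
      by (rule finsum_reindex) (use x in \<open>auto simp: inj_on_def\<close>)
    also have "\<dots> = x" using gcomp_sum[OF x gcomp_finite[OF x]] by simp
    finally show "hom_decomp G (\<lambda>n. D (n - d)) x ?c"
      unfolding hom_decomp_def A using x gcomp_finite[OF x] by simp
  next
    fix c assume c: "hom_decomp G (\<lambda>n. D (n - d)) x c"
    let ?B = "{n. c n \<noteq> \<zero>}"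
    have cD: "c (m + d) \<in> D m" for m using c by (auto simp: hom_decomp_def dest: spec[of _ "m + d"])
    have cc: "c n \<in> carrier G" for n using cD[of "n - d"] by auto
    have "gcomp G D x = (\<lambda>m. c (m + d))"
    proof (rule gcomp_eqI)
      show "finite ((\<lambda>n. n - d) ` ?B)" using c by (simp add: hom_decomp_def)
      show "c (m + d) = \<zero>" if "m \<notin> (\<lambda>n. n - d) ` ?B" for m
      proof (rule ccontr)
        assume "c (m + d) \<noteq> \<zero>"
        then have "m + d - d \<in> (\<lambda>n. n - d) ` ?B" by blast
        then show False using that by simp
      qed
      have "finsum G (\<lambda>m. c (m + d)) ((\<lambda>n. n - d) ` ?B) = finsum G (\<lambda>n. c (n - d + d)) ?B"
        by (rule finsum_reindex) (use cc in \<open>auto simp: inj_on_def\<close>)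
      also have "\<dots> = x" using c by (simp add: hom_decomp_def)
      finally show "x = finsum G (\<lambda>m. c (m + d)) ((\<lambda>n. n - d) ` ?B)" by simp
    qed (rule cD)
    then show "c = (\<lambda>n. gcomp G D x (n - d))" by simp
  qed
  then show ?thesis
    by unfold_locales (auto simp: grading_def D_subgroup)
qed

text \<open>The free module of rank one with generator in degree \<open>d\<close>, often written
  R(-d). Non-negativity of \<open>R\<close> bounds it below by \<open>d\<close>.\<close>

definition regular_module ::
    "('a, 'r) graded_ring_scheme \<Rightarrow> int \<Rightarrow> ('a, 'a) graded_module" where
  "regular_module R d =
     \<lparr>carrier = carrier R, monoid.mult = undefined, one = undefined, ring.zero = \<zero>\<^bsub>R\<^esub>,
      add = add R, smult = monoid.mult R, mgrade = (\<lambda>n. rgrade R (n - d))\<rparr>"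

text \<open>\<open>free_module\<close> with its \<open>i\<close>-th basis vector placed in degree
  \<open>e i\<close>. The grading makes the relations of homogeneous elements a homogeneous
  submodule, to which \<open>homogeneous_generators\<close> applies.\<close>

definition graded_free ::
    "('a, 'r) graded_ring_scheme \<Rightarrow> nat \<Rightarrow> (nat \<Rightarrow> int) \<Rightarrow> ('a, nat \<Rightarrow> 'a) graded_module" where
  "graded_free R n e = direct_sum_module {..<n} (\<lambda>i. regular_module R (e i))"

context graded_ring begin

lemma regular_graded_module:
  assumes "\<forall>n<0. rgrade R n = {\<zero>}"
  shows "graded_module R (regular_module R d)" (is "graded_module R ?M")
proof -
  have M: "carrier ?M = carrier R" "\<zero>\<^bsub>?M\<^esub> = \<zero>" "add ?M = add R" "smult ?M = monoid.mult R"
    "mgrade ?M = (\<lambda>n. rgrade R (n - d))"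
    by (auto simp: regular_module_def)
  have mod: "module R ?M"
  proof (rule moduleI)
    show "abelian_group ?M"
    proof (rule abelian_groupI)
      show "\<exists>y\<in>carrier ?M. y \<oplus>\<^bsub>?M\<^esub> x = \<zero>\<^bsub>?M\<^esub>" if "x \<in> carrier ?M" for x
        using that by (auto simp: M intro!: bexI[of _ "\<ominus> x"] l_neg)
    qed (auto simp: M a_ac)
  qed (auto simp: M is_cring l_distr r_distr m_assoc)
  interpret M: module R ?M by fact
  interpret i: add_map ?M R "\<lambda>x. x" by unfold_locales (auto simp: M)
  have "grading ?M (mgrade ?M)"
    by (rule i.grading_inj[OF gr.graded_group_shift[of d]])
      (auto simp: M inj_on_def intro: graded_group.gcomp_closed[OF gr.graded_group_shift[of d]])
  then show ?thesis
    by (intro graded_moduleI[where lo = d, OF graded_ring_axioms mod])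
      (use assms mult_grade in \<open>auto simp: M add_diff_eq[symmetric]\<close>)
qed

lemma graded_free_module:
  "\<forall>n<0. rgrade R n = {\<zero>} \<Longrightarrow> graded_module R (graded_free R n e)"
  unfolding graded_free_def
  by (rule direct_sum_graded_module[OF graded_ring_axioms]) (auto intro: regular_graded_module)

end

lemma graded_free_simps:
  "carrier (graded_free R n e) = (\<Pi>\<^sub>E i\<in>{..<n}. carrier R)"
  "ring.zero (graded_free R n e) = (\<lambda>i\<in>{..<n}. \<zero>\<^bsub>R\<^esub>)"
  "add (graded_free R n e) = (\<lambda>x y. \<lambda>i\<in>{..<n}. x i \<oplus>\<^bsub>R\<^esub> y i)"
  "smult (graded_free R n e) = (\<lambda>a x. \<lambda>i\<in>{..<n}. a \<otimes>\<^bsub>R\<^esub> x i)"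
  "mgrade (graded_free R n e) d = (\<Pi>\<^sub>E i\<in>{..<n}. rgrade R (d - e i))"
  by (simp_all add: graded_free_def direct_sum_module_def regular_module_def)

lemma free_module_simps:
  "carrier (free_module R n) = (\<Pi>\<^sub>E i\<in>{..<n}. carrier R)"
  "ring.zero (free_module R n) = (\<lambda>i\<in>{..<n}. \<zero>\<^bsub>R\<^esub>)"
  "add (free_module R n) = (\<lambda>x y. \<lambda>i\<in>{..<n}. x i \<oplus>\<^bsub>R\<^esub> y i)"
  "smult (free_module R n) = (\<lambda>a x. \<lambda>i\<in>{..<n}. a \<otimes>\<^bsub>R\<^esub> x i)"
  by (simp_all add: free_module_def)

lemma lin_graded_free: "i < n \<Longrightarrow> lin (graded_free R n e) m s b i = comb R m b s i"
  unfolding lin_def comb_def by (induction m) (auto simp: graded_free_simps)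

lemma lin_free: "i < n \<Longrightarrow> lin (free_module R n) m s b i = comb R m b s i"
  unfolding lin_def comb_def by (induction m) (auto simp: free_module_simps)

lemma (in cring) free_module_module: "module R (free_module R n)"
proof (rule moduleI)
  show "abelian_group (free_module R n)"
  proof (rule abelian_groupI)
    show "\<exists>y\<in>carrier (free_module R n). y \<oplus>\<^bsub>free_module R n\<^esub> x = \<zero>\<^bsub>free_module R n\<^esub>"
      if x: "x \<in> carrier (free_module R n)" for x
      by (rule bexI[of _ "\<lambda>i\<in>{..<n}. \<ominus> x i"])
        (use x in \<open>auto simp: free_module_simps PiE_iff intro!: restrict_ext l_neg\<close>)
  qed (auto simp: free_module_simps PiE_iff a_ac extensional_def intro!: restrict_ext)
qed (auto simp: free_module_simps PiE_iff is_cring l_distr r_distr m_assoc extensional_def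
      intro!: restrict_ext)

section \<open>Relation modules and finite presentation\<close>

context module begin

lemma lin_hom_free:
  assumes "\<And>i. i < n \<Longrightarrow> u i \<in> carrier M"
  shows "lin M n u \<in> mod_hom R (free_module R n) M"
proof -
  have "lin M n u (x \<oplus>\<^bsub>free_module R n\<^esub> y) = lin M n u x \<oplus>\<^bsub>M\<^esub> lin M n u y"
    if "x \<in> carrier (free_module R n)" "y \<in> carrier (free_module R n)" for x y
  proof -
    have "lin M n u (x \<oplus>\<^bsub>free_module R n\<^esub> y) = lin M n u (\<lambda>i. x i \<oplus> y i)"
      by (rule lin_cong) (auto simp: free_module_simps)
    also have "\<dots> = lin M n u x \<oplus>\<^bsub>M\<^esub> lin M n u y"
      by (rule lin_add) (use assms that in \<open>auto simp: free_module_simps\<close>)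
    finally show ?thesis .
  qed
  moreover have "lin M n u (a \<odot>\<^bsub>free_module R n\<^esub> x) = a \<odot>\<^bsub>M\<^esub> lin M n u x"
    if "a \<in> carrier R" "x \<in> carrier (free_module R n)" for a x
  proof -
    have "lin M n u (a \<odot>\<^bsub>free_module R n\<^esub> x) = lin M n u (\<lambda>i. a \<otimes> x i)"
      by (rule lin_cong) (auto simp: free_module_simps)
    also have "\<dots> = a \<odot>\<^bsub>M\<^esub> lin M n u x"
      by (rule lin_smult) (use assms that in \<open>auto simp: free_module_simps\<close>)
    finally show ?thesis .
  qed
  moreover have "lin M n u x \<in> carrier M" if "x \<in> carrier (free_module R n)" for x
    by (rule lin_closed) (use assms that in \<open>auto simp: free_module_simps\<close>)
  ultimately show ?thesis by (auto simp: mod_hom_def)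
qed

context
  fixes n :: nat and u
  assumes u: "\<And>i. i < n \<Longrightarrow> u i \<in> carrier M"
begin

interpretation f: lin_map R "free_module R n" M "lin M n u"
  by (intro lin_map.intro lin_map_axioms.intro R.free_module_module module_axioms lin_hom_free[OF u])

abbreviation (input) "relations \<equiv> a_kernel (free_module R n) M (lin M n u)"

lemma mem_relations_iff:
  "a \<in> relations \<longleftrightarrow> a \<in> extensional {..<n} \<and> (\<forall>i<n. a i \<in> carrier R) \<and> lin M n u a = \<zero>\<^bsub>M\<^esub>"
  by (auto simp: a_kernel_def kernel_def free_module_simps PiE_iff)

text \<open>In \<open>syz_gen\<close> only the values below \<open>n\<close> count, whereas elements
  of \<open>free_module\<close> are extensional functions; restriction passes from one convention to
  the other.\<close>

lemma restrict_mem_relations: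
  assumes "\<forall>i<n. a i \<in> carrier R" "lin M n u a = \<zero>\<^bsub>M\<^esub>"
  shows "restrict a {..<n} \<in> relations"
proof -
  have "lin M n u (restrict a {..<n}) = lin M n u a" by (rule lin_cong) auto
  then show ?thesis using assms by (simp add: mem_relations_iff)
qed

lemma submodule_relations: "submodule relations R (free_module R n)"
  by (rule f.M.submoduleI) (auto simp: a_kernel_def kernel_def f.map_add f.map_minus f.map_smult)

lemma syz_gen_imp_relations:
  assumes s: "syz_gen R M n u m s"
  shows "relations = lspan R (free_module R n) m (\<lambda>k. restrict (s k) {..<n})"
proof
  let ?F = "free_module R n" and ?s = "\<lambda>k. restrict (s k) {..<n}"
  have sK: "?s k \<in> relations" if "k < m" for k
    by (rule restrict_mem_relations) (use s that in \<open>auto simp: syz_gen_def\<close>)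
  show "lspan R ?F m ?s \<subseteq> relations" by (rule f.M.lspan_least[OF submodule_relations sK])
  show "relations \<subseteq> lspan R ?F m ?s"
  proof
    fix a assume a: "a \<in> relations"
    then have ac: "\<forall>i<n. a i \<in> carrier R" "lin M n u a = \<zero>\<^bsub>M\<^esub>" by (auto simp: mem_relations_iff)
    obtain b where b: "\<forall>k<m. b k \<in> carrier R" "\<forall>i<n. a i = comb R m b s i"
      by (rule syz_genE[OF s ac])
    have "lin ?F m ?s b \<in> carrier ?F"
      by (rule f.M.lin_closed) (use b sK f.M.submoduleE(1)[OF submodule_relations] in auto)
    then have "a = lin ?F m ?s b"
    proof (intro extensionalityI[of _ "{..<n}"])
      show "a i = lin ?F m ?s b i" if "i \<in> {..<n}" for i
      proof -
        have "a i = comb R m b s i" using b that by simp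
        also have "\<dots> = comb R m b ?s i" by (rule comb_cong) (use that in auto)
        finally show ?thesis using that by (simp add: lin_free)
      qed
    qed (use a in \<open>auto simp: mem_relations_iff free_module_simps PiE_iff\<close>)
    then show "a \<in> lspan R ?F m ?s" using b by (auto simp: lspan_def)
  qed
qed

lemma relations_imp_syz_gen:
  assumes s: "\<forall>k<m. s k \<in> relations" "relations = lspan R (free_module R n) m s"
  shows "syz_gen R M n u m s"
proof -
  have "\<exists>b. (\<forall>k<m. b k \<in> carrier R) \<and> (\<forall>i<n. a i = comb R m b s i)"
    if a: "\<forall>i<n. a i \<in> carrier R" "lin M n u a = \<zero>\<^bsub>M\<^esub>" for a
  proof -
    obtain b where b: "\<forall>k<m. b k \<in> carrier R" "restrict a {..<n} = lin (free_module R n) m s b"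
      using restrict_mem_relations[OF a] unfolding s(2) by (auto simp: lspan_def)
    have "a i = comb R m b s i" if "i < n" for i
      using fun_cong[OF b(2), of i] that by (simp add: lin_free)
    with b(1) show ?thesis by blast
  qed
  moreover have "\<forall>k<m. (\<forall>i<n. s k i \<in> carrier R) \<and> lin M n u (s k) = \<zero>\<^bsub>M\<^esub>"
    using s(1) by (auto simp: mem_relations_iff)
  ultimately show ?thesis by (auto simp: syz_gen_def)
qed

lemma syz_gen_kernel:
  "(\<exists>m s. syz_gen R M n u m s) \<longleftrightarrow>
    finitely_generated R ((free_module R n)\<lparr>carrier := relations\<rparr>)"
  unfolding f.M.finitely_generated_sub_iff[OF submodule_relations]
proof
  assume "\<exists>m s. syz_gen R M n u m s"
  then obtain m s where s: "syz_gen R M n u m s" by blast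
  let ?s = "\<lambda>k. restrict (s k) {..<n}"
  have "\<forall>k<m. ?s k \<in> relations"
    using restrict_mem_relations s by (simp add: syz_gen_def)
  with syz_gen_imp_relations[OF s]
  show "\<exists>m s. (\<forall>k<m. s k \<in> relations) \<and> relations = lspan R (free_module R n) m s"
    by (intro exI[of _ m] exI[of _ ?s]) blast
qed (use relations_imp_syz_gen in blast)

end

text \<open>A linear map out of a free module is \<open>lin\<close> of the images of the unit
  vectors, so presentations correspond to generating tuples with finitely generated
  relations.\<close>

lemma finitely_presented_iff:
  "finitely_presented R M \<longleftrightarrow> (\<exists>n u. (\<forall>i<n. u i \<in> carrier M) \<and> carrier M = lspan R M n u \<and>
      (\<exists>m s. syz_gen R M n u m s))"
proof
  assume "finitely_presented R M"
  then obtain n f where f: "f \<in> mod_hom R (free_module R n) M"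
    "f ` carrier (free_module R n) = carrier M"
    "finitely_generated R ((free_module R n)\<lparr>carrier := a_kernel (free_module R n) M f\<rparr>)"
    by (auto simp: finitely_presented_def)
  let ?F = "free_module R n"
  interpret F: module R ?F by (rule R.free_module_module)
  interpret f: lin_map R ?F M f by unfold_locales (rule f(1))
  define e where "e j = (\<lambda>i\<in>{..<n}. if i = j then \<one> else \<zero>)" for j
  have e: "e j \<in> carrier ?F" for j by (auto simp: e_def free_module_simps)
  have fe: "f a = lin M n (\<lambda>j. f (e j)) a" if a: "a \<in> carrier ?F" for a
  proof -
    have ac: "a i \<in> carrier R" if "i < n" for i using a that by (auto simp: free_module_simps)
    have "a = lin ?F n e a"
    proof (rule extensionalityI[of _ "{..<n}"])
      show "a i = lin ?F n e a i" if "i \<in> {..<n}" for i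
      proof -
        have "comb R n a e i = sumn R n (\<lambda>k. if k = i then a i else \<zero>)"
          unfolding comb_def by (rule sumn_cong) (use ac that in \<open>auto simp: e_def\<close>)
        also have "\<dots> = a i" by (rule R.sumn_delta) (use ac that in auto)
        finally show ?thesis using that by (simp add: lin_free)
      qed
      have "lin ?F n e a \<in> carrier ?F" by (rule F.lin_closed) (use e ac in auto)
      then show "lin ?F n e a \<in> extensional {..<n}" by (auto simp: free_module_simps PiE_iff)
    qed (use a in \<open>auto simp: free_module_simps PiE_iff\<close>)
    then have "f a = f (lin ?F n e a)" by simp
    also have "\<dots> = lin M n (\<lambda>j. f (e j)) a" by (rule f.map_lin) (use e ac in auto)
    finally show ?thesis .
  qed
  have u: "f (e j) \<in> carrier M" for j using e by auto
  have "a_kernel ?F M f = a_kernel ?F M (lin M n (\<lambda>j. f (e j)))"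
    using fe by (auto simp: a_kernel_def kernel_def)
  then have "\<exists>m s. syz_gen R M n (\<lambda>j. f (e j)) m s"
    using f(3) syz_gen_kernel[of n "\<lambda>j. f (e j)"] u by auto
  moreover have "carrier M = lspan R M n (\<lambda>j. f (e j))"
  proof
    show "carrier M \<subseteq> lspan R M n (\<lambda>j. f (e j))"
    proof
      fix x assume "x \<in> carrier M"
      then obtain a where a: "a \<in> carrier ?F" "x = f a" using f(2) by auto
      then have "x = lin M n (\<lambda>j. f (e j)) a" using fe by simp
      then show "x \<in> lspan R M n (\<lambda>j. f (e j))"
        using a unfolding lspan_def by (auto simp: free_module_simps)
    qed
    show "lspan R M n (\<lambda>j. f (e j)) \<subseteq> carrier M" by (rule lspan_subset) (rule u)
  qed
  ultimately show "\<exists>n u. (\<forall>i<n. u i \<in> carrier M) \<and> carrier M = lspan R M n u \<and>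
      (\<exists>m s. syz_gen R M n u m s)"
    using u by (intro exI[of _ n] exI[of _ "\<lambda>j. f (e j)"]) auto
next
  assume "\<exists>n u. (\<forall>i<n. u i \<in> carrier M) \<and> carrier M = lspan R M n u \<and>
      (\<exists>m s. syz_gen R M n u m s)"
  then obtain n u where u: "\<forall>i<n. u i \<in> carrier M" "carrier M = lspan R M n u"
    "\<exists>m s. syz_gen R M n u m s" by blast
  have "lin M n u ` carrier (free_module R n) = lspan R M n u"
  proof
    show "lin M n u ` carrier (free_module R n) \<subseteq> lspan R M n u"
      by (auto simp: lspan_def free_module_simps)
    show "lspan R M n u \<subseteq> lin M n u ` carrier (free_module R n)"
    proof
      fix x assume "x \<in> lspan R M n u"
      then obtain a where a: "\<forall>i<n. a i \<in> carrier R" "x = lin M n u a" by (auto simp: lspan_def)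
      have "x = lin M n u (restrict a {..<n})" unfolding a by (rule lin_cong) auto
      then show "x \<in> lin M n u ` carrier (free_module R n)"
        using a by (intro image_eqI[of _ _ "restrict a {..<n}"]) (auto simp: free_module_simps)
    qed
  qed
  then show "finitely_presented R M"
    unfolding finitely_presented_def
    using u lin_hom_free[of n u] syz_gen_kernel[of n u]
    by (intro exI[of _ n] exI[of _ "lin M n u"]) auto
qed

text \<open>Schanuel's argument: finite generation of the relations does not depend on the
  generating tuple.\<close>

lemma syz_gen_change:
  assumes v: "\<And>j. j < p \<Longrightarrow> v j \<in> carrier M" "lspan R M p v = V" and s: "syz_gen R M p v K s"
    and u: "\<And>i. i < n \<Longrightarrow> u i \<in> carrier M" "lspan R M n u = V"
  shows "\<exists>m t. syz_gen R M n u m t"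
proof -
  note sc = syz_gen_carrier[OF s] and s0 = syz_gen_zero[OF s]
  \<comment> \<open>The two tuples span the same submodule: \<open>P\<close> and \<open>Q\<close>
    are matrices with v = P u and u = Q v.\<close>
  have "\<exists>a. (\<forall>i<n. a i \<in> carrier R) \<and> v j = lin M n u a" if "j < p" for j
    using lspan_gen[of p v j] v that unfolding v(2) u(2)[symmetric] by (auto simp: lspan_def)
  then obtain P where Pc: "\<And>j i. j < p \<Longrightarrow> i < n \<Longrightarrow> P j i \<in> carrier R"
    and P: "\<And>j. j < p \<Longrightarrow> v j = lin M n u (P j)" by metis
  have "\<exists>a. (\<forall>j<p. a j \<in> carrier R) \<and> u i = lin M p v a" if "i < n" for i
    using lspan_gen[of n u i] u that unfolding u(2) v(2)[symmetric] by (auto simp: lspan_def)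
  then obtain Q where Qc: "\<And>i j. i < n \<Longrightarrow> j < p \<Longrightarrow> Q i j \<in> carrier R"
    and Q: "\<And>i. i < n \<Longrightarrow> u i = lin M p v (Q i)" by metis
  have linP: "lin M n u (comb R p b P) = lin M p v b" if b: "\<And>j. j < p \<Longrightarrow> b j \<in> carrier R" for b
  proof -
    have "lin M n u (comb R p b P) = lin M p (\<lambda>j. lin M n u (P j)) b"
      by (rule lin_comb) (use u b Pc in auto)
    also have "\<dots> = lin M p v b" by (rule lin_cong) (use P in auto)
    finally show ?thesis .
  qed
  have cP: "comb R p b P i \<in> carrier R" if "\<And>j. j < p \<Longrightarrow> b j \<in> carrier R" "i < n" for b i
    by (rule R.comb_closed) (use that Pc in auto)
  \<comment> \<open>The rows of 1 - Q P and of s P are relations of \<open>u\<close>; together they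
    generate all relations.\<close>
  define T where "T k i = (if i = k then \<one> else \<zero>) \<ominus> comb R p (Q k) P i" for k i
  define t where "t l = (if l < n then T l else comb R p (s (l - n)) P)" for l
  have Tc: "T k i \<in> carrier R" if "k < n" "i < n" for k i
    unfolding T_def using cP[of "Q k" i] Qc that by auto
  have "\<forall>i<n. t l i \<in> carrier R" if "l < n + K" for l
    using that Tc cP[of "s (l - n)"] sc by (auto simp: t_def)
  moreover have "lin M n u (t l) = \<zero>\<^bsub>M\<^esub>" if l: "l < n + K" for l
  proof (cases "l < n")
    case True
    have "lin M n u (T l) = lin M n u (\<lambda>i. if i = l then \<one> else \<zero>) \<ominus>\<^bsub>M\<^esub> lin M n u (comb R p (Q l) P)"
      unfolding T_def by (rule lin_diff) (use u cP[of "Q l"] Qc True in auto)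
    also have "\<dots> = u l \<ominus>\<^bsub>M\<^esub> u l"
      using linP[of "Q l"] Qc Q True lin_unit[of n u l] u by simp
    also have "\<dots> = \<zero>\<^bsub>M\<^esub>" using u True by (simp add: M.minus_eq_zero_iff)
    finally show ?thesis using True by (simp add: t_def)
  next
    case False
    then show ?thesis using linP[of "s (l - n)"] sc s0 l by (simp add: t_def)
  qed
  moreover have "\<exists>b. (\<forall>l<n+K. b l \<in> carrier R) \<and> (\<forall>i<n. a i = comb R (n + K) b t i)"
    if a: "\<forall>i<n. a i \<in> carrier R" "lin M n u a = \<zero>\<^bsub>M\<^esub>" for a
  proof -
    let ?b = "comb R n a Q"
    have bc: "?b j \<in> carrier R" if "j < p" for j by (rule R.comb_closed) (use a Qc that in auto)
    have "lin M p v ?b = lin M n (\<lambda>i. lin M p v (Q i)) a"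
      by (rule lin_comb) (use v a Qc in auto)
    also have "\<dots> = lin M n u a" by (rule lin_cong) (use Q in auto)
    finally have "lin M p v ?b = \<zero>\<^bsub>M\<^esub>" using a by simp
    then obtain c where c: "\<forall>l<K. c l \<in> carrier R" "\<forall>j<p. ?b j = comb R K c s j"
      using s bc unfolding syz_gen_def by blast
    \<comment> \<open>From a = a (1 - Q P) + (a Q) P, where a Q is a relation of \<open>v\<close>
      and hence equals c s.\<close>
    let ?c = "\<lambda>l. if l < n then a l else c (l - n)"
    have "a i = comb R (n + K) ?c t i" if i: "i < n" for i
    proof -
      have "comb R (n + K) ?c t i
          = comb R n ?c t i \<oplus> sumn R K (\<lambda>l. ?c (n + l) \<otimes> t (n + l) i)"
        unfolding comb_def using a c Tc cP[of "s _"] sc i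
        by (intro R.sumn_append) (auto simp: t_def)
      also have "comb R n ?c t i = comb R n a T i"
        by (rule comb_cong) (auto simp: t_def)
      also have "sumn R K (\<lambda>l. ?c (n + l) \<otimes> t (n + l) i) = comb R K c (\<lambda>l. comb R p (s l) P) i"
        unfolding comb_def[of R K] by (rule sumn_cong) (auto simp: t_def)
      also have "\<dots> = comb R p (comb R K c s) P i"
        by (rule R.comb_assoc[symmetric]) (use c sc Pc i in auto)
      also have "\<dots> = comb R p ?b P i" by (rule comb_cong) (use c in auto)
      also have "comb R n a T i = a i \<ominus> comb R n a (\<lambda>k. comb R p (Q k) P) i"
      proof -
        have "comb R n a T i = sumn R n (\<lambda>k. (if k = i then a i else \<zero>) \<oplus> \<ominus> (a k \<otimes> comb R p (Q k) P i))"
          unfolding comb_def[of R n]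
          by (rule sumn_cong)
            (use a cP[of "Q _" i] Qc i in \<open>auto simp: T_def R.minus_eq R.r_distr R.r_minus\<close>)
        also have "\<dots> = sumn R n (\<lambda>k. if k = i then a i else \<zero>) \<oplus>
            sumn R n (\<lambda>k. \<ominus> (a k \<otimes> comb R p (Q k) P i))"
          by (rule R.sumn_add) (use a cP[of "Q _" i] Qc i in auto)
        also have "sumn R n (\<lambda>k. if k = i then a i else \<zero>) = a i"
          by (rule R.sumn_delta) (use a i in auto)
        also have "sumn R n (\<lambda>k. \<ominus> (a k \<otimes> comb R p (Q k) P i)) = \<ominus> comb R n a (\<lambda>k. comb R p (Q k) P) i"
          unfolding comb_def[of R n] by (rule R.sumn_minus) (use a cP[of "Q _" i] Qc i in auto)
        finally show ?thesis by (simp add: R.minus_eq)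
      qed
      also have "comb R n a (\<lambda>k. comb R p (Q k) P) i = comb R p ?b P i"
        by (rule R.comb_assoc[symmetric]) (use a Qc Pc i in auto)
      finally show ?thesis using a i cP[of ?b i] bc by simp
    qed
    then show ?thesis by (intro exI[of _ ?c]) (use a c in auto)
  qed
  ultimately have "syz_gen R M n u (n + K) t" unfolding syz_gen_def by blast
  then show ?thesis by blast
qed

end

section \<open>The coherence conditions in terms of tuples\<close>

lemma syz_gen_eq:
  "\<lbrakk>add M = add N; ring.zero M = ring.zero N; smult M = smult N\<rbrakk> \<Longrightarrow>
    syz_gen R M n u m s = syz_gen R N n u m s"
  unfolding syz_gen_def using lin_eq[of M N n u] by simp

context graded_module begin

lemma lin_graded_hom_free:
  assumes nonneg: "\<forall>n<0. rgrade R n = {\<zero>}" and u: "\<And>i. i < n \<Longrightarrow> u i \<in> mgrade M (e i)"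
  shows "graded_lin_map R (graded_free R n e) M (lin M n u)"
proof -
  have uc: "u i \<in> carrier M" if "i < n" for i using u that by blast
  have "lin M n u \<in> mod_hom R (graded_free R n e) M"
    using lin_hom_free[of n u, OF uc] by (simp add: mod_hom_def free_module_simps graded_free_simps)
  moreover have "lin M n u a \<in> mgrade M d" if "a \<in> mgrade (graded_free R n e) d" for a d
    by (rule lin_D[OF u]) (use that in \<open>auto simp: graded_free_simps\<close>)
  ultimately show ?thesis
    by (intro graded_lin_map.intro graded_lin_map_axioms.intro graded_free_module[OF nonneg]
        graded_module_axioms) (auto simp: graded_hom_def)
qed

text \<open>The relations are the kernel of a degree-preserving map from a graded free module, hence
  a homogeneous submodule; the components of any finite generating set generate it too.\<close>

lemma homogeneous_syz:
  assumes nonneg: "\<forall>n<0. rgrade R n = {\<zero>}" and u: "\<And>i. i < n \<Longrightarrow> u i \<in> mgrade M (e i)"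
    and s: "syz_gen R M n u m s"
  shows "\<exists>m eps s. (\<forall>k<m. \<forall>i<n. s k i \<in> rgrade R (eps k - e i)) \<and> syz_gen R M n u m s"
proof -
  let ?F = "graded_free R n e"
  interpret f: graded_lin_map R ?F M "lin M n u" by (rule lin_graded_hom_free[OF nonneg u])
  have uc: "u i \<in> carrier M" if "i < n" for i using u[OF that] by blast
  let ?K = "a_kernel (free_module R n) M (lin M n u)" and ?s = "\<lambda>k. restrict (s k) {..<n}"
  have span: "lspan R ?F m v = lspan R (free_module R n) m v" for m v
    by (rule lspan_eq) (simp_all add: free_module_simps graded_free_simps)
  have K: "?K = lspan R ?F m ?s"
    unfolding span by (rule syz_gen_imp_relations[OF _ s]) (rule uc)
  have Kf: "?K = {x \<in> carrier ?F. lin M n u x = \<zero>\<^bsub>M\<^esub>}"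
    by (simp add: a_kernel_def kernel_def free_module_simps graded_free_simps)
  have sF: "?s k \<in> carrier ?F" if "k < m" for k
    using s that by (auto simp: syz_gen_def graded_free_simps)
  have "gcomp ?F (mgrade ?F) x d \<in> ?K" if "x \<in> ?K" for x d
    using that f.map_gcomp[of x d] by (auto simp: Kf)
  from f.M.homogeneous_generators[OF sF K this]
  obtain m' eps t where t: "\<forall>k<m'. t k \<in> mgrade ?F (eps k)" "?K = lspan R ?F m' t" by blast
  have "t k \<in> ?K" if "k < m'" for k
    unfolding t(2) by (rule f.M.M.lspan_gen) (use t(1) that f.M.gm.D_carrier in auto)
  then have "syz_gen R M n u m' t"
    by (intro relations_imp_syz_gen) (use uc t(2) span in auto)
  moreover have "\<forall>k<m'. \<forall>i<n. t k i \<in> rgrade R (eps k - e i)"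
    using t(1) by (auto simp: graded_free_simps)
  ultimately show ?thesis by blast
qed

text \<open>Forward: a homogeneous tuple spans a homogeneous submodule, whose presentation may use
  other generators; \<open>syz_gen_change\<close> carries it to the given tuple and
  \<open>homogeneous_syz\<close> restores homogeneity. Backward: a finitely generated homogeneous
  submodule has finitely many homogeneous generators.\<close>

lemma graded_coherent_iff:
  assumes nonneg: "\<forall>n<0. rgrade R n = {\<zero>}"
  shows "graded_coherent R M \<longleftrightarrow> hom_fg R M \<and> hom_syz_fg R M"
proof
  assume coh: "graded_coherent R M"
  then have "finitely_generated R M" by (simp add: graded_coherent_def)
  then obtain n u where u: "\<forall>i<n. u i \<in> carrier M" "carrier M = lspan R M n u"
    unfolding finitely_generated_iff by blast
  have "\<exists>m e v. (\<forall>i<m. v i \<in> mgrade M (e i)) \<and> carrier M = lspan R M m v"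
    by (rule homogeneous_generators[of n u]) (use u(1) in \<open>simp_all add: u(2)[symmetric]\<close>)
  then have "hom_fg R M" unfolding hom_fg_def by blast
  moreover have "hom_syz_fg R M"
    unfolding hom_syz_fg_def
  proof (intro allI impI)
    fix n :: nat and e u assume u: "\<forall>i<n. u i \<in> mgrade M (e i)"
    have uD: "u i \<in> mgrade M (e i)" if "i < n" for i using u that by blast
    have uc: "u i \<in> carrier M" if "i < n" for i using uD[OF that] by blast
    let ?V = "lspan R M n u" and ?N = "M\<lparr>carrier := lspan R M n u\<rparr>"
    have V: "submodule ?V R M" by (rule lspan_submodule[OF uc])
    interpret N: module R ?N by (rule submodule.submodule_is_module[OF V module_axioms])
    have span: "lspan R ?N n' u' = lspan R M n' u'" for n' u' by (rule lspan_eq) auto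
    have uV: "u i \<in> ?V" if "i < n" for i by (rule lspan_gen) (use uc that in auto)
    have "homogeneous_submodule ?V R M"
      unfolding homogeneous_submodule_def
    proof (intro conjI ballI allI V)
      fix x d assume "x \<in> ?V"
      then obtain a where a: "\<forall>i<n. a i \<in> carrier R" "x = lin M n u a" by (auto simp: lspan_def)
      have "hcomp M x d = lin M n u (\<lambda>i. gr.part (a i) (d - e i))"
        unfolding a(2) hcomp_def gcomp_def[symmetric] by (rule gcomp_lin) (use uD a in auto)
      then show "hcomp M x d \<in> ?V" using a by (auto simp: lspan_def)
    qed
    moreover have "finitely_generated R ?N"
      unfolding finitely_generated_sub_iff[OF V] using uV by blast
    ultimately have "finitely_presented R ?N" using coh by (simp add: graded_coherent_def)
    then obtain p v K s where v: "\<forall>j<p. v j \<in> ?V" "?V = lspan R ?N p v" "syz_gen R ?N p v K s"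
      unfolding N.finitely_presented_iff by auto
    have "\<exists>m t. syz_gen R ?N n u m t"
      by (rule N.syz_gen_change[of p v ?V K s]) (use v uV span in auto)
    then obtain m t where st: "syz_gen R M n u m t" using syz_gen_eq[of ?N M R] by auto
    show "\<exists>m eps s. (\<forall>k<m. \<forall>i<n. s k i \<in> rgrade R (eps k - e i)) \<and> syz_gen R M n u m s"
      by (rule homogeneous_syz[OF nonneg _ st]) (rule uD)
  qed
  ultimately show "hom_fg R M \<and> hom_syz_fg R M" ..
next
  assume *: "hom_fg R M \<and> hom_syz_fg R M"
  then obtain n e u where u: "\<forall>i<n. u i \<in> mgrade M (e i)" "carrier M = lspan R M n u"
    by (auto simp: hom_fg_def)
  have "finitely_generated R M"
    unfolding finitely_generated_iff using u gm.D_carrier by blast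
  moreover have "finitely_presented R (M\<lparr>carrier := V\<rparr>)"
    if V: "homogeneous_submodule V R M" "finitely_generated R (M\<lparr>carrier := V\<rparr>)" for V
  proof -
    let ?N = "M\<lparr>carrier := V\<rparr>"
    have subV: "submodule V R M" and hom: "\<And>x d. x \<in> V \<Longrightarrow> gm.part x d \<in> V"
      using V(1) by (auto simp: homogeneous_submodule_def hcomp_def gcomp_def)
    have VM: "V \<subseteq> carrier M" by (rule submoduleE(1)[OF subV])
    interpret N: module R ?N by (rule submodule.submodule_is_module[OF subV module_axioms])
    obtain n u where u: "\<forall>i<n. u i \<in> V" "V = lspan R M n u"
      using V(2) unfolding finitely_generated_sub_iff[OF subV] by blast
    have "\<exists>m e v. (\<forall>i<m. v i \<in> mgrade M (e i)) \<and> V = lspan R M m v"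
      by (rule homogeneous_generators[of n u]) (use u VM hom in auto)
    then obtain m e v where v: "\<forall>i<m. v i \<in> mgrade M (e i)" "V = lspan R M m v" by blast
    have vD: "v i \<in> mgrade M (e i)" if "i < m" for i using v(1) that by blast
    have vc: "v i \<in> carrier M" if "i < m" for i using vD[OF that] by blast
    have vV: "v i \<in> V" if "i < m" for i unfolding v(2) by (rule lspan_gen) (use vc that in auto)
    obtain p eps s where "\<forall>k<p. \<forall>i<m. s k i \<in> rgrade R (eps k - e i)" "syz_gen R M m v p s"
      by (rule hom_syzE[OF conjunct2[OF *] vD])
    then have "syz_gen R ?N m v p s" using syz_gen_eq[of ?N M R] by simp
    moreover have "lspan R ?N m v = V" unfolding v(2) by (rule lspan_eq) auto
    ultimately show ?thesis unfolding N.finitely_presented_iff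
      using vV by (intro exI[of _ m] exI[of _ v]) auto
  qed
  ultimately show "graded_coherent R M"
    unfolding graded_coherent_def using graded_module_axioms by blast
qed

section \<open>Groebner bases and filtration bases\<close>

lemma mdeg_eq:
  assumes "x \<in> gm.F d" "gm.part x d \<noteq> \<zero>\<^bsub>M\<^esub>"
  shows "mdeg M x = d" "init_term M x = gm.part x d"
proof -
  have x: "x \<in> carrier M" using assms(1) by blast
  have "Max {n. gm.part x n \<noteq> \<zero>\<^bsub>M\<^esub>} = d"
  proof (rule Max_eqI)
    show "finite {n. gm.part x n \<noteq> \<zero>\<^bsub>M\<^esub>}" by (rule gm.gcomp_finite[OF x])
    show "n \<le> d" if "n \<in> {n. gm.part x n \<noteq> \<zero>\<^bsub>M\<^esub>}" for n
      using that gm.F_top_zero[OF assms(1), of n] by force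
  qed (use assms in auto)
  then show d: "mdeg M x = d" by (simp add: mdeg_def hcomp_def gcomp_def)
  have "x \<noteq> \<zero>\<^bsub>M\<^esub>" using assms(2) by auto
  then show "init_term M x = gm.part x d"
    by (simp add: init_term_def d) (simp add: hcomp_def gcomp_def)
qed

text \<open>For zero, \<open>mdeg\<close> is the maximum of the empty set, an unspecified integer,
  but both claims hold whatever its value.\<close>

lemma init_term_top:
  assumes x: "x \<in> carrier M"
  shows "x \<in> gm.F (mdeg M x)" "init_term M x = gm.part x (mdeg M x)"
proof -
  have "x \<in> gm.F (mdeg M x) \<and> init_term M x = gm.part x (mdeg M x)"
  proof (cases "x = \<zero>\<^bsub>M\<^esub>")
    case False
    let ?A = "{n. gm.part x n \<noteq> \<zero>\<^bsub>M\<^esub>}"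
    have fin: "finite ?A" by (rule gm.gcomp_finite[OF x])
    have "?A \<noteq> {}" using gm.gcomp_ext[OF x M.zero_closed] False by auto
    then have m: "Max ?A \<in> ?A" using fin by (rule Max_in[rotated])
    have "x \<in> gm.F (Max ?A)" unfolding fil_def using x Max_ge[OF fin] by force
    with m show ?thesis using mdeg_eq[of x "Max ?A"] by auto
  qed (auto simp: init_term_def)
  then show "x \<in> gm.F (mdeg M x)" "init_term M x = gm.part x (mdeg M x)" by auto
qed

text \<open>Division algorithm: the top part of an element of \<open>V\<close> is a combination of
  initial terms of \<open>B\<close>, and subtracting the same combination of the \<open>y j\<close>
  lowers the degree. The coefficients stay within the degrees allowed by the weights
  \<open>e j\<close>.\<close>

lemma groebner_basis_imp_fil_basis:
  assumes V: "submodule V R M" and B: "finite B" "groebner_basis R M V B"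
  shows "\<exists>m y e. fil_basis R M V m y e"
proof -
  have VM: "V \<subseteq> carrier M" by (rule submoduleE(1)[OF V])
  from finite_enum[OF B(1)] obtain m y where By: "B = y ` {..<m::nat}" by (elim exE)
  have yV: "y j \<in> V" if "j < m" for j using B(2) By that by (auto simp: groebner_basis_def)
  have yc: "y j \<in> carrier M" if "j < m" for j using yV[OF that] VM by blast
  define e where "e j = mdeg M (y j)" for j
  define w where "w j = init_term M (y j)" for j
  have yF: "y j \<in> gm.F (e j)" and wy: "w j = gm.part (y j) (e j)" if "j < m" for j
    unfolding e_def w_def using init_term_top[OF yc[OF that]] by auto
  have wD: "w j \<in> mgrade M (e j)" if "j < m" for j using wy[OF that] yc[OF that] by simp
  have wc: "w j \<in> carrier M" if "j < m" for j using wD[OF that] by blast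
  have "init_term M ` B = w ` {..<m}" by (auto simp: By w_def)
  then have W: "lspan R M m w = init_submodule R M V"
    using B(2) submodule_span_lspan[of m w] wc by (auto simp: groebner_basis_def)
  have in_W: "init_term M z \<in> lspan R M m w" if "z \<in> V" "z \<noteq> \<zero>\<^bsub>M\<^esub>" for z
    unfolding W init_submodule_def submodule_span_def
    by (rule subsetD[OF hull_subset]) (use that in blast)
  obtain lo where lo: "\<forall>n<lo. mgrade M n = {\<zero>\<^bsub>M\<^esub>}" using bounded_below by blast
  have low: "z = \<zero>\<^bsub>M\<^esub>" if "z \<in> gm.F d" "d < lo" for z d
  proof (rule gm.gcomp_ext)
    fix n
    show "gm.part z n = gm.part \<zero>\<^bsub>M\<^esub> n"
    proof (cases "d < n")
      case False
      then have "mgrade M n = {\<zero>\<^bsub>M\<^esub>}" using lo that(2) by auto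
      then show ?thesis using gm.gcomp_D[of z n] that(1) by auto
    qed (use gm.F_top_zero[OF that(1)] in auto)
  qed (use that in auto)
  have zero_mem: "\<zero>\<^bsub>M\<^esub> \<in> filspan R M m y e d" for d
    unfolding filspan_def by (intro CollectI exI[of _ "\<lambda>_. \<zero>"]) (auto simp: lin_zero yc)
  \<comment> \<open>Below \<open>lo\<close> the module vanishes, so at level \<open>lo - 1\<close>
    only zero is left and the induction starts there.\<close>
  have main: "z \<in> filspan R M m y e (lo - 1 + int q)" if "z \<in> V" "z \<in> gm.F (lo - 1 + int q)" for z q
    using that
  proof (induction q arbitrary: z)
    case 0
    then have "z = \<zero>\<^bsub>M\<^esub>" using low[of z "lo - 1"] by simp
    then show ?case using zero_mem by simp
  next
    case (Suc q)
    define d where "d = lo - 1 + int (Suc q)"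
    have zF: "z \<in> gm.F d" using Suc.prems d_def by simp
    have zc: "z \<in> carrier M" using zF by blast
    have "gm.part z d \<in> lspan R M m w"
    proof (cases "gm.part z d = \<zero>\<^bsub>M\<^esub>")
      case True
      then show ?thesis using lspan_zero[of m w] wc by simp
    next
      case False
      moreover have "z \<noteq> \<zero>\<^bsub>M\<^esub>" using False by auto
      ultimately show ?thesis using mdeg_eq(2)[OF zF] in_W[OF Suc.prems(1)] by simp
    qed
    then obtain b where b: "\<forall>j<m. b j \<in> carrier R" "gm.part z d = lin M m w b"
      by (auto simp: lspan_def)
    \<comment> \<open>The \<open>w j\<close> are homogeneous, so only the components of
      \<open>b j\<close> of degree \<open>d - e j\<close> contribute in degree
      \<open>d\<close>.\<close>
    define t where "t j = gr.part (b j) (d - e j)" for j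
    have tD: "t j \<in> rgrade R (d - e j)" if "j < m" for j using b(1) that by (simp add: t_def)
    have tF: "t j \<in> gr.F (d - e j)" if "j < m" for j by (rule gr.D_F[OF tD[OF that]]) simp
    have tc: "t j \<in> carrier R" if "j < m" for j using tD[OF that] by blast
    have "gm.part z d \<in> mgrade M d" using zc by simp
    then have "gm.part z d = gm.part (gm.part z d) d"
      by (simp add: gm.gcomp_homog)
    also have "\<dots> = lin M m w t"
      unfolding b(2) t_def by (rule gcomp_lin) (use wD b in auto)
    finally have zt: "gm.part z d = lin M m w t" .
    have lF: "lin M m y t \<in> gm.F d" by (rule lin_F[OF yF tF])
    have lc: "lin M m y t \<in> carrier M" using lF by blast
    have "gm.part (lin M m y t) d
        = lin M m (\<lambda>j. gm.part (y j) (e j)) (\<lambda>j. gr.part (t j) (d - e j))"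
      by (rule gcomp_lin_top[OF yF tF])
    also have "\<dots> = lin M m w t"
      by (rule lin_cong) (simp_all add: wy gr.gcomp_homog[OF tD])
    finally have "gm.part (z \<ominus>\<^bsub>M\<^esub> lin M m y t) d = \<zero>\<^bsub>M\<^esub>"
      using zt zc lc wc tc by (simp add: gm.gcomp_diff M.minus_eq_zero_iff)
    then have "z \<ominus>\<^bsub>M\<^esub> lin M m y t \<in> gm.F (d - 1)"
      using gm.F_pred zF lF by blast
    moreover have "lin M m y t \<in> V" by (rule submodule_lin[OF V yV tc])
    then have "z \<ominus>\<^bsub>M\<^esub> lin M m y t \<in> V"
      unfolding a_minus_def using submoduleE(3,5)[OF V] Suc.prems(1) by blast
    ultimately have "z \<ominus>\<^bsub>M\<^esub> lin M m y t \<in> filspan R M m y e (lo - 1 + int q)"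
      using Suc.IH[of "z \<ominus>\<^bsub>M\<^esub> lin M m y t"] by (simp add: d_def algebra_simps)
    then obtain a where a: "\<forall>j<m. a j \<in> gr.F (lo - 1 + int q - e j)"
      "z \<ominus>\<^bsub>M\<^esub> lin M m y t = lin M m y a" by (auto simp: filspan_def)
    have ac: "a j \<in> carrier R" if "j < m" for j using a(1) that by blast
    have "z = lin M m y a \<oplus>\<^bsub>M\<^esub> lin M m y t"
      unfolding a(2)[symmetric] using zc lc by simp
    also have "\<dots> = lin M m y (\<lambda>j. a j \<oplus> t j)" by (rule lin_add[symmetric, OF yc ac tc])
    finally have "z = lin M m y (\<lambda>j. a j \<oplus> t j)" .
    moreover have "a j \<oplus> t j \<in> gr.F (d - e j)" if "j < m" for j
      using a(1) that tF[OF that] gr.F_mono[of "a j" "lo - 1 + int q - e j" "d - e j"]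
      by (auto simp: d_def)
    ultimately show ?case unfolding filspan_def d_def by blast
  qed
  have "V \<inter> gm.F d \<subseteq> filspan R M m y e d" for d
  proof
    fix z assume z: "z \<in> V \<inter> gm.F d"
    show "z \<in> filspan R M m y e d"
    proof (cases "d < lo")
      case True
      then show ?thesis using z low zero_mem by auto
    next
      case False
      then have "d = lo - 1 + int (nat (d - lo + 1))" by simp
      then show ?thesis using main[of z "nat (d - lo + 1)"] z by simp
    qed
  qed
  then have "fil_basis R M V m y e" unfolding fil_basis_def using yV yF by blast
  then show ?thesis by blast
qed

text \<open>An element \<open>z\<close> is a combination of the \<open>y j\<close> within weight
  \<open>mdeg M z\<close>, that is, without cancellation above its own degree; its initial term is
  then the combination of top parts given by \<open>gcomp_lin_top\<close>.\<close>

lemma fil_basis_imp_groebner_basis: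
  assumes V: "submodule V R M" and fb: "fil_basis R M V m y e"
  shows "groebner_basis R M V (y ` {..<m})"
proof -
  have VM: "V \<subseteq> carrier M" by (rule submoduleE(1)[OF V])
  have yV: "y j \<in> V" and yF: "y j \<in> gm.F (e j)" if "j < m" for j
    using fb that by (auto simp: fil_basis_def)
  have yc: "y j \<in> carrier M" if "j < m" for j using yF[OF that] by blast
  define w where "w j = init_term M (y j)" for j
  have wc: "w j \<in> carrier M" if "j < m" for j
    unfolding w_def using init_term_top[OF yc[OF that]] yc[OF that] by simp
  have W: "submodule (lspan R M m w) R M" by (rule lspan_submodule[OF wc])
  have wW: "w j \<in> lspan R M m w" if "j < m" for j by (rule lspan_gen) (use wc that in auto)
  \<comment> \<open>If the weight exceeds the degree of \<open>y j\<close> this part is zero;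
    otherwise it is the initial term of \<open>y j\<close>.\<close>
  have top: "gm.part (y j) (e j) \<in> lspan R M m w" if j: "j < m" for j
  proof (cases "gm.part (y j) (e j) = \<zero>\<^bsub>M\<^esub>")
    case True
    then show ?thesis using lspan_zero[of m w] wc by simp
  next
    case False
    then show ?thesis using mdeg_eq(2)[OF yF[OF j]] wW[OF j] by (simp add: w_def)
  qed
  have "submodule_span R M (init_term M ` (V - {\<zero>\<^bsub>M\<^esub>})) \<subseteq> lspan R M m w"
    unfolding submodule_span_def
  proof (rule hull_minimal, rule image_subsetI)
    show "submodule (lspan R M m w) R M" by (rule W)
    fix z assume z: "z \<in> V - {\<zero>\<^bsub>M\<^esub>}"
    then have zc: "z \<in> carrier M" using VM by blast
    let ?d = "mdeg M z"
    have "z \<in> filspan R M m y e ?d" using fb z init_term_top(1)[OF zc] unfolding fil_basis_def by blast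
    then obtain a where a: "\<forall>j<m. a j \<in> gr.F (?d - e j)" "z = lin M m y a" by (auto simp: filspan_def)
    have aF: "a j \<in> gr.F (?d - e j)" if "j < m" for j using a(1) that by blast
    have "init_term M z = gm.part z ?d" by (rule init_term_top(2)[OF zc])
    also have "\<dots> = gm.part (lin M m y a) ?d" using a(2) by simp
    also have "\<dots> = lin M m (\<lambda>j. gm.part (y j) (e j)) (\<lambda>j. gr.part (a j) (?d - e j))"
      by (rule gcomp_lin_top[OF yF aF])
    also have "\<dots> \<in> lspan R M m w"
      by (rule submodule_lin[OF W top]) (use aF gr.F_closed in auto)
    finally show "init_term M z \<in> lspan R M m w" .
  qed
  moreover have "lspan R M m w \<subseteq> submodule_span R M (init_term M ` (V - {\<zero>\<^bsub>M\<^esub>}))"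
    unfolding submodule_span_def hull_def
  proof (rule Inter_greatest)
    fix T assume "T \<in> {t. submodule t R M \<and> init_term M ` (V - {\<zero>\<^bsub>M\<^esub>}) \<subseteq> t}"
    then have T: "submodule T R M" "init_term M ` (V - {\<zero>\<^bsub>M\<^esub>}) \<subseteq> T" by auto
    \<comment> \<open>Covers a vanishing \<open>y j\<close>, which \<open>V - {0}\<close> excludes
      although its initial term is listed among the \<open>w j\<close>.\<close>
    have "\<zero>\<^bsub>M\<^esub> \<in> T" using submodule_lin[OF T(1), of 0] by (simp add: lin_def)
    then have "w j \<in> T" if "j < m" for j
      using yV[OF that] T(2) unfolding w_def by (cases "y j = \<zero>\<^bsub>M\<^esub>") (auto simp: init_term_def[of M "\<zero>\<^bsub>M\<^esub>"])
    then show "lspan R M m w \<subseteq> T" by (rule lspan_least[OF T(1)])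
  qed
  moreover have "submodule_span R M (init_term M ` y ` {..<m}) = lspan R M m w"
    using submodule_span_lspan[of m w, OF wc] by (simp add: image_image w_def)
  ultimately show ?thesis using yV by (auto simp: groebner_basis_def init_submodule_def)
qed

lemma groebner_coherent_iff:
  assumes nonneg: "\<forall>n<0. rgrade R n = {\<zero>}"
  shows "groebner_coherent R M \<longleftrightarrow> gcoh R M"
proof -
  have "(\<forall>N. submodule N R M \<and> finitely_generated R (M\<lparr>carrier := N\<rparr>) \<longrightarrow>
            (\<exists>B. finite B \<and> groebner_basis R M N B)) \<longleftrightarrow>
        (\<forall>n x. (\<forall>i<n. x i \<in> carrier M) \<longrightarrow> (\<exists>m y e. fil_basis R M (lspan R M n x) m y e))"
    (is "?L \<longleftrightarrow> ?R")
  proof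
    assume L: ?L
    show ?R
    proof (intro allI impI)
      fix n :: nat and x assume x: "\<forall>i<n. x i \<in> carrier M"
      let ?V = "lspan R M n x"
      have V: "submodule ?V R M" by (rule lspan_submodule) (use x in auto)
      have "\<forall>i<n. x i \<in> ?V" using lspan_gen[of n x] x by blast
      then have "finitely_generated R (M\<lparr>carrier := ?V\<rparr>)"
        unfolding finitely_generated_sub_iff[OF V] by blast
      then obtain B where "finite B" "groebner_basis R M ?V B" using L V by blast
      then show "\<exists>m y e. fil_basis R M ?V m y e" by (rule groebner_basis_imp_fil_basis[OF V])
    qed
  next
    assume R: ?R
    show ?L
    proof (intro allI impI)
      fix N assume N: "submodule N R M \<and> finitely_generated R (M\<lparr>carrier := N\<rparr>)"
      then have V: "submodule N R M" by blast
      obtain n x where x: "\<forall>i<n. x i \<in> N" "N = lspan R M n x"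
        using N unfolding finitely_generated_sub_iff[OF V] by blast
      have "\<forall>i<n. x i \<in> carrier M" using x(1) submoduleE(1)[OF V] by blast
      then have "\<exists>m y e. fil_basis R M (lspan R M n x) m y e" by (rule R[THEN spec, THEN spec, THEN mp])
      then obtain m y e where "fil_basis R M N m y e"
        unfolding x(2)[symmetric] by blast
      from fil_basis_imp_groebner_basis[OF V this]
      show "\<exists>B. finite B \<and> groebner_basis R M N B" by (intro exI[of _ "y ` {..<m}"]) auto
    qed
  qed
  then show ?thesis
    unfolding groebner_coherent_def gcoh_def graded_coherent_iff[OF nonneg]
    using graded_module_axioms by simp
qed

end

lemma (in graded_ring) groebner_coherent_gcoh:
  assumes nonneg: "\<forall>n<0. rgrade R n = {\<zero>}"
  shows "groebner_coherent R M \<longleftrightarrow> gcoh R M"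
proof (cases "graded_module R M")
  case True
  then show ?thesis using graded_module.groebner_coherent_iff nonneg by blast
next
  case False
  then show ?thesis by (simp add: groebner_coherent_def graded_coherent_def gcoh_def)
qed

section \<open>Closure properties\<close>

text \<open>Every coefficient tuple is a relation here, so the unit vectors generate the relations.
  This starts the induction for direct sums.\<close>

lemma (in graded_module) gcoh_zero:
  assumes zero: "carrier M = {\<zero>\<^bsub>M\<^esub>}"
  shows "gcoh R M"
proof -
  have "hom_fg R M" unfolding hom_fg_def
    by (intro exI[of _ 0]) (simp add: zero lspan_def lin_def)
  moreover have "hom_syz_fg R M"
    unfolding hom_syz_fg_def
  proof (intro allI impI)
    fix n :: nat and e u assume "\<forall>i<n. u i \<in> mgrade M (e i)"
    then have uc: "u i \<in> carrier M" if "i < n" for i using that by blast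
    define s :: "nat \<Rightarrow> nat \<Rightarrow> 'a" where "s k i = (if k = i then \<one> else \<zero>)" for k i
    have s: "s k i \<in> rgrade R (e k - e i)" for k i by (simp add: s_def one_grade)
    have "lin M n u (s k) = \<zero>\<^bsub>M\<^esub>" for k
      using lin_closed[of n u "s k"] uc s gr.D_carrier zero by blast
    moreover have "a i = comb R n a s i" if "\<forall>i<n. a i \<in> carrier R" "i < n" for a i
    proof -
      have "comb R n a s i = sumn R n (\<lambda>k. if k = i then a i else \<zero>)"
        unfolding comb_def by (rule sumn_cong) (use that in \<open>auto simp: s_def\<close>)
      also have "\<dots> = a i" by (rule R.sumn_delta) (use that in auto)
      finally show ?thesis ..
    qed
    ultimately have "syz_gen R M n u n s" unfolding syz_gen_def using s gr.D_carrier by blast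
    then show "\<exists>m eps s. (\<forall>k<m. \<forall>i<n. s k i \<in> rgrade R (eps k - e i)) \<and> syz_gen R M n u m s"
      using s by blast
  qed
  moreover have "fil_basis R M (lspan R M n x) 0 x (\<lambda>_. 0)" if "\<forall>i<n. x i \<in> carrier M" for n x
    using lspan_subset[of n x] that zero by (auto simp: fil_basis_def filspan_def lin_def)
  ultimately show ?thesis unfolding gcoh_def using graded_module_axioms by blast
qed

section \<open>Kernels, cokernels, direct sums and extensions\<close>

lemma (in lin_map) a_kernel_eq: "a_kernel M N f = {x \<in> carrier M. f x = \<zero>\<^bsub>N\<^esub>}"
  by (simp add: a_kernel_def kernel_def)

lemma (in lin_map) submodule_kernel: "submodule (a_kernel M N f) R M"
  by (rule M.submoduleI) (auto simp: a_kernel_eq map_add map_minus map_smult)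

lemma (in lin_map) submodule_image: "submodule (f ` carrier M) R N"
proof (rule N.submoduleI)
  show "f ` carrier M \<subseteq> carrier N" by auto
  show "\<zero>\<^bsub>N\<^esub> \<in> f ` carrier M" using map_zero by (metis M.M.zero_closed imageI)
  show "\<ominus>\<^bsub>N\<^esub> y \<in> f ` carrier M" if y: "y \<in> f ` carrier M" for y
  proof -
    obtain x where "x \<in> carrier M" "y = f x" using y by blast
    then show ?thesis using map_minus[of x] by (metis M.M.a_inv_closed imageI)
  qed
  show "y \<oplus>\<^bsub>N\<^esub> z \<in> f ` carrier M" if yz: "y \<in> f ` carrier M" "z \<in> f ` carrier M" for y z
  proof -
    obtain x x' where "x \<in> carrier M" "y = f x" "x' \<in> carrier M" "z = f x'" using yz by blast
    then show ?thesis using map_add[of x x'] by (metis M.M.a_closed imageI)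
  qed
  show "a \<odot>\<^bsub>N\<^esub> y \<in> f ` carrier M" if a: "a \<in> carrier R" "y \<in> f ` carrier M" for a y
  proof -
    obtain x where "x \<in> carrier M" "y = f x" using a by blast
    then show ?thesis using map_smult[of a x] a by (metis M.smult_closed imageI)
  qed
qed

text \<open>The kernel embeds in \<open>M\<close>, so by \<open>gcoh_inj\<close> only its finite
  generation is at stake; that comes from the relations in \<open>N\<close> through
  \<open>ker_hom_fg\<close>.\<close>

lemma gcoh_kernel:
  fixes M :: "('a, 'b) graded_module" and N :: "('a, 'c) graded_module"
  assumes M: "gcoh R M" and N: "gcoh R N" and f: "f \<in> graded_hom R M N"
  shows "gcoh R (kernel_module M N f)"
proof -
  have g: "graded_module R M" "graded_module R N" using M N by (auto simp: gcoh_def)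
  interpret f: graded_lin_map R M N f
    by (intro graded_lin_map.intro graded_lin_map_axioms.intro g f)
  let ?V = "a_kernel M N f" and ?K = "kernel_module M N f"
  have K: "graded_module R ?K" unfolding kernel_module_def
    by (rule graded_module_submodule[OF g(1) f.submodule_kernel])
      (auto simp: f.a_kernel_eq f.map_gcomp[symmetric])
  have Ks: "carrier ?K = ?V" "mgrade ?K n = mgrade M n \<inter> ?V" "add ?K = add M"
    "\<zero>\<^bsub>?K\<^esub> = \<zero>\<^bsub>M\<^esub>" "smult ?K = smult M" for n
    by (simp_all add: kernel_module_def)
  interpret i: graded_lin_map R ?K M "\<lambda>x. x"
    by (intro graded_lin_map.intro graded_lin_map_axioms.intro g K)
      (auto simp: graded_hom_def mod_hom_def Ks f.a_kernel_eq)
  obtain m eps w where w: "\<forall>k<m. w k \<in> mgrade M (eps k) \<and> f (w k) = \<zero>\<^bsub>N\<^esub>"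
    "\<forall>x\<in>carrier M. f x = \<zero>\<^bsub>N\<^esub> \<longrightarrow> x \<in> lspan R M m w"
    using f.ker_hom_fg M N by (auto simp: gcoh_def)
  have wV: "w k \<in> ?V" if "k < m" for k
    using w(1) that f.M.gm.D_carrier by (auto simp: f.a_kernel_eq)
  have "lspan R M m w \<subseteq> ?V" by (rule f.M.M.lspan_least[OF f.submodule_kernel wV])
  moreover have "?V \<subseteq> lspan R M m w" using w(2) by (auto simp: f.a_kernel_eq)
  ultimately have "carrier ?K = lspan R ?K m w"
    using lspan_eq[of ?K M R m w] by (simp add: Ks)
  moreover have "\<forall>k<m. w k \<in> mgrade ?K (eps k)" using w(1) wV by (simp add: Ks)
  ultimately have "hom_fg R ?K" unfolding hom_fg_def by blast
  then show ?thesis by (rule i.gcoh_inj[rotated]) (simp_all add: M)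
qed

text \<open>The kernel of the projection is the image of \<open>f\<close>, generated by the images
  of homogeneous generators of \<open>M\<close>. These form the tuple that \<open>gcoh_surj\<close>
  asks for.\<close>

lemma gcoh_cokernel:
  fixes M :: "('a, 'b) graded_module" and N :: "('a, 'c) graded_module"
  assumes M: "gcoh R M" and N: "gcoh R N" and f: "f \<in> graded_hom R M N"
  shows "gcoh R (cokernel_module M N f)"
proof -
  have g: "graded_module R M" "graded_module R N" using M N by (auto simp: gcoh_def)
  interpret f: graded_lin_map R M N f
    by (intro graded_lin_map.intro graded_lin_map_axioms.intro g f)
  let ?I = "f ` carrier M" and ?Q = "quotient_module N (f ` carrier M)"
  have hom: "gcomp N (mgrade N) x d \<in> ?I" if "x \<in> ?I" for x d
    using that by (auto simp: f.map_gcomp)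
  note q = quotient_graded_module[OF g(2) f.submodule_image hom]
  interpret q: graded_lin_map R N ?Q "\<lambda>x. ?I +>\<^bsub>N\<^esub> x"
    by (intro graded_lin_map.intro graded_lin_map_axioms.intro g q(1,2))
  obtain n e u where u: "\<forall>i<n. u i \<in> mgrade M (e i)" "carrier M = lspan R M n u"
    using M by (auto simp: gcoh_def hom_fg_def)
  have uc: "u i \<in> carrier M" if "i < n" for i using u(1) that f.M.gm.D_carrier by blast
  have I: "?I = lspan R N n (\<lambda>i. f (u i))" using f.map_lspan[of n u, OF uc] u(2) by simp
  have "gcoh R ?Q"
  proof (rule q.gcoh_surj[OF q(3), of n "\<lambda>i. f (u i)" e])
    show "f (u k) \<in> mgrade N (e k)" if "k < n" for k using u(1) that f.map_D by blast
    show "?I +>\<^bsub>N\<^esub> f (u k) = \<zero>\<^bsub>?Q\<^esub>" if "k < n" for k using q(4)[of "f (u k)"] uc[OF that] by auto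
    show "x \<in> lspan R N n (\<lambda>i. f (u i))" if "x \<in> carrier N" "?I +>\<^bsub>N\<^esub> x = \<zero>\<^bsub>?Q\<^esub>" for x
      using q(4)[of x] that I by auto
  qed (simp_all add: N)
  then show ?thesis by (simp add: cokernel_module_def)
qed

text \<open>Adjoining a summand gives an extension of \<open>M i\<close> by the smaller sum,
  embedded through extension by zero, so closure under extension carries the induction on
  \<open>I\<close>.\<close>

lemma gcoh_direct_sum:
  fixes M :: "'i \<Rightarrow> ('a, 'b) graded_module"
  assumes R: "graded_ring R" and nonneg: "\<forall>n<0. rgrade R n = {\<zero>\<^bsub>R\<^esub>}"
    and "finite I" "\<forall>i\<in>I. gcoh R (M i)"
  shows "gcoh R (direct_sum_module I M)"
  using assms(3,4)
proof (induction I)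
  case empty
  have "graded_module R (direct_sum_module {} M)"
    by (rule direct_sum_graded_module[OF R]) auto
  then show ?case
    by (rule graded_module.gcoh_zero) (simp add: direct_sum_module_def restrict_def)
next
  case (insert i I)
  let ?L = "direct_sum_module I M" and ?S = "direct_sum_module (insert i I) M"
  let ?f = "\<lambda>x. \<lambda>j\<in>insert i I. if j = i then \<zero>\<^bsub>M i\<^esub> else x j" and ?g = "\<lambda>x. x i"
  have gm: "graded_module R (M j)" if "j \<in> insert i I" for j using insert.prems that by (auto simp: gcoh_def)
  have L: "graded_module R ?L" by (rule direct_sum_graded_module[OF R insert.hyps(1)]) (use gm in auto)
  have S: "graded_module R ?S" by (rule direct_sum_graded_module[OF R _ gm]) (use insert.hyps in auto)
  interpret i: graded_module R "M i" by (rule gm) simp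
  have f: "?f \<in> graded_hom R ?L ?S"
    using insert.hyps(2)
    by (auto simp: graded_hom_def mod_hom_def direct_sum_module_def PiE_iff fun_eq_iff
        split: if_splits)
  have g: "?g \<in> graded_hom R ?S (M i)"
    by (auto simp: graded_hom_def mod_hom_def direct_sum_module_def)
  have "graded_short_exact R ?L ?S (M i) ?f ?g"
  proof (intro graded_short_exact.intro graded_lin_map.intro graded_lin_map_axioms.intro
      graded_short_exact_axioms.intro L S f g nonneg i.graded_module_axioms)
    show "inj_on ?f (carrier ?L)"
    proof (rule inj_onI)
      fix x y assume xy: "x \<in> carrier ?L" "y \<in> carrier ?L" "?f x = ?f y"
      show "x = y"
      proof (rule PiE_ext[of x I "\<lambda>i. carrier (M i)" y])
        show "x j = y j" if "j \<in> I" for j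
          using fun_cong[OF xy(3), of j] that insert.hyps(2) by (auto split: if_splits)
      qed (use xy in \<open>auto simp: direct_sum_module_def\<close>)
    qed
    show "?f ` carrier ?L = {x \<in> carrier ?S. ?g x = \<zero>\<^bsub>M i\<^esub>}"
    proof (intro equalityI subsetI)
      fix x assume x: "x \<in> {x \<in> carrier ?S. ?g x = \<zero>\<^bsub>M i\<^esub>}"
      then have "restrict x I \<in> carrier ?L" by (auto simp: direct_sum_module_def)
      moreover have "x = ?f (restrict x I)"
        using x by (auto simp: direct_sum_module_def PiE_iff fun_eq_iff extensional_def)
      ultimately show "x \<in> ?f ` carrier ?L" by (intro image_eqI[of x ?f "restrict x I"])
    qed (auto simp: direct_sum_module_def PiE_iff)
    show "?g ` carrier ?S = carrier (M i)"
    proof (intro equalityI subsetI)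
      fix x assume x: "x \<in> carrier (M i)"
      have "\<zero>\<^bsub>M j\<^esub> \<in> carrier (M j)" if j: "j \<in> insert i I" for j
      proof -
        interpret graded_module R "M j" by (rule gm[OF j])
        show ?thesis by simp
      qed
      then have "(\<lambda>j\<in>insert i I. if j = i then x else \<zero>\<^bsub>M j\<^esub>) \<in> carrier ?S"
        using x by (auto simp: direct_sum_module_def)
      then show "x \<in> ?g ` carrier ?S"
        by (intro image_eqI[of x ?g "\<lambda>j\<in>insert i I. if j = i then x else \<zero>\<^bsub>M j\<^esub>"]) simp_all
    qed (auto simp: direct_sum_module_def)
  qed (use insert in auto)
  then show ?case by (rule graded_short_exact.gcoh_ext)
qed

lemma gcoh_extension:
  assumes nonneg: "\<forall>n<0. rgrade R n = {\<zero>\<^bsub>R\<^esub>}"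
    and ex: "short_exact R L M N f g" and "gcoh R L" "gcoh R N"
  shows "gcoh R M"
proof -
  have "f ` carrier L = {x \<in> carrier M. g x = \<zero>\<^bsub>N\<^esub>}"
    using ex by (simp add: short_exact_def a_kernel_def kernel_def)
  then have "graded_short_exact R L M N f g"
    using assms
    by (auto simp: graded_short_exact_def graded_lin_map_def graded_lin_map_axioms_def
        graded_short_exact_axioms_def short_exact_def)
  then show ?thesis by (rule graded_short_exact.gcoh_ext)
qed

theorem corollary4p8:
  fixes R :: "'r graded_ring"
  assumes "graded_ring R"
    and "\<forall>n<0. rgrade R n = {\<zero>\<^bsub>R\<^esub>}"
  shows
    "(\<forall>(M :: ('r, 'm) graded_module) (N :: ('r, 'n) graded_module) f.
        groebner_coherent R M \<and> groebner_coherent R N \<and> f \<in> graded_hom R M N \<longrightarrow>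
          groebner_coherent R (kernel_module M N f) \<and>
          groebner_coherent R (cokernel_module M N f)) \<and>
     (\<forall>(I :: 'i set) (M :: 'i \<Rightarrow> ('r, 'm) graded_module).
        finite I \<and> (\<forall>i\<in>I. groebner_coherent R (M i)) \<longrightarrow>
          groebner_coherent R (direct_sum_module I M)) \<and>
     (\<forall>(M' :: ('r, 'm1) graded_module) (M :: ('r, 'm) graded_module)
        (M'' :: ('r, 'm2) graded_module) f g.
        short_exact R M' M M'' f g \<and> groebner_coherent R M' \<and> groebner_coherent R M'' \<longrightarrow>
          groebner_coherent R M)"
  \<comment> \<open>The equivalence is applied at every module type that occurs, including cosets
    and functions on \<open>I\<close>.\<close>
  unfolding graded_ring.groebner_coherent_gcoh[OF assms]
proof (intro conjI allI impI; elim conjE)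
  fix M :: "('r, 'm) graded_module" and N :: "('r, 'n) graded_module" and f
  assume "gcoh R M" "gcoh R N" "f \<in> graded_hom R M N"
  then show "gcoh R (kernel_module M N f)" "gcoh R (cokernel_module M N f)"
    by (rule gcoh_kernel gcoh_cokernel; assumption)+
next
  fix I :: "'i set" and M :: "'i \<Rightarrow> ('r, 'm) graded_module"
  assume "finite I" "\<forall>i\<in>I. gcoh R (M i)"
  then show "gcoh R (direct_sum_module I M)" by (rule gcoh_direct_sum[OF assms])
next
  fix M' :: "('r, 'm1) graded_module" and M :: "('r, 'm) graded_module"
    and M'' :: "('r, 'm2) graded_module" and f g
  assume "short_exact R M' M M'' f g" "gcoh R M'" "gcoh R M''"
  then show "gcoh R M" by (rule gcoh_extension[OF assms(2)])
qed

end
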